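(* Let $b\ge1$ and $0<\alpha<1$. In the infinite Poisson model, the number $\widetilde U=\widetilde U_\alpha$ of keys inspected in an unsuccessful search starting at bucket $0$ has probability generating function $$\psi_{\widetilde U}(q)=T_0(b\alpha)\,\frac{\prod_{\ell=0}^{b-1}\bigl(q-\zeta_\ell(q^b)\bigr)-\prod_{\ell=0}^{b-1}\bigl(q-\zeta_\ell(1)\bigr)}{1-q^b}.$$ Moreover, for the exact model, as $m,n\to\infty$ with $n/(bm)\to\alpha$, $\widetilde U_{m,n}\to\widetilde U_\alpha$ in distribution with convergence of all moments, and for some $\delta>0$ the probability generating function of $\widetilde U_{m,n}$ converges to $\psi_{\widetilde U}(q)$ uniformly for $|q|\le1+\delta$.
   Context: $T(z)=\sum_{n\ge1}n^{n-1}z^n/n!$, $\omega=e^{2\pi i/b}$; for $|q|\le(e^{\alpha-1}/\alpha)^b$, $\zeta_\ell(q)=T(\omega^\ell\alpha e^{-\alpha}q^{1/b})/\alpha$ (fixed choice of $q^{1/b}$; symmetric expressions do not depend on it); $\zeta_\ell(1)$ uses $1^{1/b}=1$; $T_0(b\alpha)=b(1-\alpha)/\prod_{\ell=1}^{b-1}(1-\zeta_\ell(1))$. Infinite Poisson model: buckets $i\in\mathbb Z$ of capacity $b$, $X_i$ i.i.d. Poisson($\alpha b$), $H_i=b+\max_{j<i}\sum_{k=j+1}^i(X_k-b)$; bucket $i$ stores $Y_i=\min(H_i,b)$ keys and is full iff $H_i\ge b$. With $U_0$ the number of full buckets before the first non-full bucket $k\ge0$ (so $k=U_0$), $\widetilde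 U=bU_0+Y_{k}$. Exact model: $m$ cyclically arranged buckets of capacity $b$, $n<bm$ keys with independent uniform hash addresses, linear probing with wrap-around; $\widetilde U_{m,n}$ is the number of keys inspected in an unsuccessful search starting at a given bucket ($b$ times the number of full buckets passed plus the number of keys in the first non-full bucket). *)

theory Defs
  imports "HOL-Probability.Probability"
begin

text \<open>
  The sum starts at exponent 1; the index is shifted because natural-number subtraction
  would turn the summand of exponent 0 into 1.
\<close>
definition tree_fun :: "complex \<Rightarrow> complex" where
  "tree_fun z = (\<Sum>n. of_nat (Suc n) ^ n / fact (Suc n) * z ^ Suc n)"

text \<open>
  The parameter \<open>rt\<close> is the choice of the \<open>b\<close>-th root; it is to satisfy
  \<open>rt z ^ b = z\<close> for all \<open>z\<close>, and \<open>rt 1 = 1\<close>.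
\<close>
definition zeta :: "nat \<Rightarrow> real \<Rightarrow> (complex \<Rightarrow> complex) \<Rightarrow> nat \<Rightarrow> complex \<Rightarrow> complex" where
  "zeta b \<alpha> rt l q =
     tree_fun (exp (2 * of_real pi * \<i> / of_nat b) ^ l
               * of_real (\<alpha> * exp (- \<alpha>)) * rt q) / of_real \<alpha>"

text \<open>The number \<open>T\<^sub>0(b\<alpha>)\<close>.\<close>
definition T0 :: "nat \<Rightarrow> real \<Rightarrow> (complex \<Rightarrow> complex) \<Rightarrow> complex" where
  "T0 b \<alpha> rt =
     of_nat b * (1 - of_real \<alpha>) / (\<Prod>l\<in>{1..<b}. 1 - zeta b \<alpha> rt l 1)"

definition pgf :: "'a measure \<Rightarrow> ('a \<Rightarrow> nat) \<Rightarrow> complex \<Rightarrow> complex" where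
  "pgf M U q = (LINT \<omega>|M. q ^ U \<omega>)"


section \<open>The infinite Poisson model\<close>

text \<open>
  A configuration \<open>x\<close> gives the number \<open>x i\<close> of keys with hash address \<open>i\<close>, for every bucket
  \<open>i :: int\<close>. The supremum is a maximum whenever the set is bounded above, and the \<open>LEAST\<close> below
  is over a nonempty set whenever some bucket to the right of 0 is not full; for i.i.d.
  Poisson variables of mean \<open>\<alpha> * b\<close> with \<open>\<alpha> < 1\<close> both hold almost surely.
\<close>
definition inf_H :: "nat \<Rightarrow> (int \<Rightarrow> nat) \<Rightarrow> int \<Rightarrow> int" where
  "inf_H b x i = int b + (SUP j\<in>{..<i}. \<Sum>k\<in>{j+1..i}. int (x k) - int b)"

definition inf_Y :: "nat \<Rightarrow> (int \<Rightarrow> nat) \<Rightarrow> int \<Rightarrow> nat" where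
  "inf_Y b x i = nat (min (inf_H b x i) (int b))"

definition inf_full :: "nat \<Rightarrow> (int \<Rightarrow> nat) \<Rightarrow> int \<Rightarrow> bool" where
  "inf_full b x i \<longleftrightarrow> inf_H b x i \<ge> int b"

definition inf_U0 :: "nat \<Rightarrow> (int \<Rightarrow> nat) \<Rightarrow> nat" where
  "inf_U0 b x = (LEAST k. \<not> inf_full b x (int k))"

definition inf_U :: "nat \<Rightarrow> (int \<Rightarrow> nat) \<Rightarrow> nat" where
  "inf_U b x = b * inf_U0 b x + inf_Y b x (int (inf_U0 b x))"


section \<open>The exact model\<close>

text \<open>
  The buckets are \<open>0, \<dots>, m - 1\<close>, arranged cyclically; a state \<open>c\<close> of the table gives the number
  \<open>c i\<close> of keys stored in bucket \<open>i\<close>. A probe starting at bucket \<open>i\<close> passes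
  \<open>full_passed b m c i\<close> full buckets before it meets a non-full one, which exists as long as
  fewer than \<open>b * m\<close> keys are stored.
\<close>
definition full_passed :: "nat \<Rightarrow> nat \<Rightarrow> (nat \<Rightarrow> nat) \<Rightarrow> nat \<Rightarrow> nat" where
  "full_passed b m c i = (LEAST k. c ((i + k) mod m) < b)"

definition first_nonfull :: "nat \<Rightarrow> nat \<Rightarrow> (nat \<Rightarrow> nat) \<Rightarrow> nat \<Rightarrow> nat" where
  "first_nonfull b m c i = (i + full_passed b m c i) mod m"

definition insert_key :: "nat \<Rightarrow> nat \<Rightarrow> (nat \<Rightarrow> nat) \<Rightarrow> nat \<Rightarrow> (nat \<Rightarrow> nat)" where
  "insert_key b m c h = (let j = first_nonfull b m c h in c(j := c j + 1))"

text \<open>The table after inserting keys with the hash addresses \<open>hs\<close>, one after the other.\<close>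
definition hash_table :: "nat \<Rightarrow> nat \<Rightarrow> nat list \<Rightarrow> (nat \<Rightarrow> nat)" where
  "hash_table b m hs = foldl (insert_key b m) (\<lambda>_. 0) hs"

definition exact_U :: "nat \<Rightarrow> nat \<Rightarrow> nat \<Rightarrow> nat list \<Rightarrow> nat" where
  "exact_U b m i hs =
     (let c = hash_table b m hs in b * full_passed b m c i + c (first_nonfull b m c i))"

definition hash_addresses :: "nat \<Rightarrow> nat \<Rightarrow> nat list pmf" where
  "hash_addresses m n = replicate_pmf n (pmf_of_set {..<m})"

end

theory Submission
  imports Defs "HOL-Complex_Analysis.Complex_Analysis" "HOL-Real_Asymp.Real_Asymp"
begin

text \<open>
  In both models the overflow \<open>Q\<close> from bucket to bucket obeys the Lindley recursion
  \<open>Q' = max (Q + X - b) 0\<close>, and a search inspects \<open>u\<close> keys iff the first \<open>u div b\<close> buckets are full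
  and the next one holds \<open>u mod b\<close> keys. Starting the recursion \<open>K\<close> buckets earlier with an
  empty queue changes the outcome only if these \<open>K\<close> buckets are all full, which by Chernoff's
  inequality has probability \<open>O (\<rho> ^ (b * K))\<close> in both models, uniformly in \<open>m\<close>, with
  \<open>\<rho> = a * exp (1 - a) < 1\<close> for any \<open>a < 1\<close> bounding the load. The truncated event depends on finitely many
  hash counts, which are multinomial and hence asymptotically independent Poisson. This gives
  pointwise convergence of the distributions; with the geometric tail bound, dominated convergence
  gives everything else.

  For the generating function, let \<open>e z = exp (\<alpha> * b * (z - 1))\<close> and let \<open>G j z\<close> be the expectation of
  \<open>z ^ Q\<close> after \<open>j\<close> buckets on the event that all of them are full. Then
  \<open>e z * G j z = z ^ b * G (j + 1) z + (\<Sum>y<b. p (b * j + y) * z ^ y)\<close>, where \<open>p\<close> is the distribution of the number of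
  inspected keys, and stationarity gives \<open>(z ^ b - e z) * G 0 z = (\<Sum>s<b. p s * (z ^ b - z ^ s))\<close>. Multiplied by \<open>w ^ j\<close> and
  summed over \<open>j\<close>, the first equation telescopes at the \<open>b\<close> roots \<open>\<zeta>\<close> of \<open>z ^ b = w * e z\<close> in the unit
  disc, which identifies a polynomial in \<open>z\<close> of degree \<open>b\<close> as a multiple of the product of the factors \<open>z - \<zeta>\<close>;
  \<open>w = q ^ b\<close> and \<open>z = q\<close> give the formula for \<open>0 < \<bar>q\<bar> < 1\<close>. It extends to \<open>\<bar>q\<bar> \<le> exp (\<alpha> - 1) / \<alpha>\<close> by analytic
  continuation and, on the boundary circle, by continuity of the right-hand side and nonnegativity of \<open>p\<close>.
\<close>

section \<open>The tree function\<close>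

text \<open>The tree function enters because \<open>T z * exp (- T z) = z\<close> solves the kernel
  equation \<open>z ^ b = w * exp (\<alpha> * b * (z - 1))\<close> once for each \<open>b\<close>-th
  root of \<open>w\<close>. Its argument has modulus
  \<open>\<alpha> * exp (- \<alpha>) * \<bar>q\<bar>\<close>, which reaches the singular value
  \<open>exp (-1)\<close> exactly at \<open>\<bar>q\<bar> = exp (\<alpha> - 1) / \<alpha>\<close>.
  This number is also \<open>1 / rho \<alpha>\<close>, so the Chernoff rate makes the power series
  of \<open>p\<close> converge in just the disc in which the right-hand side is holomorphic; the
  circle itself needs the tree function on its closed disc. The constant \<open>T0\<close> is the
  probability that bucket 0 is not full. It first appears as an unknown leading coefficient and is
  found from the simple zero at \<open>z = 1\<close> of the stationarity equation:
  \<open>G 0 1\<close> is a total mass, hence 1, and the kernel has derivative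
  \<open>b * (1 - \<alpha>)\<close> there. In the exact model the load merely tends to
  \<open>\<alpha>\<close>, so tails are controlled only at the rate of some
  \<open>a > \<alpha>\<close>; this limits the \<open>\<delta>\<close> for which uniform convergence
  is obtained.\<close>

unbundle no vec_syntax

text \<open>This is the \<open>j\<close>-th coefficient of \<open>(1 - exp X) ^ n\<close>, a power series of order \<open>n\<close>.\<close>
lemma alternating_binomial_power_sum:
  fixes n j :: nat
  assumes "j < n"
  shows "(\<Sum>k\<le>n. of_nat (n choose k) * (-1) ^ k * of_nat k ^ j) = (0 :: complex)"
proof -
  define G :: "complex fps" where "G = 1 - fps_exp 1"
  have "G ^ n $ j = 0"
    using assms startsby_zero_power_prefix[of G n] by (auto simp: G_def)
  have "G = - fps_exp 1 + 1" by (simp add: G_def)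
  hence "G ^ n = (\<Sum>k\<le>n. of_nat (n choose k) * (- fps_exp 1) ^ k * 1 ^ (n - k))"
    by (simp only: binomial_ring)
  also have "\<dots> = (\<Sum>k\<le>n. fps_const (of_nat (n choose k) * (-1) ^ k) * fps_exp (of_nat k))"
  proof (intro sum.cong refl)
    fix k
    have "(- fps_exp 1 :: complex fps) ^ k = fps_const ((-1) ^ k) * fps_exp (of_nat k)"
      by (simp add: power_minus[of "fps_exp 1"] fps_exp_power_mult flip: fps_const_neg fps_const_power)
    thus "of_nat (n choose k) * (- fps_exp 1 :: complex fps) ^ k * 1 ^ (n - k)
        = fps_const (of_nat (n choose k) * (-1) ^ k) * fps_exp (of_nat k)"
      by (simp add: fps_of_nat mult.assoc flip: fps_const_mult)
  qed
  finally have "G ^ n $ j = (\<Sum>k\<le>n. of_nat (n choose k) * (-1) ^ k * (of_nat k ^ j / fact j))"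
    by (simp add: fps_sum_nth)
  also have "\<dots> = (\<Sum>k\<le>n. of_nat (n choose k) * (-1) ^ k * of_nat k ^ j) / fact j"
    by (simp add: sum_divide_distrib)
  finally show ?thesis using \<open>G ^ n $ j = 0\<close> by simp
qed

section \<open>Lagrange inversion of the tree series\<close>

definition tree_fps :: "complex fps" where
  "tree_fps = Abs_fps (\<lambda>n. if n = 0 then 0 else of_nat n ^ (n - 1) / fact n)"

text \<open>Up to the factor \<open>(-1) ^ N / fact N\<close>, the coefficient of order
  \<open>N \<ge> 2\<close> is an alternating binomial sum of \<open>n ^ (N - 1)\<close>, an
  \<open>N\<close>-th difference of a polynomial of smaller degree, hence zero.\<close>

lemma tree_fps_compose_left: "tree_fps oo (fps_X * fps_exp (-1)) = fps_X"
proof (rule fps_ext)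
  fix N :: nat
  have *: "(fps_X * fps_exp (-1) :: complex fps) ^ n $ N =
      (if N < n then 0 else (- of_nat n) ^ (N - n) / fact (N - n))" for n
    by (simp add: power_mult_distrib fps_X_power_mult_nth fps_exp_power_mult)
  have S: "(tree_fps oo (fps_X * fps_exp (-1))) $ N =
      (\<Sum>n\<le>N. tree_fps $ n * ((- of_nat n) ^ (N - n) / fact (N - n)))"
    unfolding fps_compose_nth atMost_atLeast0[symmetric]
    by (intro sum.cong refl, subst *) auto
  consider "N = 0" | "N = 1" | "N \<ge> 2" by linarith
  thus "(tree_fps oo (fps_X * fps_exp (-1))) $ N = fps_X $ N"
  proof cases
    case 3
    have "(\<Sum>n\<le>N. tree_fps $ n * ((- of_nat n) ^ (N - n) / fact (N - n)))
        = (\<Sum>n\<le>N. (-1) ^ N / fact N * (of_nat (N choose n) * (-1) ^ n * of_nat n ^ (N - 1)))"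
    proof (intro sum.cong refl)
      fix n assume n: "n \<in> {..N}"
      show "tree_fps $ n * ((- of_nat n) ^ (N - n) / fact (N - n)) =
        (-1) ^ N / fact N * (of_nat (N choose n) * (-1) ^ n * of_nat n ^ (N - 1))"
      proof (cases "n = 0")
        case True
        thus ?thesis using 3 by (simp add: tree_fps_def)
      next
        case False
        have p: "(of_nat n :: complex) ^ (N - Suc 0) = of_nat n ^ (n - Suc 0) * of_nat n ^ (N - n)"
          using n False by (simp flip: power_add)
        have s: "(-1 :: complex) ^ (N - n) = (-1) ^ N * (-1) ^ n"
          using n by (auto simp: minus_one_power_iff)
        have c: "(of_nat (N choose n) :: complex) = fact N / (fact n * fact (N - n))"
          using n by (simp add: binomial_fact)
        show ?thesis
          using False by (simp add: tree_fps_def p c power_minus[of "of_nat n"] s field_simps)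
      qed
    qed
    also have "\<dots> = 0"
      using alternating_binomial_power_sum[of "N - 1" N] 3 by (subst sum_distrib_left[symmetric]) simp
    finally show ?thesis using S 3 by simp
  qed (unfold S, auto simp: tree_fps_def)
qed

text \<open>The inner series has a nonzero linear coefficient, so it has a compositional right
  inverse; by associativity this must be the left inverse \<open>tree_fps\<close>.\<close>

lemma tree_fps_compose_right: "(fps_X * fps_exp (-1)) oo tree_fps = fps_X"
proof -
  define F :: "complex fps" where "F = fps_X * fps_exp (-1)"
  have F: "F $ 0 = 0" "F $ 1 \<noteq> 0" by (auto simp: F_def)
  have t0: "tree_fps $ 0 = 0" by (simp add: tree_fps_def)
  have i0: "fps_inv F $ 0 = 0" by (simp add: fps_inv_def)
  have "tree_fps = tree_fps oo (F oo fps_inv F)"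
    using fps_inv_right[OF F] by simp
  also have "\<dots> = (tree_fps oo F) oo fps_inv F"
    by (rule fps_compose_assoc) (use F i0 in auto)
  also have "\<dots> = fps_inv F"
    using tree_fps_compose_left i0 by (simp add: F_def)
  finally show ?thesis
    using fps_inv_right[OF F] by (simp add: F_def)
qed

section \<open>The analytic tree function and its functional equation\<close>

definition tree_coeff :: "nat \<Rightarrow> real" where
  "tree_coeff n = of_nat (Suc n) ^ n / fact (Suc n)"

lemma tree_coeff_nonneg: "tree_coeff n \<ge> 0"
  by (simp add: tree_coeff_def)

text \<open>\<open>N ^ N / fact N\<close> is a single term of the series of \<open>exp N\<close>.
  This crude bound already yields convergence for all arguments of modulus below
  \<open>exp (-1)\<close>.\<close>

lemma tree_coeff_le: "tree_coeff n \<le> exp 1 ^ Suc n"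
proof -
  have "real (Suc n) ^ n / fact (Suc n) \<le> real (Suc n) ^ Suc n / fact (Suc n)"
    by (intro divide_right_mono power_increasing) auto
  also have "\<dots> \<le> (\<Sum>k. real (Suc n) ^ k / fact k)"
    using sum_le_suminf[of "\<lambda>k. real (Suc n) ^ k / fact k" "{Suc n}"]
      summable_exp_generic[of "real (Suc n)"] by (simp add: divide_inverse mult.commute)
  also have "\<dots> = exp (real (Suc n))"
    by (simp add: exp_def divide_inverse mult.commute)
  also have "\<dots> = exp 1 ^ Suc n"
    by (metis exp_of_nat_mult mult.right_neutral)
  finally show ?thesis by (simp add: tree_coeff_def)
qed

lemma tree_fun_altdef: "tree_fun z = (\<Sum>n. of_real (tree_coeff n) * z ^ Suc n)"
  by (simp add: tree_fun_def tree_coeff_def)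

lemma tree_fps_nth: "tree_fps $ Suc n = of_real (tree_coeff n)"
  by (simp add: tree_fps_def tree_coeff_def)

lemma summable_tree_small:
  assumes "norm (z::complex) < exp (-1)"
  shows "summable (\<lambda>n. norm (of_real (tree_coeff n) * z ^ Suc n))"
proof (rule summable_comparison_test)
  have "exp 1 * norm z < 1"
    using assms by (simp add: exp_minus field_simps)
  hence "summable (\<lambda>n. (exp 1 * norm z) ^ n)"
    by (intro summable_geometric) auto
  thus "summable (\<lambda>n. (exp 1 * norm z) ^ Suc n)"
    by (subst summable_Suc_iff)
  show "\<exists>N. \<forall>n\<ge>N. norm (norm (of_real (tree_coeff n) * z ^ Suc n)) \<le> (exp 1 * norm z) ^ Suc n"
    using tree_coeff_le tree_coeff_nonneg
    by (auto simp: norm_mult norm_power power_mult_distrib simp del: power_Suc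
        intro!: mult_right_mono)
qed

lemma tree_fps_conv_radius: "fps_conv_radius tree_fps \<ge> ereal (exp (-1))"
  unfolding fps_conv_radius_def
proof (rule conv_radius_geI_ex)
  fix r :: real assume r: "0 < r" "ereal r < ereal (exp (-1))"
  have "summable (\<lambda>n. of_real (tree_coeff n) * (of_real r :: complex) ^ Suc n)"
    by (rule summable_norm_cancel, rule summable_tree_small) (use r in auto)
  hence "summable (\<lambda>n. tree_fps $ (Suc n) * (of_real r :: complex) ^ Suc n)"
    by (simp add: tree_fps_nth)
  hence "summable (\<lambda>n. tree_fps $ n * (of_real r :: complex) ^ n)"
    by (subst (asm) summable_Suc_iff)
  thus "\<exists>z. norm z = r \<and> summable (\<lambda>n. tree_fps $ n * z ^ n)"
    using r by (intro exI[of _ "of_real r"]) auto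
qed

lemma eval_tree_fps:
  assumes "norm z < exp (-1)"
  shows "eval_fps tree_fps z = tree_fun z"
proof -
  have "(\<lambda>n. of_real (tree_coeff n) * z ^ Suc n) sums tree_fun z"
    unfolding tree_fun_altdef
    by (rule summable_sums, rule summable_norm_cancel, rule summable_tree_small) fact
  hence "(\<lambda>n. tree_fps $ (Suc n) * z ^ Suc n) sums tree_fun z"
    by (simp add: tree_fps_nth)
  hence "(\<lambda>n. tree_fps $ n * z ^ n) sums (tree_fun z + tree_fps $ 0 * z ^ 0)"
    by (subst (asm) sums_Suc_iff)
  thus ?thesis
    by (simp add: eval_fps_def sums_iff tree_fps_def)
qed

lemma tree_fun_holomorphic: "tree_fun holomorphic_on ball 0 (exp (-1))"
proof -
  have "eval_fps tree_fps holomorphic_on ball 0 (exp (-1))"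
    by (rule holomorphic_on_eval_fps)
      (use tree_fps_conv_radius in \<open>auto simp: eball_def dist_norm intro!: less_le_trans[OF _ tree_fps_conv_radius]\<close>)
  thus ?thesis
    by (rule holomorphic_transform) (auto simp: eval_tree_fps)
qed

text \<open>Formal inversion gives the equation only near 0; the identity theorem carries it to the
  whole disc.\<close>

lemma tree_fun_eq_small:
  assumes "norm z < exp (-1)"
  shows "tree_fun z * exp (- tree_fun z) = z"
proof -
  have T: "tree_fun has_fps_expansion tree_fps"
    unfolding has_fps_expansion_def
  proof
    show "fps_conv_radius tree_fps > 0"
      by (rule less_le_trans[OF _ tree_fps_conv_radius]) auto
    have "eventually (\<lambda>z::complex. z \<in> ball 0 (exp (-1))) (nhds 0)"
      by (intro eventually_nhds_in_open) auto
    thus "eventually (\<lambda>z. eval_fps tree_fps z = tree_fun z) (nhds 0)"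
      by eventually_elim (auto simp: eval_tree_fps)
  qed
  have F: "(\<lambda>w. w * exp (-1 * w)) has_fps_expansion (fps_X * fps_exp (-1 :: complex))"
    by (intro fps_expansion_intros)
  have "((\<lambda>w. w * exp (-1 * w)) \<circ> tree_fun) has_fps_expansion fps_X"
    using has_fps_expansion_compose[OF F T] by (simp add: tree_fps_def[THEN arg_cong, of "\<lambda>f. f $ 0"] tree_fps_compose_right)
  hence ev: "eventually (\<lambda>z. z = tree_fun z * exp (- tree_fun z)) (nhds 0)"
    by (auto simp: has_fps_expansion_def)
  then obtain S where S: "open S" "0 \<in> S" "\<And>z. z \<in> S \<Longrightarrow> z = tree_fun z * exp (- tree_fun z)"
    by (auto simp: eventually_nhds)
  show ?thesis
  proof (rule analytic_continuation_open[of "S \<inter> ball 0 (exp (-1))" "ball 0 (exp (-1))"])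
    show "S \<inter> ball 0 (exp (-1)) \<noteq> {}" using S by auto
    show "(\<lambda>z. tree_fun z * exp (- tree_fun z)) holomorphic_on ball 0 (exp (-1))"
      by (intro holomorphic_intros tree_fun_holomorphic)
  qed (use S assms in auto)
qed

section \<open>Real arguments and the boundary circle\<close>

lemma mul_exp_neg_strict_mono:
  assumes "0 \<le> x" "x < y" "y \<le> (1::real)"
  shows "x * exp (- x) < y * exp (- y)"
proof (rule DERIV_pos_imp_increasing_open[OF assms(2)])
  fix t assume t: "x < t" "t < y"
  have "((\<lambda>t. t * exp (- t)) has_real_derivative (1 - t) * exp (- t)) (at t)"
    by (auto intro!: derivative_eq_intros simp: algebra_simps)
  thus "\<exists>d. ((\<lambda>t. t * exp (- t)) has_real_derivative d) (at t) \<and> 0 < d"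
    using t assms by (intro exI conjI) auto
qed (auto intro!: continuous_intros)

definition tree_real :: "real \<Rightarrow> real" where
  "tree_real x = (\<Sum>n. tree_coeff n * x ^ Suc n)"

lemma tree_fun_of_real_small:
  assumes "\<bar>x\<bar> < exp (-1)"
  shows "tree_fun (of_real x) = of_real (tree_real x)"
proof -
  have "summable (\<lambda>n. norm (of_real (tree_coeff n) * (of_real x::complex) ^ Suc n))"
    by (rule summable_tree_small) (use assms in auto)
  hence "summable (\<lambda>n. norm (tree_coeff n * x ^ Suc n))"
    by (simp add: norm_mult norm_power abs_mult power_abs)
  hence "summable (\<lambda>n. tree_coeff n * x ^ Suc n)"
    by (rule summable_norm_cancel)
  from suminf_of_real[OF this, where 'a = complex] show ?thesis
    by (simp add: tree_fun_altdef tree_real_def)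
qed

text \<open>The values cannot cross 1: by continuity they would equal 1 somewhere, and the
  functional equation would force that argument to be \<open>exp (-1)\<close>, which is excluded.
  Staying below 1 selects the increasing branch of \<open>t * exp (- t)\<close>.\<close>

lemma tree_real_small:
  assumes "0 \<le> x" "x < exp (-1)"
  shows "tree_real x * exp (- tree_real x) = x" "0 \<le> tree_real x" "tree_real x < 1"
proof -
  have eq: "tree_real x * exp (- tree_real x) = x" if "0 \<le> x" "x < exp (-1)" for x
  proof -
    have "complex_of_real (tree_real x * exp (- tree_real x)) = of_real x"
      using tree_fun_eq_small[of "of_real x"] tree_fun_of_real_small[of x] that
      by (simp add: exp_of_real flip: of_real_minus)
    thus ?thesis by (simp only: of_real_eq_iff)
  qed
  show "tree_real x * exp (- tree_real x) = x" by (rule eq) fact+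
  show "0 \<le> tree_real x"
    using eq[OF assms] assms by (metis exp_gt_zero zero_le_mult_iff not_less)
  show "tree_real x < 1"
  proof (rule ccontr)
    assume "\<not> tree_real x < 1"
    have cont: "continuous_on {0..x} tree_real"
    proof -
      have "continuous_on {0..x} (\<lambda>y. Re (tree_fun (of_real y)))"
        by (intro continuous_intros continuous_on_compose2[OF holomorphic_on_imp_continuous_on[OF tree_fun_holomorphic]])
          (use assms in auto)
      thus ?thesis
        by (rule continuous_on_eq) (use assms in \<open>auto simp: tree_fun_of_real_small\<close>)
    qed
    have "tree_real 0 = 0" by (simp add: tree_real_def)
    then obtain y where y: "0 \<le> y" "y \<le> x" "tree_real y = 1"
      using IVT'[of tree_real 0 1 x] cont assms \<open>\<not> tree_real x < 1\<close> by auto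
    have "y = exp (-1)" using eq[of y] y assms by simp
    thus False using y assms by simp
  qed
qed

text \<open>Each partial sum is the left limit of partial sums bounded by
  \<open>tree_real x < 1\<close>; with nonnegative coefficients this gives convergence at the
  endpoint without asymptotics of factorials.\<close>

lemma summable_tree_max: "summable (\<lambda>n. tree_coeff n * exp (-1) ^ Suc n)"
proof (rule bounded_imp_summable)
  show "tree_coeff n * exp (-1) ^ Suc n \<ge> 0" for n by (simp add: tree_coeff_nonneg)
  fix N
  have "((\<lambda>x. \<Sum>n\<le>N. tree_coeff n * x ^ Suc n) \<longlongrightarrow> (\<Sum>n\<le>N. tree_coeff n * exp (-1) ^ Suc n)) (at_left (exp (-1)))"
    by (intro tendsto_intros)
  moreover have "eventually (\<lambda>x. (\<Sum>n\<le>N. tree_coeff n * x ^ Suc n) \<le> 1) (at_left (exp (-1 :: real)))"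
  proof -
    have "eventually (\<lambda>x. x \<in> {0<..<exp (-1)}) (at_left (exp (-1 :: real)))"
      by (intro eventually_at_left_real) auto
    thus ?thesis
    proof eventually_elim
      case (elim x)
      have "summable (\<lambda>n. norm (of_real (tree_coeff n) * (of_real x::complex) ^ Suc n))"
        by (rule summable_tree_small) (use elim in auto)
      hence s: "summable (\<lambda>n. tree_coeff n * x ^ Suc n)"
        using elim by (simp add: norm_mult norm_power tree_coeff_nonneg)
      have "(\<Sum>n\<le>N. tree_coeff n * x ^ Suc n) \<le> tree_real x"
        unfolding tree_real_def
        by (rule sum_le_suminf[OF s]) (use elim tree_coeff_nonneg in auto)
      also have "\<dots> < 1" by (rule tree_real_small) (use elim in auto)
      finally show ?case by simp
    qed
  qed
  ultimately show "(\<Sum>n\<le>N. tree_coeff n * exp (-1) ^ Suc n) \<le> 1"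
    by (intro tendsto_upperbound) auto
qed

lemma summable_tree:
  assumes "norm (z::complex) \<le> exp (-1)"
  shows "summable (\<lambda>n. norm (of_real (tree_coeff n) * z ^ Suc n))"
proof (rule summable_comparison_test[OF _ summable_tree_max])
  show "\<exists>N. \<forall>n\<ge>N. norm (norm (of_real (tree_coeff n) * z ^ Suc n)) \<le> tree_coeff n * exp (-1) ^ Suc n"
    using assms tree_coeff_nonneg
    by (auto simp: norm_mult norm_power simp del: power_Suc intro!: mult_left_mono power_mono)
qed

lemma tree_fun_continuous: "continuous_on (cball 0 (exp (-1))) tree_fun"
proof -
  have "uniform_limit (cball 0 (exp (-1)))
      (\<lambda>n z. \<Sum>i<n. of_real (tree_coeff i) * z ^ Suc i) tree_fun sequentially"
    unfolding tree_fun_altdef[abs_def]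
    by (rule Weierstrass_m_test[OF _ summable_tree_max])
      (auto simp: norm_mult norm_power tree_coeff_nonneg simp del: power_Suc intro!: mult_left_mono power_mono)
  thus ?thesis
    by (rule uniform_limit_theorem[rotated]) (auto intro!: always_eventually continuous_intros)
qed

lemma tree_fun_eq:
  assumes "norm z \<le> exp (-1)"
  shows "tree_fun z * exp (- tree_fun z) = z"
proof -
  have cl: "closure (ball (0::complex) (exp (-1))) = cball 0 (exp (-1))" by simp
  have "tree_fun z * exp (- tree_fun z) - z = 0"
  proof (rule continuous_constant_on_closure[of "ball 0 (exp (-1))" "\<lambda>z. tree_fun z * exp (- tree_fun z) - z"])
    show "continuous_on (closure (ball 0 (exp (- 1)))) (\<lambda>z. tree_fun z * exp (- tree_fun z) - z)"
      unfolding cl by (intro continuous_intros tree_fun_continuous)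
  qed (use assms in \<open>auto simp: cl tree_fun_eq_small\<close>)
  thus ?thesis by simp
qed

lemma tree_fun_0 [simp]: "tree_fun 0 = 0"
  by (simp add: tree_fun_def)

lemma tree_fun_inj:
  assumes "norm z \<le> exp (-1)" "norm w \<le> exp (-1)" "tree_fun z = tree_fun w"
  shows "z = w"
  using tree_fun_eq assms by metis

lemma mul_exp_neg_le: 
  assumes "0 \<le> x" "x \<le> (1::real)"
  shows "x * exp (- x) \<le> exp (-1)"
  using mul_exp_neg_strict_mono[of x 1] assms by (cases "x = 1") auto

text \<open>Both \<open>x\<close> and the value of the series lie in \<open>[0, 1)\<close>, where
  \<open>t * exp (- t)\<close> is injective. This later makes \<open>zeta b \<alpha> rt 0 1\<close>
  equal to 1.\<close>

lemma tree_real_mul_exp: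
  assumes "0 \<le> x" "x < 1"
  shows "tree_real (x * exp (- x)) = x"
proof -
  have "x * exp (- x) < exp (-1)" using mul_exp_neg_strict_mono[of x 1] assms by auto
  note * = tree_real_small[OF _ this]
  show ?thesis
  proof (rule ccontr)
    assume "tree_real (x * exp (- x)) \<noteq> x"
    thus False
      using * assms mul_exp_neg_strict_mono[of x "tree_real (x * exp (- x))"]
        mul_exp_neg_strict_mono[of "tree_real (x * exp (- x))" x] by force
  qed
qed

lemma tree_fun_mul_exp:
  assumes "0 \<le> x" "x < 1"
  shows "tree_fun (of_real (x * exp (- x))) = of_real x"
  using tree_fun_of_real_small[of "x * exp (- x)"] tree_real_mul_exp[OF assms] 
    mul_exp_neg_strict_mono[of x 1] assms by auto

text \<open>The coefficients are nonnegative, so the modulus on a disc is largest at the positive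
  real point, where the value is \<open>x\<close>. With \<open>x = \<alpha>\<close> it places the
  roots \<open>zeta\<close> in the closed unit disc.\<close>

lemma norm_tree_fun_le:
  assumes "0 \<le> x" "x < 1" "norm z \<le> x * exp (- x)"
  shows "norm (tree_fun z) \<le> x"
proof -
  have x: "x * exp (- x) < exp (-1)" using mul_exp_neg_strict_mono[of x 1] assms by auto
  have s: "summable (\<lambda>n. norm (of_real (tree_coeff n) * z ^ Suc n))"
    by (rule summable_tree) (use assms x in auto)
  have "summable (\<lambda>n. norm (of_real (tree_coeff n) * (of_real (x * exp (- x)) :: complex) ^ Suc n))"
    by (rule summable_tree) (use assms x in \<open>auto simp: norm_mult\<close>)
  hence s2: "summable (\<lambda>n. tree_coeff n * (x * exp (- x)) ^ Suc n)"
    using assms by (simp add: norm_mult norm_power tree_coeff_nonneg)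
  have "norm (tree_fun z) \<le> (\<Sum>n. norm (of_real (tree_coeff n) * z ^ Suc n))"
    unfolding tree_fun_altdef by (rule summable_norm[OF s])
  also have "\<dots> \<le> tree_real (x * exp (- x))"
    unfolding tree_real_def
    by (rule suminf_le[OF _ s s2])
      (use assms tree_coeff_nonneg in \<open>auto simp: norm_mult norm_power simp del: power_Suc intro!: mult_left_mono power_mono\<close>)
  also have "\<dots> = x" by (rule tree_real_mul_exp) fact+
  finally show ?thesis .
qed

section \<open>Linear probing as a Lindley recursion\<close>

text \<open>Truncated subtraction of natural numbers is the maximum with 0 in the Lindley recursion;
  the value at \<open>i\<close> is the overflow entering position \<open>i\<close>.\<close>

primrec lind :: "nat \<Rightarrow> nat \<Rightarrow> (nat \<Rightarrow> nat) \<Rightarrow> nat \<Rightarrow> nat" where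
  "lind b q f 0 = q"
| "lind b q f (Suc i) = lind b q f i + f i - b"

text \<open>
  Position \<open>K\<close> of \<open>f\<close> is the bucket where the search starts, and \<open>q\<close> is the overflow entering position \<open>0\<close>.
\<close>
definition ends_at :: "nat \<Rightarrow> nat \<Rightarrow> (nat \<Rightarrow> nat) \<Rightarrow> nat \<Rightarrow> nat \<Rightarrow> bool" where
  "ends_at b q f K u \<longleftrightarrow>
     (\<forall>i<u div b. b \<le> lind b q f (K + i) + f (K + i)) \<and>
     lind b q f (K + u div b) + f (K + u div b) = u mod b"

lemma lind_cong:
  "(\<And>j. j < i \<Longrightarrow> f j = g j) \<Longrightarrow> lind b q f i = lind b q g i"
  by (induction i) auto

lemma ends_at_cong:
  assumes "\<And>j. j \<le> K + u div b \<Longrightarrow> f j = g j"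
  shows "ends_at b q f K u = ends_at b q g K u"
proof -
  have "lind b q f (K + i) = lind b q g (K + i)" if "i \<le> u div b" for i
    by (rule lind_cong) (use that assms in auto)
  thus ?thesis using assms unfolding ends_at_def by auto
qed

lemma lind_mono: "q \<le> q' \<Longrightarrow> lind b q f i \<le> lind b q' f i"
  by (induction i) (auto intro: diff_le_mono)

text \<open>By monotonicity in the initial overflow the queue started from 0 lies below the other
  one, so both are empty at \<open>j\<close> and agree from then on.\<close>

lemma lind_coupling:
  assumes "lind b q f j = 0" "j \<le> i"
  shows "lind b 0 f i = lind b q f i"
  using assms(2)
proof (induction i rule: dec_induct)
  case base
  thus ?case using lind_mono[of 0 q b f j] assms by simp
qed auto

lemma ends_at_coupling:
  assumes "lind b q f j = 0" "j \<le> K"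
  shows "ends_at b q f K u = ends_at b 0 f K u"
  using lind_coupling[OF assms(1)] assms(2) by (simp add: ends_at_def)

lemma lind_sum_le: "(\<Sum>j<i. f j) \<le> lind b q f i + b * i"
  by (induction i) auto

text \<open>While all buckets are full no subtraction is truncated, so keys are conserved.\<close>

lemma lind_run:
  assumes "\<And>i. i < L \<Longrightarrow> b \<le> lind b q f i + f i"
  shows "lind b q f L + b * L = q + (\<Sum>i<L. f i)"
  using assms
proof (induction L)
  case (Suc L)
  have "lind b q f L + b * L = q + (\<Sum>i<L. f i)" by (rule Suc.IH) (use Suc.prems in auto)
  moreover have "b \<le> lind b q f L + f L" by (rule Suc.prems) auto
  ultimately show ?case by auto
qed auto

text \<open>This bound on every single count makes the event a union of finitely many patterns,
  those in \<open>windows\<close>.\<close>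

lemma ends_at_total:
  assumes "ends_at b q f K u" "b \<ge> 1" "j \<le> K + u div b"
  shows "f j \<le> b * Suc (K + u div b)"
proof -
  let ?N = "K + u div b"
  have "f j \<le> (\<Sum>j<Suc ?N. f j)"
    by (rule member_le_sum) (use assms in auto)
  also have "\<dots> = (\<Sum>j<?N. f j) + f ?N" by simp
  also have "\<dots> \<le> (lind b q f ?N + f ?N) + b * ?N"
    using lind_sum_le[of f ?N b q] by simp
  also have "\<dots> \<le> b * Suc ?N"
    using assms mod_less_divisor[of b u] by (simp add: ends_at_def)
  finally show ?thesis .
qed

text \<open>
  Here \<open>x j\<close> is the number of keys with address \<open>j\<close>, \<open>c j\<close> the number stored in bucket \<open>j\<close>, and
  \<open>I j\<close> the number of keys that have probed bucket \<open>j - 1\<close> unsuccessfully.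
\<close>
definition table_inv :: "nat \<Rightarrow> nat \<Rightarrow> (nat \<Rightarrow> nat) \<Rightarrow> (nat \<Rightarrow> nat) \<Rightarrow> (nat \<Rightarrow> nat) \<Rightarrow> bool" where
  "table_inv b m x c I \<longleftrightarrow>
     (\<forall>j<m. x j + I j = c j + I (Suc j mod m)) \<and> (\<forall>j<m. c j \<le> b) \<and>
     (\<forall>j<m. I (Suc j mod m) > 0 \<longrightarrow> c j = b) \<and> (\<Sum>j<m. c j) = (\<Sum>j<m. x j)"

lemma full_passed_props:
  assumes "h < m" "j < m" "c j < b"
  shows "full_passed b m c h < m" "c ((h + full_passed b m c h) mod m) < b"
    "\<And>i. i < full_passed b m c h \<Longrightarrow> \<not> c ((h + i) mod m) < b"
proof -
  define k where "k = (if h \<le> j then j - h else j + m - h)"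
  have k: "k < m" "(h + k) mod m = j" using assms by (auto simp: k_def)
  hence ck: "c ((h + k) mod m) < b" using assms by simp
  show "c ((h + full_passed b m c h) mod m) < b"
    unfolding full_passed_def by (rule LeastI[of _ k]) fact
  show "full_passed b m c h < m"
    using Least_le[of "\<lambda>k. c ((h + k) mod m) < b" k] ck k by (auto simp: full_passed_def)
  show "\<not> c ((h + i) mod m) < b" if "i < full_passed b m c h" for i
    using not_less_Least that unfolding full_passed_def by blast
qed

lemma ex_less_of_sum_less:
  fixes c :: "nat \<Rightarrow> nat"
  assumes "(\<Sum>j<m. c j) < b * m"
  shows "\<exists>j<m. c j < b"
proof (rule ccontr)
  assume "\<not> ?thesis"
  hence "(\<Sum>j<m. b) \<le> (\<Sum>j<m. c j)" by (intro sum_mono) (metis lessThan_iff not_less)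
  thus False using assms by (simp add: mult.commute)
qed

lemma table_inv_insert:
  assumes inv: "table_inv b m x c I" and h: "h < m" and less: "(\<Sum>j<m. c j) < b * m"
  shows "\<exists>I'. table_inv b m (x(h := x h + 1)) (insert_key b m c h) I'"
proof -
  obtain j0 where j0: "j0 < m" "c j0 < b" using ex_less_of_sum_less[OF less] by auto
  define k where "k = full_passed b m c h"
  define p where "p = (h + k) mod m"
  have k: "k < m" "c p < b" "\<And>i. i < k \<Longrightarrow> \<not> c ((h + i) mod m) < b"
    using full_passed_props[of h m j0 c b] h j0 unfolding k_def p_def by auto
  have p: "p < m" "p = (if h + k < m then h + k else h + k - m)"
    using h k by (auto simp: p_def mod_if)
  \<comment> \<open>Cyclic distance from the hash address, so that the probe path becomes the
    interval from 0 to \<open>k\<close>.\<close>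
  define off where "off j = (if h \<le> j then j - h else j + m - h)" for j
  have off: "off j < m" "(h + off j) mod m = j" if "j < m" for j
    using that h by (auto simp: off_def)
  have off0: "off j = 0 \<longleftrightarrow> j = h" and offk: "off j = k \<longleftrightarrow> j = p" if "j < m" for j
    using that h k p by (auto simp: off_def)
  have offS: "off (Suc j mod m) = (if Suc (off j) = m then 0 else Suc (off j))" if "j < m" for j
    using that h by (auto simp: off_def mod_if)
  \<comment> \<open>The new key leaves the buckets at distances 0 to \<open>k - 1\<close>, so it
    counts as inflow at distances 1 to \<open>k\<close>; since \<open>k < m\<close> it does not
    return to \<open>h\<close>.\<close>
  define I' where "I' j = I j + (if 1 \<le> off j \<and> off j \<le> k then 1 else 0)" for j
  have ins: "insert_key b m c h = c(p := c p + 1)"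
    by (simp add: insert_key_def first_nonfull_def p_def k_def Let_def)
  have "table_inv b m (x(h := x h + 1)) (c(p := c p + 1)) I'"
    unfolding table_inv_def
  proof (intro conjI allI impI)
    fix j assume j: "j < m"
    have e: "x j + I j = c j + I (Suc j mod m)" using inv j by (simp add: table_inv_def)
    have "(x(h := x h + 1)) j = x j + (if off j = 0 then 1 else 0)"
      using off0[OF j] by auto
    moreover have "(c(p := c p + 1)) j = c j + (if off j = k then 1 else 0)"
      using offk[OF j] by auto
    moreover have I'S: "I' (Suc j mod m) = I (Suc j mod m) + (if off j < k then 1 else 0)"
      unfolding I'_def offS[OF j] using k(1) off(1)[OF j] by auto
    ultimately show "(x(h := x h + 1)) j + I' j = (c(p := c p + 1)) j + I' (Suc j mod m)"
      using e by (auto simp: I'_def)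
    show "(c(p := c p + 1)) j \<le> b" using inv j k by (auto simp: table_inv_def)
    assume pos: "0 < I' (Suc j mod m)"
    have "c j = b"
    proof (cases "off j < k")
      case True
      hence "\<not> c j < b" using k(3)[OF True] off(2)[OF j] by simp
      thus ?thesis using inv j by (auto simp: table_inv_def)
    next
      case False
      hence "I (Suc j mod m) > 0"
        using pos I'S by simp
      thus ?thesis using inv j by (auto simp: table_inv_def)
    qed
    thus "(c(p := c p + 1)) j = b" using k(2) by auto
  next
    have "(\<Sum>j<m. (c(p := c p + 1)) j) = (\<Sum>j<m. c j) + 1"
      using p(1) by (subst (1 2) sum.remove[of _ p]) auto
    moreover have "(\<Sum>j<m. (x(h := x h + 1)) j) = (\<Sum>j<m. x j) + 1"
      using h by (subst (1 2) sum.remove[of _ h]) auto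
    ultimately show "(\<Sum>j<m. (c(p := c p + 1)) j) = (\<Sum>j<m. (x(h := x h + 1)) j)"
      using inv by (simp add: table_inv_def)
  qed
  thus ?thesis unfolding ins by blast
qed

lemma sum_count_list: "set hs \<subseteq> {..<m::nat} \<Longrightarrow> (\<Sum>j<m. count_list hs j) = length hs"
  by (rule sum_count_set) simp_all

lemma hash_table_inv:
  assumes "set hs \<subseteq> {..<m}" "length hs \<le> b * m"
  shows "\<exists>I. table_inv b m (count_list hs) (hash_table b m hs) I"
  using assms
proof (induction hs rule: rev_induct)
  case Nil
  show ?case
    by (intro exI[of _ "\<lambda>_. 0"]) (auto simp: table_inv_def hash_table_def)
next
  case (snoc h hs)
  then obtain I where I: "table_inv b m (count_list hs) (hash_table b m hs) I" by auto
  have "(\<Sum>j<m. hash_table b m hs j) = length hs"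
    using I sum_count_list[of hs m] snoc.prems by (simp add: table_inv_def)
  hence "\<exists>I'. table_inv b m ((count_list hs)(h := count_list hs h + 1)) (insert_key b m (hash_table b m hs) h) I'"
    using snoc.prems by (intro table_inv_insert[OF I]) auto
  moreover have "(count_list hs)(h := count_list hs h + 1) = count_list (hs @ [h])" by auto
  ultimately have "\<exists>I'. table_inv b m (count_list (hs @ [h])) (insert_key b m (hash_table b m hs) h) I'"
    by (simp only:)
  thus ?case by (simp only: hash_table_def foldl_append foldl.simps)
qed

locale table =
  fixes b m :: nat and x c I :: "nat \<Rightarrow> nat"
  assumes inv: "table_inv b m x c I"
    and b: "b \<ge> 1" and less: "(\<Sum>j<m. x j) < b * m"
begin

lemma m_pos: "m > 0" using less by (cases m) auto

text \<open>Only full buckets let keys pass on, so the balance equation can be solved for the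
  outflow and the content. The hash counts and one inflow thus determine the state, whatever the
  insertion order.\<close>

lemma step: "I (Suc j mod m) = x (j mod m) + I (j mod m) - b" "c (j mod m) = min b (x (j mod m) + I (j mod m))"
proof -
  define j' where "j' = j mod m"
  have j': "j' < m" using m_pos by (simp add: j'_def)
  have e: "Suc j mod m = Suc j' mod m" by (simp add: j'_def mod_Suc_eq)
  have "x j' + I j' = c j' + I (Suc j' mod m)" "c j' \<le> b" "I (Suc j' mod m) > 0 \<longrightarrow> c j' = b"
    using inv j' by (auto simp: table_inv_def)
  thus "I (Suc j mod m) = x (j mod m) + I (j mod m) - b" "c (j mod m) = min b (x (j mod m) + I (j mod m))"
    unfolding e j'_def[symmetric] by (cases "I (Suc j' mod m)"; auto)+
qed

lemma I_lind: "I ((a + i) mod m) = lind b (I (a mod m)) (\<lambda>i. x ((a + i) mod m)) i"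
  by (induction i) (auto simp: step(1))

lemma c_lind: "c ((a + i) mod m) = min b (lind b (I (a mod m)) (\<lambda>i. x ((a + i) mod m)) i + x ((a + i) mod m))"
  unfolding I_lind[symmetric] step(2) by (simp only: add.commute)

lemma ex_nonfull: "\<exists>j<m. c j < b"
  by (rule ex_less_of_sum_less) (use less inv in \<open>simp add: table_inv_def\<close>)

text \<open>The recursion starts \<open>K\<close> buckets before \<open>s\<close> with the true
  overflow there; \<open>m\<close> is added before \<open>K\<close> is subtracted to stay within the
  natural numbers.\<close>

lemma exact_ends_at:
  assumes "s < m" "K \<le> m"
  shows "b * full_passed b m c s + c (first_nonfull b m c s) = u \<longleftrightarrow>
    ends_at b (I ((s + m - K) mod m)) (\<lambda>i. x ((s + m - K + i) mod m)) K u"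
proof -
  obtain j where j: "j < m" "c j < b" using ex_nonfull by auto
  define k where "k = full_passed b m c s"
  note fp = full_passed_props[of s m j c b, OF assms(1) j, folded k_def]
  have fn: "first_nonfull b m c s = (s + k) mod m" by (simp add: first_nonfull_def k_def)
  have cl: "c ((s + i) mod m) = min b (lind b (I ((s + m - K) mod m)) (\<lambda>i. x ((s + m - K + i) mod m)) (K + i)
      + x ((s + m - K + (K + i)) mod m))" for i
  proof -
    have "c ((s + i) mod m) = c ((s + m - K + (K + i)) mod m)"
    proof -
      have "s + m - K + (K + i) = s + i + m" using assms by simp
      thus ?thesis by (simp only: mod_add_self2)
    qed
    thus ?thesis by (simp only: c_lind)
  qed
  have R: "ends_at b (I ((s + m - K) mod m)) (\<lambda>i. x ((s + m - K + i) mod m)) K u \<longleftrightarrow>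
     (\<forall>i<u div b. \<not> c ((s + i) mod m) < b) \<and> c ((s + u div b) mod m) = u mod b"
  proof -
    have "u mod b < b" using b by simp
    thus ?thesis unfolding ends_at_def cl by (auto simp: min_def)
  qed
  show ?thesis
  proof
    assume u: "b * full_passed b m c s + c (first_nonfull b m c s) = u"
    hence "u div b = k" "u mod b = c ((s + k) mod m)"
      using fp(2) unfolding fn k_def[symmetric] by auto
    thus "ends_at b (I ((s + m - K) mod m)) (\<lambda>i. x ((s + m - K + i) mod m)) K u"
      unfolding R using fp by auto
  next
    assume "ends_at b (I ((s + m - K) mod m)) (\<lambda>i. x ((s + m - K + i) mod m)) K u"
    hence *: "\<forall>i<u div b. \<not> c ((s + i) mod m) < b" "c ((s + u div b) mod m) = u mod b"
      unfolding R by auto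
    have "k = u div b"
      using * fp mod_less_divisor[of b u] b by (metis One_nat_def Suc_le_lessD linorder_neqE_nat)
    thus "b * full_passed b m c s + c (first_nonfull b m c s) = u"
      unfolding fn k_def[symmetric] using * by simp
  qed
qed

text \<open>Going back from the end of the run to the nearest non-full bucket gives
  \<open>L \<ge> k\<close> consecutive full buckets that receive no overflow from outside, so their
  own hash counts fill them. They may begin before the run does, hence the unknown
  \<open>L\<close>.\<close>

lemma full_run:
  assumes "\<And>i. i < k \<Longrightarrow> c ((a + i) mod m) = b"
  shows "\<exists>L\<in>{k..m}. b * L \<le> (\<Sum>i<L. x ((a + k + m - L + i) mod m))"
proof -
  define P where "P L \<longleftrightarrow> c ((a + k + m - Suc L) mod m) < b" for L
  obtain j where j: "j < m" "c j < b" using ex_nonfull by auto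
  have "\<exists>L<m. P L"
  proof -
    \<comment> \<open>Cyclic distance back from the last bucket of the run,
      \<open>a + k - 1\<close>, to the non-full bucket \<open>j\<close>.\<close>
    define L where "L = (a + k + (m - Suc j)) mod m"
    have Lm: "L < m" using m_pos by (simp add: L_def)
    have "(a + k + m - Suc L) mod m = j"
    proof -
      have "int ((a + k + m - Suc L) mod m) = (int (a + k + m) - int (Suc L)) mod int m"
        using Lm by (simp add: zmod_int of_nat_diff)
      also have "\<dots> = (int (a + k + m) - 1 - int (a + k + (m - Suc j)) mod int m) mod int m"
        by (simp add: L_def zmod_int algebra_simps)
      also have "\<dots> = (int (a + k + m) - 1 - int (a + k + (m - Suc j))) mod int m"
        by (simp add: mod_diff_right_eq)
      also have "int (a + k + m) - 1 - int (a + k + (m - Suc j)) = int j"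
        using j by (simp add: of_nat_diff)
      also have "int j mod int m = int j" using j by simp
      finally show ?thesis by simp
    qed
    thus ?thesis using Lm j by (auto simp: P_def)
  qed
  then obtain L0 where L0: "L0 < m" "P L0" by auto
  define L where "L = (LEAST L. P L)"
  have PL: "P L" unfolding L_def by (rule LeastI) fact
  have Lm: "L < m" using Least_le[of P L0] L0 by (simp add: L_def)
  have nP: "\<not> P i" if "i < L" for i using not_less_Least that unfolding L_def by blast
  have "k \<le> L"
  proof (rule ccontr)
    assume "\<not> k \<le> L"
    hence "c ((a + (k - Suc L)) mod m) = b" by (intro assms) auto
    moreover have "a + k + m - Suc L = a + (k - Suc L) + m" using \<open>\<not> k \<le> L\<close> by auto
    ultimately show False using PL by (simp add: P_def)
  qed
  define a' where "a' = a + k + m - L"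
  have I0: "I (a' mod m) = 0"
  proof -
    have "a' = Suc (a + k + m - Suc L)" using Lm by (simp add: a'_def)
    thus ?thesis using PL step[of "a + k + m - Suc L"] by (simp add: P_def min_def split: if_splits)
  qed
  have "lind b 0 (\<lambda>i. x ((a' + i) mod m)) L + b * L = 0 + (\<Sum>i<L. x ((a' + i) mod m))"
  proof (rule lind_run)
    fix i assume i: "i < L"
    have "\<not> P (L - Suc i)" using i by (intro nP) auto
    moreover have "a + k + m - Suc (L - Suc i) = a' + i" using i Lm by (simp add: a'_def)
    ultimately have "\<not> c ((a' + i) mod m) < b" by (simp add: P_def)
    thus "b \<le> lind b 0 (\<lambda>i. x ((a' + i) mod m)) i + x ((a' + i) mod m)"
      using I0 by (simp add: c_lind)
  qed
  hence "b * L \<le> (\<Sum>i<L. x ((a' + i) mod m))" by linarith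
  thus ?thesis using Lm \<open>k \<le> L\<close> by (auto simp: a'_def)
qed

lemma ends_at_full_run:
  assumes "ends_at b (I (a mod m)) (\<lambda>i. x ((a + i) mod m)) 0 u" "i < u div b"
  shows "c ((a + i) mod m) = b"
  using assms unfolding ends_at_def c_lind by auto

text \<open>An empty overflow after any of the first \<open>K\<close> buckets would couple the two
  recursions; so all these overflows are positive, and only full buckets overflow.\<close>

lemma no_coupling_full_run:
  assumes "ends_at b (I (a mod m)) (\<lambda>i. x ((a + i) mod m)) K u \<noteq> ends_at b 0 (\<lambda>i. x ((a + i) mod m)) K u"
    "i < K"
  shows "c ((a + i) mod m) = b"
proof -
  have "lind b (I (a mod m)) (\<lambda>i. x ((a + i) mod m)) (Suc i) \<noteq> 0"
    using ends_at_coupling[of b _ _ "Suc i" K] assms by (metis Suc_leI)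
  hence "I (Suc (a + i) mod m) \<noteq> 0" using I_lind[of a "Suc i"] by simp
  thus ?thesis using step[of "a + i"] by auto
qed

end

section \<open>Full runs in the exact model\<close>

text \<open>\<open>rho a ^ b\<close> is the minimum over \<open>z\<close> of
  \<open>exp (a * b * (z - 1)) / z ^ b\<close>: the Chernoff bound for a Poisson number of keys with
  mean \<open>a * b\<close> to reach \<open>b\<close>.\<close>

definition rho :: "real \<Rightarrow> real" where "rho a = a * exp (1 - a)"

lemma rho_bounds:
  assumes "0 < a" "a < 1"
  shows "0 < rho a" "rho a < 1"
proof -
  show "0 < rho a" using assms by (simp add: rho_def)
  have "a * exp (- a) * exp 1 < exp (- 1) * exp 1"
    by (intro mult_strict_right_mono) (use mul_exp_neg_strict_mono[of a 1] assms in auto)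
  thus "rho a < 1" by (simp add: rho_def exp_diff exp_minus field_simps)
qed

lemma rho_power_tendsto:
  assumes "0 < a" "a < 1" "b \<ge> 1"
  shows "(\<lambda>k. rho a ^ (b * k) / (1 - rho a)) \<longlonglongrightarrow> 0"
proof -
  have "rho a ^ b < 1" using rho_bounds[OF assms(1,2)] assms(3) by (simp add: power_less_one_iff)
  hence "(\<lambda>k. (rho a ^ b) ^ k / (1 - rho a)) \<longlonglongrightarrow> 0 / (1 - rho a)"
    using rho_bounds[OF assms(1,2)] by (intro tendsto_divide LIMSEQ_power_zero tendsto_const) auto
  thus ?thesis by (simp add: power_mult)
qed

text \<open>Patterns of counts on the positions that the event looks at. Extensionality makes
  different patterns describe disjoint events, and the bound keeps the set finite.\<close>

definition windows :: "nat \<Rightarrow> nat \<Rightarrow> nat \<Rightarrow> (nat \<Rightarrow> nat) set" where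
  "windows b K u = {g \<in> {..<Suc (K + u div b)} \<rightarrow>\<^sub>E {..b * Suc (K + u div b)}. ends_at b 0 g K u}"

lemma finite_windows: "finite (windows b K u)"
proof -
  have "finite ({..<Suc (K + u div b)} \<rightarrow>\<^sub>E {..b * Suc (K + u div b)})"
    by (intro finite_PiE) auto
  thus ?thesis by (rule finite_subset[rotated]) (auto simp: windows_def)
qed

text \<open>Stated for a general finite measure so that both models expand the truncated event over
  the same finite set of patterns; comparing them reduces to comparing pattern
  probabilities.\<close>

lemma (in finite_measure) measure_ends_at:
  assumes b: "b \<ge> 1"
    and meas: "\<And>g. {\<omega> \<in> space M. \<forall>i<Suc (K + u div b). f \<omega> i = g i} \<in> sets M"
  shows "measure M {\<omega> \<in> space M. ends_at b 0 (f \<omega>) K u} =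
    (\<Sum>g\<in>windows b K u. measure M {\<omega> \<in> space M. \<forall>i<Suc (K + u div b). f \<omega> i = g i})"
    and "{\<omega> \<in> space M. ends_at b 0 (f \<omega>) K u} \<in> sets M"
proof -
  let ?N = "Suc (K + u div b)"
  define A where "A g = {\<omega> \<in> space M. \<forall>i<?N. f \<omega> i = g i}" for g
  have eq: "{\<omega> \<in> space M. ends_at b 0 (f \<omega>) K u} = (\<Union>g\<in>windows b K u. A g)"
  proof (intro set_eqI iffI)
    fix \<omega> assume \<omega>: "\<omega> \<in> {\<omega> \<in> space M. ends_at b 0 (f \<omega>) K u}"
    define g where "g = restrict (f \<omega>) {..<?N}"
    have "ends_at b 0 g K u = ends_at b 0 (f \<omega>) K u"
      by (rule ends_at_cong) (auto simp: g_def)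
    moreover have "f \<omega> i \<le> b * ?N" if "i < ?N" for i
      using ends_at_total[of b 0 "f \<omega>" K u i] \<omega> b that by auto
    ultimately have "g \<in> windows b K u"
      using \<omega> by (auto simp: windows_def g_def)
    moreover have "\<omega> \<in> A g" using \<omega> by (auto simp: A_def g_def)
    ultimately show "\<omega> \<in> (\<Union>g\<in>windows b K u. A g)" by blast
  next
    fix \<omega> assume "\<omega> \<in> (\<Union>g\<in>windows b K u. A g)"
    then obtain g where g: "g \<in> windows b K u" "\<omega> \<in> A g" by auto
    have "ends_at b 0 g K u = ends_at b 0 (f \<omega>) K u"
      by (rule ends_at_cong) (use g in \<open>auto simp: A_def\<close>)
    thus "\<omega> \<in> {\<omega> \<in> space M. ends_at b 0 (f \<omega>) K u}"
      using g by (auto simp: windows_def A_def)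
  qed
  have A: "A g \<in> sets M" for g unfolding A_def by (rule meas)
  have "disjoint_family_on A (windows b K u)"
  proof (unfold disjoint_family_on_def, intro ballI impI)
    fix g h assume gh: "g \<in> windows b K u" "h \<in> windows b K u" "g \<noteq> h"
    show "A g \<inter> A h = {}"
    proof (rule ccontr)
      assume "A g \<inter> A h \<noteq> {}"
      then obtain \<omega> where "\<omega> \<in> A g" "\<omega> \<in> A h" by auto
      hence "g i = h i" if "i < ?N" for i using that by (auto simp: A_def)
      hence "g = h"
        using gh by (intro PiE_ext[of g "{..<?N}" "\<lambda>_. {..b * ?N}" h]) (auto simp: windows_def)
      thus False using gh by simp
    qed
  qed
  hence "measure M (\<Union>g\<in>windows b K u. A g) = (\<Sum>g\<in>windows b K u. measure M (A g))"
    using A by (intro finite_measure_finite_Union finite_windows image_subsetI)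
  thus "measure M {\<omega> \<in> space M. ends_at b 0 (f \<omega>) K u} =
    (\<Sum>g\<in>windows b K u. measure M {\<omega> \<in> space M. \<forall>i<?N. f \<omega> i = g i})"
    by (simp only: eq A_def)
  show "{\<omega> \<in> space M. ends_at b 0 (f \<omega>) K u} \<in> sets M"
    unfolding eq by (intro sets.finite_UN finite_windows A)
qed

section \<open>Chernoff bound for full runs under uniform hashing\<close>

lemma set_pmf_hash_addresses:
  assumes "m > 0"
  shows "set_pmf (hash_addresses m n) = {hs. set hs \<subseteq> {..<m} \<and> length hs = n}"
proof -
  have "set_pmf (pmf_of_set {..<m}) = {..<m}"
    using assms by (intro set_pmf_of_set) auto
  thus ?thesis by (auto simp: hash_addresses_def set_replicate_pmf lists_eq_set)
qed

lemma finite_set_hash_addresses: "m > 0 \<Longrightarrow> finite (set_pmf (hash_addresses m n))"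
  by (simp add: set_pmf_hash_addresses finite_lists_length_eq)

lemma hash_addresses_Suc:
  "hash_addresses m (Suc n) = pmf_of_set {..<m} \<bind> (\<lambda>x. map_pmf ((#) x) (hash_addresses m n))"
  by (simp add: hash_addresses_def map_pmf_def)

lemma expectation_hash_Suc:
  fixes h :: "nat list \<Rightarrow> real"
  assumes "m > 0"
  shows "measure_pmf.expectation (hash_addresses m (Suc n)) h =
    (\<Sum>x<m. measure_pmf.expectation (hash_addresses m n) (\<lambda>hs. h (x # hs))) / m"
  unfolding hash_addresses_Suc
  by (subst pmf_expectation_bind_pmf_of_set)
    (use assms in \<open>simp_all add: finite_set_hash_addresses lessThan_empty_iff bot_nat_def divide_inverse mult.commute flip: sum_distrib_left\<close>)

lemma prob_hash_Suc:
  assumes "m > 0"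
  shows "measure_pmf.prob (hash_addresses m (Suc n)) A =
    (\<Sum>x<m. measure_pmf.prob (hash_addresses m n) {hs. x # hs \<in> A}) / m"
proof -
  have *: "measure_pmf.prob p A = measure_pmf.expectation p (indicator A)" for p :: "nat list pmf" and A
    by simp
  have "(\<lambda>hs. indicator A (x # hs) :: real) = indicator {hs. x # hs \<in> A}" for x
    by (auto simp: indicator_def)
  thus ?thesis unfolding * by (subst expectation_hash_Suc[OF assms]) (simp only:)
qed

lemma sum_count_Cons:
  assumes "finite J" "inj_on pos J"
  shows "(\<Sum>i\<in>J. count_list (x # hs) (pos i)) = (\<Sum>i\<in>J. count_list hs (pos i)) + (if x \<in> pos ` J then 1 else 0)"
proof (cases "x \<in> pos ` J")
  case True
  then obtain i where i: "i \<in> J" "x = pos i" by auto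
  have "(\<Sum>j\<in>J - {i}. count_list (x # hs) (pos j)) = (\<Sum>j\<in>J - {i}. count_list hs (pos j))"
    by (intro sum.cong) (use i assms in \<open>auto simp: inj_on_def\<close>)
  thus ?thesis using i assms by (simp add: sum.remove[of J i])
next
  case False
  have "(\<Sum>j\<in>J. count_list (x # hs) (pos j)) = (\<Sum>j\<in>J. count_list hs (pos j))"
    by (intro sum.cong) (use False in auto)
  thus ?thesis using False by simp
qed

text \<open>The number of keys falling into the cells \<open>pos\<close> applied to \<open>J\<close>
  is binomial with success probability \<open>card J / m\<close>; peeling off the first key splits
  off one factor.\<close>

lemma expectation_power_count:
  fixes z :: real
  assumes m: "m > 0" and J: "finite J" "inj_on pos J" "pos ` J \<subseteq> {..<m}"
  shows "measure_pmf.expectation (hash_addresses m n) (\<lambda>hs. z ^ (\<Sum>i\<in>J. count_list hs (pos i))) =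
    (1 + (z - 1) * card J / m) ^ n"
proof (induction n)
  case 0
  show ?case by (simp add: hash_addresses_def)
next
  case (Suc n)
  define E where "E = (1 + (z - 1) * card J / m) ^ n"
  have "measure_pmf.expectation (hash_addresses m (Suc n)) (\<lambda>hs. z ^ (\<Sum>i\<in>J. count_list hs (pos i))) =
     (\<Sum>x<m. measure_pmf.expectation (hash_addresses m n)
        (\<lambda>hs. z ^ (\<Sum>i\<in>J. count_list hs (pos i)) * (if x \<in> pos ` J then z else 1))) / m"
    unfolding expectation_hash_Suc[OF m] sum_count_Cons[OF J(1,2)] power_add
    by (simp only: if_distrib[of "\<lambda>k. z ^ k"] power_one_right power_0)
  also have "\<dots> = E * (\<Sum>x<m. if x \<in> pos ` J then z else 1) / m"
    unfolding integral_mult_left_zero Suc.IH E_def[symmetric] by (simp add: sum_distrib_left)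
  also have "(\<Sum>x<m. if x \<in> pos ` J then z else 1) = (\<Sum>x<m. 1 + (if x \<in> pos ` J then z - 1 else 0))"
    by (intro sum.cong) auto
  also have "\<dots> = m + (z - 1) * card (pos ` J)"
  proof -
    have "(\<Sum>x<m. if x \<in> pos ` J then z - 1 else 0) = sum (\<lambda>_. z - 1) ({..<m} \<inter> pos ` J)"
      by (rule sum.inter_restrict[symmetric]) simp
    also have "{..<m} \<inter> pos ` J = pos ` J" using J by blast
    finally show ?thesis by (simp add: sum.distrib)
  qed
  also have "card (pos ` J) = card J" using J by (simp add: card_image)
  finally show ?case using m by (simp add: E_def field_simps)
qed

lemma chernoff_count:
  fixes a :: real
  assumes m: "m > 0" and J: "finite J" "inj_on pos J" "pos ` J \<subseteq> {..<m}"
    and a: "0 < a" "a < 1" "n \<le> a * b * m"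
  shows "measure_pmf.prob (hash_addresses m n) {hs. b * card J \<le> (\<Sum>i\<in>J. count_list hs (pos i))}
    \<le> rho a ^ (b * card J)"
proof -
  let ?D = "hash_addresses m n"
  \<comment> \<open>The tilt that attains the minimum \<open>rho a ^ b\<close>; it exceeds 1 because
    \<open>a < 1\<close>.\<close>
  define z where "z = 1 / a"
  have z: "z > 1" using a by (simp add: z_def)
  hence zc: "0 \<le> (z - 1) * card J" by simp
  hence zm: "0 \<le> (z - 1) * card J / m" by simp
  have "measure_pmf.prob ?D {hs. b * card J \<le> (\<Sum>i\<in>J. count_list hs (pos i))} =
     measure_pmf.expectation ?D (indicator {hs. b * card J \<le> (\<Sum>i\<in>J. count_list hs (pos i))})" by simp
  also have "\<dots> \<le> measure_pmf.expectation ?D (\<lambda>hs. z ^ (\<Sum>i\<in>J. count_list hs (pos i)) / z ^ (b * card J))"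
    using z by (intro integral_mono integrable_measure_pmf_finite finite_set_hash_addresses m)
      (auto simp: indicator_def intro: power_increasing)
  also have "\<dots> = (1 + (z - 1) * card J / m) ^ n / z ^ (b * card J)"
    by (simp add: expectation_power_count[OF m J])
  also have "\<dots> \<le> exp (b * card J * (1 - a)) / z ^ (b * card J)"
  proof (intro divide_right_mono)
    have "(1 + (z - 1) * card J / m) ^ n \<le> exp ((z - 1) * card J / m) ^ n"
      using zm by (intro power_mono exp_ge_add_one_self add_nonneg_nonneg) auto
    also have "\<dots> = exp ((z - 1) * card J * (n / m))"
      by (simp add: exp_of_nat_mult[symmetric] field_simps)
    also have "(z - 1) * card J * (n / m) \<le> (z - 1) * card J * (a * b)"
      using a m by (intro mult_left_mono zc) (simp add: pos_divide_le_eq)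
    also have "\<dots> = b * card J * (1 - a)" using a by (simp add: z_def field_simps)
    finally show "(1 + (z - 1) * card J / m) ^ n \<le> exp (b * card J * (1 - a))" by simp
  qed (use z in auto)
  also have "\<dots> = rho a ^ (b * card J)"
    using exp_of_nat_mult[of "b * card J" "1 - a"]
    by (simp add: rho_def z_def power_mult_distrib power_divide mult.commute)
  finally show ?thesis .
qed

lemma sum_power_tail_le:
  fixes r :: real
  assumes "0 < r" "r < 1" "b \<ge> 1"
  shows "(\<Sum>L\<in>{k..m}. r ^ (b * L)) \<le> r ^ (b * k) / (1 - r)"
proof (cases "k \<le> m")
  case True
  have "(1 - r ^ b) * (\<Sum>L\<in>{k..m}. (r ^ b) ^ L) \<le> (r ^ b) ^ k"
    using assms by (subst sum_gp_multiplied[OF True]) auto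
  moreover have "r ^ b \<le> r" using power_decreasing[of 1 b r] assms by simp
  hence "(1 - r) * (\<Sum>L\<in>{k..m}. (r ^ b) ^ L) \<le> (1 - r ^ b) * (\<Sum>L\<in>{k..m}. (r ^ b) ^ L)"
    using assms by (intro mult_right_mono sum_nonneg) auto
  ultimately have "(1 - r) * (\<Sum>L\<in>{k..m}. r ^ (b * L)) \<le> r ^ (b * k)"
    by (simp only: power_mult)
  thus ?thesis using assms by (simp add: pos_le_divide_eq mult.commute)
qed (use assms in auto)

lemma add_mod_inj_on: "inj_on (\<lambda>i::nat. (a + i) mod m) {..<L}" if "L \<le> m"
proof -
  have *: "i = j" if "i \<le> j" "j < m" "(a + i) mod m = (a + j) mod m" for i j
  proof -
    have "m dvd (a + j) - (a + i)" using that mod_eq_dvd_iff_nat[of "a+i" "a+j" m] by auto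
    hence "m dvd j - i" by simp
    thus ?thesis using that nat_dvd_not_less[of "j - i" m] by force
  qed
  show ?thesis
  proof (rule inj_onI)
    fix i j assume ij: "i \<in> {..<L}" "j \<in> {..<L}" "(a + i) mod m = (a + j) mod m"
    have lt: "i < m" "j < m" using ij(1,2) that by auto
    show "i = j"
    proof (cases "i \<le> j")
      case True
      thus ?thesis by (rule *[OF _ lt(2) ij(3)])
    next
      case False
      thus ?thesis using *[OF _ lt(1) ij(3)[symmetric]] by simp
    qed
  qed
qed

lemma table_hash:
  assumes "m > 0" "n < b * m" "b \<ge> 1" "hs \<in> set_pmf (hash_addresses m n)"
  obtains I where "table b m (count_list hs) (hash_table b m hs) I"
proof -
  have hs: "set hs \<subseteq> {..<m}" "length hs = n" using set_pmf_hash_addresses[of m n] assms by auto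
  then obtain I where "table_inv b m (count_list hs) (hash_table b m hs) I"
    using hash_table_inv[of hs m b] assms by auto
  hence "table b m (count_list hs) (hash_table b m hs) I"
    using assms hs sum_count_list[of hs m] by unfold_locales auto
  thus ?thesis by (rule that)
qed

text \<open>Union bound over the lengths \<open>L\<close> supplied by \<open>full_run\<close>, with
  Chernoff's inequality for each. The geometric sum makes the bound independent of \<open>m\<close>,
  \<open>n\<close> and the position.\<close>

lemma prob_full_run:
  fixes a :: real
  assumes m: "n < b * m" "b \<ge> 1" and a: "0 < a" "a < 1" "n \<le> a * b * m"
  shows "measure_pmf.prob (hash_addresses m n) {hs. \<forall>i<k. hash_table b m hs ((e + i) mod m) = b}
    \<le> rho a ^ (b * k) / (1 - rho a)"
proof -
  let ?D = "hash_addresses m n"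
  have m0: "m > 0" using m by (cases m) auto
  define A where "A L = {hs. b * card {..<L} \<le> (\<Sum>i<L. count_list hs ((e + k + m - L + i) mod m))}" for L
  have "measure_pmf.prob ?D {hs. \<forall>i<k. hash_table b m hs ((e + i) mod m) = b}
    \<le> measure_pmf.prob ?D (\<Union>L\<in>{k..m}. A L)"
  proof (rule measure_pmf.finite_measure_mono_AE)
    show "AE hs in ?D. hs \<in> {hs. \<forall>i<k. hash_table b m hs ((e + i) mod m) = b} \<longrightarrow> hs \<in> (\<Union>L\<in>{k..m}. A L)"
    proof (rule AE_pmfI, rule impI)
      fix hs assume hs: "hs \<in> set_pmf ?D" "hs \<in> {hs. \<forall>i<k. hash_table b m hs ((e + i) mod m) = b}"
      obtain I where "table b m (count_list hs) (hash_table b m hs) I"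
        using table_hash[OF m0 m hs(1)] by blast
      from table.full_run[OF this, of k e] hs show "hs \<in> (\<Union>L\<in>{k..m}. A L)"
        by (auto simp: A_def)
    qed
  qed simp
  also have "\<dots> \<le> (\<Sum>L\<in>{k..m}. measure_pmf.prob ?D (A L))"
    by (intro measure_pmf.finite_measure_subadditive_finite) auto
  also have "\<dots> \<le> (\<Sum>L\<in>{k..m}. rho a ^ (b * L))"
  proof (rule sum_mono)
    fix L assume "L \<in> {k..m}"
    hence "inj_on (\<lambda>i. (e + k + m - L + i) mod m) {..<L}" by (intro add_mod_inj_on) auto
    from chernoff_count[OF m0 _ this _ a] show "measure_pmf.prob ?D (A L) \<le> rho a ^ (b * L)"
      unfolding A_def using m0 by (simp add: image_subset_iff)
  qed
  also have "\<dots> \<le> rho a ^ (b * k) / (1 - rho a)"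
    by (rule sum_power_tail_le) (use rho_bounds a m in auto)
  finally show ?thesis .
qed

lemma prob_exact_U_le:
  fixes a :: real
  assumes m: "n < b * m" "b \<ge> 1" "s < m" and a: "0 < a" "a < 1" "n \<le> a * b * m"
  shows "measure_pmf.prob (hash_addresses m n) {hs. exact_U b m s hs = u}
    \<le> rho a ^ (b * (u div b)) / (1 - rho a)"
proof -
  let ?D = "hash_addresses m n"
  have m0: "m > 0" using m by auto
  have "measure_pmf.prob ?D {hs. exact_U b m s hs = u}
    \<le> measure_pmf.prob ?D {hs. \<forall>i<u div b. hash_table b m hs ((s + i) mod m) = b}"
  proof (rule measure_pmf.finite_measure_mono_AE)
    show "AE hs in ?D. hs \<in> {hs. exact_U b m s hs = u} \<longrightarrow>
      hs \<in> {hs. \<forall>i<u div b. hash_table b m hs ((s + i) mod m) = b}"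
    proof (rule AE_pmfI, rule impI)
      fix hs assume hs: "hs \<in> set_pmf ?D" "hs \<in> {hs. exact_U b m s hs = u}"
      obtain I where I: "table b m (count_list hs) (hash_table b m hs) I"
        using table_hash[OF m0 m(1,2) hs(1)] by blast
      have "ends_at b (I ((s + m) mod m)) (\<lambda>i. count_list hs ((s + m + i) mod m)) 0 u"
        using hs(2) table.exact_ends_at[OF I m(3), of 0 u] by (simp add: exact_U_def Let_def)
      from table.ends_at_full_run[OF I this] have "hash_table b m hs ((s + m + i) mod m) = b" if "i < u div b" for i
        using that by blast
      moreover have "(s + m + i) mod m = (s + i) mod m" for i
      proof -
        have "s + m + i = s + i + m" by simp
        thus ?thesis by (simp only: mod_add_self2)
      qed
      ultimately show "hs \<in> {hs. \<forall>i<u div b. hash_table b m hs ((s + i) mod m) = b}" by auto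
    qed
  qed auto
  also have "\<dots> \<le> rho a ^ (b * (u div b)) / (1 - rho a)"
    by (rule prob_full_run) fact+
  finally show ?thesis .
qed

text \<open>The two events can differ only when coupling fails, and then the \<open>K\<close>
  buckets before \<open>s\<close> are all full.\<close>

lemma prob_exact_U_approx:
  fixes a :: real
  assumes m: "n < b * m" "b \<ge> 1" "s < m" "K \<le> m" and a: "0 < a" "a < 1" "n \<le> a * b * m"
  shows "\<bar>measure_pmf.prob (hash_addresses m n) {hs. exact_U b m s hs = u} -
      measure_pmf.prob (hash_addresses m n) {hs. ends_at b 0 (\<lambda>i. count_list hs ((s + m - K + i) mod m)) K u}\<bar>
    \<le> rho a ^ (b * K) / (1 - rho a)"
proof -
  let ?D = "hash_addresses m n"
  have m0: "m > 0" using m by auto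
  define A where "A = {hs. exact_U b m s hs = u}"
  define B where "B = {hs. ends_at b 0 (\<lambda>i. count_list hs ((s + m - K + i) mod m)) K u}"
  define C where "C = {hs. \<forall>i<K. hash_table b m hs ((s + m - K + i) mod m) = b}"
  have AE: "AE hs in ?D. (hs \<in> A) \<noteq> (hs \<in> B) \<longrightarrow> hs \<in> C"
  proof (rule AE_pmfI, rule impI)
    fix hs assume hs: "hs \<in> set_pmf ?D" "(hs \<in> A) \<noteq> (hs \<in> B)"
    obtain I where I: "table b m (count_list hs) (hash_table b m hs) I"
      using table_hash[OF m0 m(1,2) hs(1)] by blast
    have "hs \<in> A \<longleftrightarrow> ends_at b (I ((s + m - K) mod m)) (\<lambda>i. count_list hs ((s + m - K + i) mod m)) K u"
      using table.exact_ends_at[OF I m(3,4), of u] by (simp add: A_def exact_U_def Let_def)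
    hence "ends_at b (I ((s + m - K) mod m)) (\<lambda>i. count_list hs ((s + m - K + i) mod m)) K u \<noteq>
       ends_at b 0 (\<lambda>i. count_list hs ((s + m - K + i) mod m)) K u"
      using hs by (simp add: B_def)
    from table.no_coupling_full_run[OF I this] show "hs \<in> C" by (auto simp: C_def)
  qed
  have "measure_pmf.prob ?D A \<le> measure_pmf.prob ?D (B \<union> C)"
    by (rule measure_pmf.finite_measure_mono_AE, rule eventually_mono[OF AE], auto)
  moreover have "measure_pmf.prob ?D B \<le> measure_pmf.prob ?D (A \<union> C)"
    by (rule measure_pmf.finite_measure_mono_AE, rule eventually_mono[OF AE], auto)
  moreover have "measure_pmf.prob ?D (B \<union> C) \<le> measure_pmf.prob ?D B + measure_pmf.prob ?D C"
     "measure_pmf.prob ?D (A \<union> C) \<le> measure_pmf.prob ?D A + measure_pmf.prob ?D C"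
    by (intro measure_Un_le; simp)+
  moreover have "measure_pmf.prob ?D C \<le> rho a ^ (b * K) / (1 - rho a)"
    unfolding C_def by (rule prob_full_run) fact+
  ultimately show ?thesis unfolding A_def[symmetric] B_def[symmetric] by linarith
qed

section \<open>Poisson limit of the hash counts\<close>

text \<open>All cells outside \<open>J\<close> are lumped into one. If the prescribed counts exceed
  \<open>n\<close>, the binomial coefficient vanishes, so the truncated exponent does no
  harm.\<close>

definition multinomial_prob :: "nat \<Rightarrow> nat \<Rightarrow> 'i set \<Rightarrow> ('i \<Rightarrow> nat) \<Rightarrow> real" where
  "multinomial_prob m n J g = real (n choose sum g J) * (fact (sum g J) / (\<Prod>i\<in>J. fact (g i))) *
     (1 / m) ^ sum g J * (1 - card J / m) ^ (n - sum g J)"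

text \<open>Pascal's rule: one key lands either in a cell \<open>i\<close> of \<open>J\<close>,
  whose remaining count drops by one, or in one of the \<open>m - card J\<close> other
  cells.\<close>

lemma multinomial_prob_Suc:
  assumes m: "m > 0" and J: "finite J"
  shows "multinomial_prob m (Suc n) J g =
    ((\<Sum>i\<in>J. if g i = 0 then 0 else multinomial_prob m n J (g(i := g i - 1))) +
     (real m - card J) * multinomial_prob m n J g) / m"
proof -
  define G where "G = sum g J"
  define P where "P = (\<Prod>i\<in>J. fact (g i) :: real)"
  define v where "v = 1 - card J / real m"
  have v: "(real m - card J) / m = v" using m by (simp add: v_def field_simps)
  have P: "P > 0" unfolding P_def by (intro prod_pos) auto
  have upd: "(if g i = 0 then 0 else multinomial_prob m n J (g(i := g i - 1))) =
      g i * (real (n choose (G - 1)) * (fact (G - 1) / P) * (1 / m) ^ (G - 1) * v ^ (n - (G - 1)))"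
    if i: "i \<in> J" for i
  proof (cases "g i")
    case (Suc k)
    have "sum (g(i := k)) J = G - 1"
      using i J Suc by (simp add: G_def sum.remove[of J i])
    moreover have "(\<Prod>j\<in>J. fact ((g(i := k)) j) :: real) = P / g i"
      using i J Suc by (simp add: P_def prod.remove[of J i])
    ultimately show ?thesis using Suc P by (simp add: multinomial_prob_def v_def)
  qed simp
  have S: "(\<Sum>i\<in>J. if g i = 0 then 0 else multinomial_prob m n J (g(i := g i - 1))) =
      G * (real (n choose (G - 1)) * (fact (G - 1) / P) * (1 / m) ^ (G - 1) * v ^ (n - (G - 1)))"
  proof -
    define C where "C = real (n choose (G - 1)) * (fact (G - 1) / P) * (1 / m) ^ (G - 1) * v ^ (n - (G - 1))"
    have "(\<Sum>i\<in>J. if g i = 0 then 0 else multinomial_prob m n J (g(i := g i - 1))) = (\<Sum>i\<in>J. g i * C)"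
      by (intro sum.cong refl) (simp only: upd C_def)
    also have "\<dots> = G * C" by (simp add: G_def sum_distrib_right)
    finally show ?thesis by (simp only: C_def)
  qed
  have F: "multinomial_prob m k J g = real (k choose G) * (fact G / P) * (1 / m) ^ G * v ^ (k - G)" for k
    by (simp add: multinomial_prob_def G_def P_def v_def)
  show ?thesis
  proof (cases G)
    case 0
    thus ?thesis unfolding S F v[symmetric] by simp
  next
    case (Suc G')
    have "real (n choose G) * v ^ (n - G') = real (n choose G) * (v * v ^ (n - G))"
    proof (cases "G \<le> n")
      case True
      hence "n - G' = Suc (n - G)" using Suc by simp
      thus ?thesis by simp
    qed simp
    hence "real (Suc n choose G) * v ^ (Suc n - G) = real (n choose G') * v ^ (n - G') + v * (real (n choose G) * v ^ (n - G))"
      using Suc by (simp add: algebra_simps)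
    hence "multinomial_prob m (Suc n) J g = 
       (real (n choose G') * v ^ (n - G') + v * (real (n choose G) * v ^ (n - G))) * ((fact G / P) * (1 / m) ^ G)"
    proof -
      have "multinomial_prob m (Suc n) J g = (real (Suc n choose G) * v ^ (Suc n - G)) * ((fact G / P) * (1 / m) ^ G)"
        unfolding F by (simp only: mult_ac)
      thus ?thesis by (simp only: \<open>real (Suc n choose G) * v ^ (Suc n - G) = _\<close>)
    qed
    also have "\<dots> = (G * (real (n choose (G - 1)) * (fact (G - 1) / P) * (1 / m) ^ (G - 1) * v ^ (n - (G - 1)))) / m
       + v * multinomial_prob m n J g"
      unfolding F using Suc m by (simp add: algebra_simps add_divide_distrib)
    finally show ?thesis unfolding S add_divide_distrib v[symmetric] by simp
  qed
qed

lemma prob_counts: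
  assumes m: "m > 0" and J: "finite J" "inj_on pos J" "pos ` J \<subseteq> {..<m}"
  shows "measure_pmf.prob (hash_addresses m n) {hs. \<forall>i\<in>J. count_list hs (pos i) = g i} =
    multinomial_prob m n J g"
proof (induction n arbitrary: g)
  case 0
  show ?case
  proof (cases "\<forall>i\<in>J. g i = 0")
    case True
    thus ?thesis by (simp add: hash_addresses_def multinomial_prob_def)
  next
    case False
    then obtain i where "i \<in> J" "g i \<noteq> 0" by auto
    hence "sum g J > 0" using J member_le_sum[of i J g] by simp
    moreover have "[] \<notin> {hs. \<forall>i\<in>J. count_list hs (pos i) = g i}" using False by auto
    ultimately show ?thesis by (simp add: hash_addresses_def multinomial_prob_def)
  qed
next
  case (Suc n)
  let ?E = "\<lambda>g. {hs. \<forall>i\<in>J. count_list hs (pos i) = g i}"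
  define p where "p x = measure_pmf.prob (hash_addresses m n) {hs. x # hs \<in> ?E g}" for x
  have out: "p x = multinomial_prob m n J g" if "x \<notin> pos ` J" for x
  proof -
    have "{hs. x # hs \<in> ?E g} = ?E g" using that by auto
    thus ?thesis unfolding p_def by (simp only: Suc.IH)
  qed
  have inn: "p (pos i) = (if g i = 0 then 0 else multinomial_prob m n J (g(i := g i - 1)))" if i: "i \<in> J" for i
  proof -
    have "{hs. pos i # hs \<in> ?E g} = (if g i = 0 then {} else ?E (g(i := g i - 1)))"
    proof -
      have ne: "pos j = pos i \<longleftrightarrow> j = i" if "j \<in> J" for j
        using J i that by (auto simp: inj_on_def)
      have "(\<forall>j\<in>J. count_list (pos i # hs) (pos j) = g j) \<longleftrightarrow> g i \<noteq> 0 \<and> (\<forall>j\<in>J. count_list hs (pos j) = (g(i := g i - 1)) j)" for hs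
      proof
        assume *: "\<forall>j\<in>J. count_list (pos i # hs) (pos j) = g j"
        show "g i \<noteq> 0 \<and> (\<forall>j\<in>J. count_list hs (pos j) = (g(i := g i - 1)) j)"
        proof (intro conjI ballI)
          show "g i \<noteq> 0" using * i by force
          fix j assume j: "j \<in> J"
          show "count_list hs (pos j) = (g(i := g i - 1)) j"
            using bspec[OF * j] ne[OF j] by (auto split: if_splits)
        qed
      next
        assume *: "g i \<noteq> 0 \<and> (\<forall>j\<in>J. count_list hs (pos j) = (g(i := g i - 1)) j)"
        show "\<forall>j\<in>J. count_list (pos i # hs) (pos j) = g j"
        proof
          fix j assume j: "j \<in> J"
          show "count_list (pos i # hs) (pos j) = g j"
            using bspec[OF conjunct2[OF *] j] conjunct1[OF *] ne[OF j] by (auto split: if_splits)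
        qed
      qed
      thus ?thesis by auto
    qed
    thus ?thesis unfolding p_def using Suc.IH[of "g(i := g i - 1)"]
      by (cases "g i = 0") (simp_all only: if_True if_False measure_empty simp_thms)
  qed
  have "(\<Sum>x<m. p x) = (\<Sum>x\<in>{..<m} - pos ` J. p x) + (\<Sum>x\<in>pos ` J. p x)"
    by (rule sum.subset_diff) (use J in auto)
  also have "(\<Sum>x\<in>{..<m} - pos ` J. p x) = (\<Sum>x\<in>{..<m} - pos ` J. multinomial_prob m n J g)"
    by (intro sum.cong) (use out in auto)
  also have "\<dots> = (real m - card J) * multinomial_prob m n J g"
  proof -
    have "card (pos ` J) = card J" "card (pos ` J) \<le> m"
      using J card_mono[of "{..<m}" "pos ` J"] by (auto simp: card_image)
    thus ?thesis using J by (simp add: card_Diff_subset of_nat_diff)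
  qed
  also have "(\<Sum>x\<in>pos ` J. p x) = (\<Sum>i\<in>J. p (pos i))"
    using J by (simp add: sum.reindex)
  also have "\<dots> = (\<Sum>i\<in>J. if g i = 0 then 0 else multinomial_prob m n J (g(i := g i - 1)))"
    by (intro sum.cong inn) auto
  finally have "(\<Sum>x<m. p x) / m = multinomial_prob m (Suc n) J g"
    unfolding multinomial_prob_Suc[OF m J(1)] by (simp only: add.commute)
  thus ?case unfolding prob_hash_Suc[OF m] p_def .
qed

lemma tendsto_one_minus_power:
  fixes m n :: "nat \<Rightarrow> nat" and N :: nat and l :: real
  assumes m: "filterlim m at_top sequentially" and mn: "(\<lambda>k. n k / m k) \<longlonglongrightarrow> l"
  shows "(\<lambda>k. (1 - N / m k) ^ n k) \<longlonglongrightarrow> exp (- l * N)"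
proof -
  have mr: "filterlim (\<lambda>k. real (m k)) at_top sequentially"
    by (rule filterlim_compose[OF filterlim_real_sequentially m])
  have "((\<lambda>x::real. x * ln (1 - real N / x)) \<longlongrightarrow> - real N) at_top"
    by real_asymp
  from filterlim_compose[OF this mr]
  have "(\<lambda>k. (n k / m k) * (m k * ln (1 - real N / m k))) \<longlonglongrightarrow> l * (- real N)"
    by (intro tendsto_mult mn) 
  hence "(\<lambda>k. exp ((n k / m k) * (m k * ln (1 - real N / m k)))) \<longlonglongrightarrow> exp (- l * N)"
    by (intro tendsto_exp) simp
  moreover have "eventually (\<lambda>k. exp ((n k / m k) * (m k * ln (1 - real N / m k))) = (1 - N / m k) ^ n k) sequentially"
    using filterlim_at_top[THEN iffD1, OF m, rule_format, of "Suc N"]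
  proof eventually_elim
    case (elim k)
    have "1 - real N / m k > 0" using elim by simp
    hence "(1 - N / m k) ^ n k = exp (n k * ln (1 - real N / m k))"
      by (simp add: exp_of_nat_mult)
    thus ?case using elim by simp
  qed
  ultimately show ?thesis by (rule Lim_transform_eventually)
qed

text \<open>The falling factorial of \<open>n\<close> over \<open>m ^ G\<close> is a product of
  \<open>G\<close> factors tending to \<open>l\<close>, and the power tends to an exponential. The
  positions may move with \<open>k\<close>, as the start of the search does.\<close>

lemma prob_counts_tendsto:
  fixes m n :: "nat \<Rightarrow> nat" and l :: real
  assumes m: "filterlim m at_top sequentially" and n: "filterlim n at_top sequentially"
    and mn: "(\<lambda>k. n k / m k) \<longlonglongrightarrow> l" and l: "l > 0"
    and J: "finite J" "eventually (\<lambda>k. inj_on (pos k) J \<and> pos k ` J \<subseteq> {..<m k}) sequentially"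
  shows "(\<lambda>k. measure_pmf.prob (hash_addresses (m k) (n k)) {hs. \<forall>i\<in>J. count_list hs (pos k i) = g i})
    \<longlonglongrightarrow> (\<Prod>i\<in>J. pmf (poisson_pmf l) (g i))"
proof -
  define G where "G = sum g J"
  define P where "P = (\<Prod>i\<in>J. fact (g i) :: real)"
  have mr: "filterlim (\<lambda>k. real (m k)) at_top sequentially"
    by (rule filterlim_compose[OF filterlim_real_sequentially m])
  have c0: "(\<lambda>k. c / real (m k)) \<longlonglongrightarrow> 0" for c
    by (rule real_tendsto_divide_at_top[OF tendsto_const mr])
  have "(\<lambda>k. (\<Prod>i<G. n k / m k - i / m k)) \<longlonglongrightarrow> (\<Prod>i<G. l - 0)"
    by (intro tendsto_prod tendsto_diff mn c0)
  hence 1: "(\<lambda>k. (\<Prod>i<G. n k / m k - i / m k)) \<longlonglongrightarrow> l ^ G" by simp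
  have "(\<lambda>k. (1 - card J / m k) ^ G) \<longlonglongrightarrow> (1 - 0) ^ G"
    by (intro tendsto_intros c0)
  hence 2: "(\<lambda>k. (1 - card J / m k) ^ n k / (1 - card J / m k) ^ G) \<longlonglongrightarrow> exp (- l * card J) / 1"
    by (intro tendsto_divide tendsto_one_minus_power m mn) auto
  have "(\<lambda>k. (\<Prod>i<G. n k / m k - i / m k) / P * ((1 - card J / m k) ^ n k / (1 - card J / m k) ^ G))
    \<longlonglongrightarrow> l ^ G / P * (exp (- l * card J) / 1)"
    by (intro tendsto_mult tendsto_divide 1 2 tendsto_const) (auto simp: P_def J)
  also have "exp (- l * card J) = exp (- l) ^ card J"
    by (simp add: exp_of_nat_mult[symmetric] mult.commute)
  also have "l ^ G / P * (exp (- l) ^ card J / 1) = (\<Prod>i\<in>J. pmf (poisson_pmf l) (g i))"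
    using l by (simp add: prod_dividef prod.distrib power_sum G_def P_def)
  finally show ?thesis
  proof (rule Lim_transform_eventually)
    show "eventually (\<lambda>k. (\<Prod>i<G. n k / m k - i / m k) / P * ((1 - card J / m k) ^ n k / (1 - card J / m k) ^ G) =
      measure_pmf.prob (hash_addresses (m k) (n k)) {hs. \<forall>i\<in>J. count_list hs (pos k i) = g i}) sequentially"
      using J(2) filterlim_at_top[THEN iffD1, OF m, rule_format, of "Suc (card J)"]
        filterlim_at_top[THEN iffD1, OF n, rule_format, of G]
    proof eventually_elim
      case (elim k)
      have m0: "m k > 0" using elim by simp
      have "real (n k choose G) * fact G = (\<Prod>i<G. real (n k) - real i)"
        by (simp add: binomial_gbinomial gbinomial_prod_rev atLeast0LessThan)
      also have "\<dots> = (\<Prod>i<G. (n k / m k - i / m k) * m k)"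
        using m0 by (intro prod.cong) (auto simp: field_simps)
      also have "\<dots> = (\<Prod>i<G. n k / m k - i / m k) * m k ^ G"
        by (simp add: prod.distrib)
      finally have ch: "real (n k choose G) * fact G * (1 / m k) ^ G = (\<Prod>i<G. n k / m k - i / m k)"
        using m0 by (simp add: power_divide)
      have "1 - card J / m k \<noteq> 0" using elim by simp
      hence pw: "(1 - card J / m k) ^ (n k - G) = (1 - card J / m k) ^ n k / (1 - card J / m k) ^ G"
        using elim by (simp add: power_diff)
      show ?case
        using elim ch prob_counts[OF m0 J(1), of "pos k" "n k" g]
        by (simp add: multinomial_prob_def G_def[symmetric] P_def[symmetric] pw ch[symmetric])
    qed
  qed
qed

text \<open>The probability of the truncated event in the Poisson model, and at the same time its
  limit in the exact model.\<close>

definition window_prob :: "nat \<Rightarrow> real \<Rightarrow> nat \<Rightarrow> nat \<Rightarrow> real" where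
  "window_prob b l K u = (\<Sum>g\<in>windows b K u. \<Prod>i<Suc (K + u div b). pmf (poisson_pmf l) (g i))"

lemma prob_window_tendsto:
  fixes m n s :: "nat \<Rightarrow> nat" and l :: real
  assumes m: "filterlim m at_top sequentially" and n: "filterlim n at_top sequentially"
    and mn: "(\<lambda>k. n k / m k) \<longlonglongrightarrow> l" and l: "l > 0" and b: "b \<ge> 1"
  shows "(\<lambda>k. measure_pmf.prob (hash_addresses (m k) (n k))
       {hs. ends_at b 0 (\<lambda>i. count_list hs ((s k + m k - K + i) mod m k)) K u})
    \<longlonglongrightarrow> window_prob b l K u"
proof -
  let ?N = "Suc (K + u div b)"
  have "measure_pmf.prob (hash_addresses (m k) (n k)) {hs. ends_at b 0 (\<lambda>i. count_list hs ((s k + m k - K + i) mod m k)) K u} =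
    (\<Sum>g\<in>windows b K u. measure_pmf.prob (hash_addresses (m k) (n k))
       {hs. \<forall>i\<in>{..<?N}. count_list hs ((s k + m k - K + i) mod m k) = g i})" for k
    using measure_pmf.measure_ends_at(1)[OF b, where M = "hash_addresses (m k) (n k)" and K = K and u = u
        and f = "\<lambda>hs i. count_list hs ((s k + m k - K + i) mod m k)"] by (simp add: lessThan_iff Ball_def)
  thus ?thesis
    unfolding window_prob_def
  proof (simp only:, intro tendsto_sum prob_counts_tendsto m n mn l)
    show "eventually (\<lambda>k. inj_on (\<lambda>i. (s k + m k - K + i) mod m k) {..<?N} \<and>
        (\<lambda>i. (s k + m k - K + i) mod m k) ` {..<?N} \<subseteq> {..<m k}) sequentially"
      using filterlim_at_top[THEN iffD1, OF m, rule_format, of ?N]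
      by eventually_elim (intro conjI add_mod_inj_on; auto)
  qed auto
qed

section \<open>Configurations on the integers\<close>

definition back_sum :: "(int \<Rightarrow> nat) \<Rightarrow> int \<Rightarrow> nat \<Rightarrow> nat" where
  "back_sum x i L = (\<Sum>k<L. x (i - int k))"

lemma back_sum_0 [simp]: "back_sum x i 0 = 0"
  by (simp add: back_sum_def)

lemma back_sum_Suc: "back_sum x i (Suc L) = back_sum x i L + x (i - int L)"
  by (simp add: back_sum_def)

lemma back_sum_add: "back_sum x i (k + L) = back_sum x i k + back_sum x (i - int k) L"
  by (induction L) (auto simp: back_sum_Suc algebra_simps)

lemma back_sum_Suc_left: "back_sum x (i + 1) (Suc L) = x (i + 1) + back_sum x i L"
  using back_sum_add[of x "i + 1" 1 L] by (simp add: back_sum_Suc)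

definition surplus :: "nat \<Rightarrow> (int \<Rightarrow> nat) \<Rightarrow> int \<Rightarrow> nat \<Rightarrow> int" where
  "surplus b x i L = int (back_sum x i L) - int (b * L)"

lemma inf_H_altdef: "inf_H b x i = int b + (SUP L\<in>{1..}. surplus b x i L)"
proof -
  have "(\<lambda>j. \<Sum>k\<in>{j+1..i}. int (x k) - int b) ` {..<i} = surplus b x i ` {1..}"
  proof -
    have 1: "{..<i} = (\<lambda>L. i - int L) ` {1..}"
    proof (intro set_eqI iffI)
      fix j assume "j \<in> {..<i}"
      hence "j = i - int (nat (i - j))" "nat (i - j) \<in> {1..}" by auto
      thus "j \<in> (\<lambda>L. i - int L) ` {1..}" by blast
    qed auto
    have 2: "(\<Sum>k\<in>{i - int L + 1..i}. int (x k) - int b) = surplus b x i L" for L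
    proof -
      have "{i - int L + 1..i} = (\<lambda>k. i - int k) ` {..<L}"
      proof (intro set_eqI iffI)
        fix k assume "k \<in> {i - int L + 1..i}"
        hence "k = i - int (nat (i - k))" "nat (i - k) \<in> {..<L}" by auto
        thus "k \<in> (\<lambda>k. i - int k) ` {..<L}" by blast
      qed auto
      moreover have "inj_on (\<lambda>k. i - int k) {..<L}" by (auto simp: inj_on_def)
      ultimately show ?thesis
        by (simp add: sum.reindex surplus_def back_sum_def sum_subtractf mult.commute card_image)
    qed
    show ?thesis unfolding 1 image_image 2 ..
  qed
  thus ?thesis by (simp add: inf_H_def)
qed

lemma inf_H_cong:
  assumes "\<And>k. k \<le> i \<Longrightarrow> x k = y k"
  shows "inf_H b x i = inf_H b y i"
proof -
  have "back_sum x i L = back_sum y i L" for L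
    using assms by (auto simp: back_sum_def intro!: sum.cong)
  thus ?thesis by (simp add: inf_H_altdef surplus_def)
qed

lemma inf_H_shift: "inf_H b (\<lambda>k. x (k + 1)) i = inf_H b x (i + 1)"
proof -
  have "back_sum (\<lambda>k. x (k + 1)) i L = back_sum x (i + 1) L" for L
    by (simp add: back_sum_def algebra_simps)
  thus ?thesis by (simp add: inf_H_altdef surplus_def)
qed

text \<open>The almost sure property that makes the suprema in \<open>inf_H\<close> attained maxima;
  given it, the link between \<open>inf_H\<close> and the Lindley recursion is
  deterministic.\<close>

definition subcritical :: "nat \<Rightarrow> (int \<Rightarrow> nat) \<Rightarrow> bool" where
  "subcritical b x \<longleftrightarrow> (\<forall>i. eventually (\<lambda>L. back_sum x i L < b * L) sequentially)"

text \<open>The overflow out of bucket \<open>i\<close>, whereas \<open>table_inv\<close> indexes by the bucket that receives it.\<close>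
definition overflow :: "nat \<Rightarrow> (int \<Rightarrow> nat) \<Rightarrow> int \<Rightarrow> nat" where
  "overflow b x i = nat (inf_H b x i - int b)"

context
  fixes b :: nat and x :: "int \<Rightarrow> nat"
  assumes sub: "subcritical b x"
begin

lemma inf_H_max:
  obtains L where "L \<ge> 1" "inf_H b x i = int b + surplus b x i L"
    "\<And>L'. L' \<ge> 1 \<Longrightarrow> surplus b x i L' \<le> surplus b x i L"
proof -
  obtain N where N: "\<And>L. L \<ge> N \<Longrightarrow> back_sum x i L < b * L"
    using sub by (auto simp: subcritical_def eventually_sequentially)
  define B where "B = Max (insert 0 (surplus b x i ` {..N}))"
  have B: "surplus b x i L \<le> B" for L
  proof (cases "L \<le> N")
    case True thus ?thesis unfolding B_def by (intro Max_ge) auto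
  next
    case False
    hence "surplus b x i L \<le> 0" using N[of L] by (simp add: surplus_def flip: of_nat_mult)
    also have "0 \<le> B" unfolding B_def by (intro Max_ge) auto
    finally show ?thesis .
  qed
  \<comment> \<open>Dropping the values below the one at \<open>L = 1\<close> leaves a nonempty set
    between two bounds, so a maximum exists; only then does the supremum on the integers have a
    usable value.\<close>
  define S where "S = {v \<in> surplus b x i ` {1..}. v \<ge> surplus b x i 1}"
  have fin: "finite S"
    by (rule finite_subset[of _ "{surplus b x i 1..B}"]) (use B in \<open>auto simp: S_def\<close>)
  have ne: "surplus b x i 1 \<in> S" by (auto simp: S_def)
  have "Max S \<in> S" using fin ne by (intro Max_in) auto
  then obtain L where L: "L \<ge> 1" "Max S = surplus b x i L" by (auto simp: S_def)
  have max: "surplus b x i L' \<le> surplus b x i L" if "L' \<ge> 1" for L'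
  proof (cases "surplus b x i L' \<ge> surplus b x i 1")
    case True
    hence "surplus b x i L' \<in> S" using that by (auto simp: S_def)
    thus ?thesis using Max_ge[OF fin] L by metis
  next
    case False
    thus ?thesis using Max_ge[OF fin ne] L by simp
  qed
  have "(SUP L\<in>{1..}. surplus b x i L) = surplus b x i L"
    by (rule cSup_eq_maximum) (use L max in auto)
  thus ?thesis using that[of L] L max by (simp add: inf_H_altdef)
qed

text \<open>Splitting off bucket \<open>i + 1\<close> turns a window of length \<open>L + 1\<close>
  ending there into one of length \<open>L\<close> ending at \<open>i\<close>; the empty window,
  \<open>L = 0\<close>, supplies the maximum with 0.\<close>

lemma inf_H_step: "inf_H b x (i + 1) = int (x (i + 1)) + int (overflow b x i)"
proof -
  obtain L1 where L1: "L1 \<ge> 1" "inf_H b x i = int b + surplus b x i L1"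
    "\<And>L'. L' \<ge> 1 \<Longrightarrow> surplus b x i L' \<le> surplus b x i L1" using inf_H_max[of i] by metis
  obtain L2 where L2: "L2 \<ge> 1" "inf_H b x (i + 1) = int b + surplus b x (i + 1) L2"
    "\<And>L'. L' \<ge> 1 \<Longrightarrow> surplus b x (i + 1) L' \<le> surplus b x (i + 1) L2" using inf_H_max[of "i + 1"] by metis
  have s: "int b + surplus b x (i + 1) (Suc L) = int (x (i + 1)) + surplus b x i L" for L
    unfolding surplus_def back_sum_Suc_left by (simp add: algebra_simps)
  obtain L' where L': "L2 = Suc L'" using L2(1) by (cases L2) auto
  have o: "int (overflow b x i) = max 0 (surplus b x i L1)"
    by (simp add: overflow_def L1(2))
  have "surplus b x i L' \<le> max 0 (surplus b x i L1)"
    using L1(3)[of L'] by (cases L') (auto simp: surplus_def)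
  moreover have "max 0 (surplus b x i L1) \<le> surplus b x i L'"
    using L2(3)[of 1] L2(3)[of "Suc L1"] s[of 0] s[of L1] s[of L'] unfolding L'
    by (simp add: surplus_def[of b x i 0])
  ultimately show ?thesis using s[of L'] L2(2) unfolding L' o by simp
qed

lemma overflow_step: "overflow b x (i + 1) = overflow b x i + x (i + 1) - b"
  by (subst overflow_def, subst inf_H_step) simp

lemma overflow_lind: "overflow b x (a + int i) = lind b (overflow b x a) (\<lambda>i. x (a + 1 + int i)) i"
proof (induction i)
  case (Suc i)
  have "overflow b x (a + int (Suc i)) = overflow b x ((a + int i) + 1)" by (simp add: algebra_simps)
  also have "\<dots> = overflow b x (a + int i) + x (a + 1 + int i) - b"
    by (subst overflow_step) (simp add: algebra_simps)
  finally show ?case using Suc.IH by simp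
qed simp

lemma inf_H_lind:
  "inf_H b x (a + 1 + int i) = int (lind b (overflow b x a) (\<lambda>i. x (a + 1 + int i)) i + x (a + 1 + int i))"
proof -
  have "inf_H b x ((a + int i) + 1) = int (x ((a + int i) + 1)) + int (overflow b x (a + int i))"
    by (rule inf_H_step)
  thus ?thesis unfolding overflow_lind by (simp add: algebra_simps)
qed

text \<open>If the window found for the first \<open>k\<close> buckets reaches further back, it
  still serves; otherwise it stops right next to bucket \<open>e - int k\<close>, which is full, and
  the maximising window of that bucket is appended.\<close>

lemma inf_full_run:
  assumes "\<And>i. i < k \<Longrightarrow> inf_full b x (e - int i)"
  shows "\<exists>L\<ge>k. b * L \<le> back_sum x e L"
  using assms
proof (induction k)
  case 0
  show ?case by (intro exI[of _ 0]) auto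
next
  case (Suc k)
  then obtain L where L: "L \<ge> k" "b * L \<le> back_sum x e L" by auto
  show ?case
  proof (cases "L = k")
    case True
    obtain L1 where L1: "L1 \<ge> 1" "inf_H b x (e - int k) = int b + surplus b x (e - int k) L1"
      using inf_H_max[of "e - int k"] by metis
    have "inf_full b x (e - int k)" by (rule Suc.prems) auto
    hence "b * L1 \<le> back_sum x (e - int k) L1"
      using L1 by (simp add: inf_full_def surplus_def flip: of_nat_mult)
    hence "b * (k + L1) \<le> back_sum x e (k + L1)"
      using L True by (simp only: back_sum_add distrib_left)
    thus ?thesis using L1 by (intro exI[of _ "k + L1"]) auto
  qed (use L in \<open>auto intro!: exI[of _ L]\<close>)
qed

lemma inf_U_eq_iff:
  assumes b: "b \<ge> 1" and ex: "\<exists>k. \<not> inf_full b x (int k)"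
  shows "inf_U b x = u \<longleftrightarrow> ends_at b (overflow b x (- int K - 1)) (\<lambda>i. x (int i - int K)) K u"
proof -
  define h where "h i = lind b (overflow b x (- int K - 1)) (\<lambda>i. x (int i - int K)) (K + i) + x (int i)" for i
  have H: "inf_H b x (int i) = int (h i)" for i
    using inf_H_lind[of "- int K - 1" "K + i"] by (simp add: h_def)
  have full: "inf_full b x (int i) \<longleftrightarrow> b \<le> h i" for i by (simp add: inf_full_def H)
  have U0: "\<not> inf_full b x (int (inf_U0 b x))" "\<And>i. i < inf_U0 b x \<Longrightarrow> inf_full b x (int i)"
  proof -
    obtain k where "\<not> inf_full b x (int k)" using ex by auto
    thus "\<not> inf_full b x (int (inf_U0 b x))" unfolding inf_U0_def by (rule LeastI)
    show "inf_full b x (int i)" if "i < inf_U0 b x" for i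
      using not_less_Least[of i "\<lambda>k. \<not> inf_full b x (int k)"] that by (auto simp: inf_U0_def)
  qed
  define k where "k = inf_U0 b x"
  have k: "h k < b" "\<And>i. i < k \<Longrightarrow> b \<le> h i" using U0 by (auto simp: full k_def not_le)
  have U: "inf_U b x = b * k + h k" using k by (simp add: inf_U_def inf_Y_def k_def[symmetric] H)
  have R: "ends_at b (overflow b x (- int K - 1)) (\<lambda>i. x (int i - int K)) K u \<longleftrightarrow>
     (\<forall>i<u div b. b \<le> h i) \<and> h (u div b) = u mod b"
    by (simp add: ends_at_def h_def)
  show ?thesis
  proof
    assume "inf_U b x = u"
    hence "u div b = k" "u mod b = h k" using k U by auto
    thus "ends_at b (overflow b x (- int K - 1)) (\<lambda>i. x (int i - int K)) K u" unfolding R using k by auto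
  next
    assume "ends_at b (overflow b x (- int K - 1)) (\<lambda>i. x (int i - int K)) K u"
    hence *: "\<forall>i<u div b. b \<le> h i" "h (u div b) = u mod b" unfolding R by auto
    have "u mod b < b" using b by simp
    hence "k = u div b"
      using * k by (metis linorder_neqE_nat not_le)
    thus "inf_U b x = u" using * U by simp
  qed
qed

lemma no_coupling_inf_full:
  assumes "ends_at b (overflow b x (- int K - 1)) (\<lambda>i. x (int i - int K)) K u \<noteq> ends_at b 0 (\<lambda>i. x (int i - int K)) K u"
    "i < K"
  shows "inf_full b x (- 1 - int i)"
proof -
  let ?f = "\<lambda>i. x (int i - int K)"
  have "lind b (overflow b x (- int K - 1)) ?f (K - i) \<noteq> 0"
    using ends_at_coupling[of b _ _ "K - i" K] assms by (metis diff_le_self)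
  moreover have "overflow b x (- 1 - int i) = lind b (overflow b x (- int K - 1)) ?f (K - i)"
  proof -
    have "- int K - 1 + int (K - i) = - 1 - int i" using assms(2) by simp
    thus ?thesis using overflow_lind[of "- int K - 1" "K - i"] by simp
  qed
  ultimately show ?thesis by (simp add: overflow_def inf_full_def)
qed

end

section \<open>Measurability of the overflow and of the search length\<close>

lemma measurable_apply2_count_space:
  assumes "f \<in> measurable N (count_space UNIV)" "g \<in> measurable N (count_space UNIV)"
  shows "(\<lambda>x. h (f x :: 'a :: countable) (g x :: 'b :: countable)) \<in> measurable N (count_space UNIV)"
  by (rule measurable_compose_countable[OF _ assms(1)])
    (rule measurable_compose[OF assms(2)], simp)

text \<open>Unfolds \<open>Sup\<close> also when no maximum exists; it is then one fixed integer, so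
  the supremum is measurable everywhere and not merely up to a null set.\<close>

lemma Sup_int_image:
  fixes v :: "nat \<Rightarrow> int"
  shows "(SUP L\<in>{1..}. v L) =
    (if \<exists>L. L \<ge> 1 \<and> (\<forall>L'\<ge>1. v L' \<le> v L) then v (LEAST L. L \<ge> 1 \<and> (\<forall>L'\<ge>1. v L' \<le> v L)) else (THE _. False))"
proof (cases "\<exists>L. L \<ge> 1 \<and> (\<forall>L'\<ge>1. v L' \<le> v L)")
  case True
  from LeastI_ex[OF this] have "(SUP L\<in>{1..}. v L) = v (LEAST L. L \<ge> 1 \<and> (\<forall>L'\<ge>1. v L' \<le> v L))"
    by (intro cSup_eq_maximum) auto
  thus ?thesis using True by simp
next
  case False
  have "(\<lambda>w. w \<in> v ` {1..} \<and> (\<forall>y\<in>v ` {1..}. y \<le> w)) = (\<lambda>_. False)"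
  proof (intro ext iffI)
    fix w assume w: "w \<in> v ` {1..} \<and> (\<forall>y\<in>v ` {1..}. y \<le> w)"
    then obtain L where "L \<ge> 1" "w = v L" by auto
    thus False using False w by auto
  qed auto
  thus ?thesis using False by (simp only: Sup_int_def if_False)
qed

text \<open>Only coordinates up to \<open>i\<close> are asked to be measurable, since
  \<open>killed_past\<close> applies this on the product space over the past.\<close>

lemma measurable_inf_H:
  assumes "\<And>k. k \<le> i \<Longrightarrow> (\<lambda>\<omega>. f \<omega> k) \<in> measurable N (count_space UNIV)"
  shows "(\<lambda>\<omega>. inf_H b (f \<omega>) i) \<in> measurable N (count_space UNIV)"
proof -
  have bs: "(\<lambda>\<omega>. back_sum (f \<omega>) i L) \<in> measurable N (count_space UNIV)" for L
  proof (induction L)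
    case (Suc L)
    show ?case unfolding back_sum_Suc
      by (rule measurable_apply2_count_space[OF Suc.IH assms]) simp
  qed simp
  have v: "(\<lambda>\<omega>. surplus b (f \<omega>) i L) \<in> measurable N (count_space UNIV)" for L
    unfolding surplus_def by (rule measurable_compose[OF bs]) simp
  have le: "Measurable.pred N (\<lambda>\<omega>. surplus b (f \<omega>) i L' \<le> surplus b (f \<omega>) i L)" for L L'
    by (rule measurable_apply2_count_space[OF v v])
  have pL: "Measurable.pred N (\<lambda>\<omega>. L \<ge> 1 \<and> (\<forall>L'\<ge>1. surplus b (f \<omega>) i L' \<le> surplus b (f \<omega>) i L))" for L
    using le by measurable
  have "(\<lambda>\<omega>. SUP L\<in>{1..}. surplus b (f \<omega>) i L) \<in> measurable N (count_space UNIV)"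
    unfolding Sup_int_image
    by (intro measurable_If measurable_compose_countable[OF v] measurable_Least pL measurable_const)
      (use pL in measurable)
  thus ?thesis unfolding inf_H_altdef by (rule measurable_compose) simp
qed

lemma measurable_inf_U:
  assumes "\<And>k. (\<lambda>\<omega>. f \<omega> k) \<in> measurable N (count_space UNIV)"
  shows "(\<lambda>\<omega>. inf_U b (f \<omega>)) \<in> measurable N (count_space UNIV)"
proof -
  have H: "(\<lambda>\<omega>. inf_H b (f \<omega>) i) \<in> measurable N (count_space UNIV)" for i
    by (rule measurable_inf_H) (rule assms)
  have Y: "(\<lambda>\<omega>. inf_Y b (f \<omega>) i) \<in> measurable N (count_space UNIV)" for i
    unfolding inf_Y_def by (rule measurable_compose[OF H]) simp
  have F: "Measurable.pred N (\<lambda>\<omega>. \<not> inf_full b (f \<omega>) i)" for i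
    unfolding inf_full_def by (rule measurable_compose[OF H]) simp
  have U0: "(\<lambda>\<omega>. inf_U0 b (f \<omega>)) \<in> measurable N (count_space UNIV)"
    unfolding inf_U0_def by (intro measurable_Least F)
  show ?thesis unfolding inf_U_def
    by (rule measurable_apply2_count_space[OF U0]) (rule measurable_compose_countable[OF Y U0])
qed

section \<open>The infinite Poisson model\<close>

locale poisson_model = prob_space M for M :: "'a measure" +
  fixes b :: nat and \<alpha> :: real and X :: "int \<Rightarrow> 'a \<Rightarrow> nat"
  assumes b: "b \<ge> 1" and \<alpha>: "0 < \<alpha>" "\<alpha> < 1"
    and indep: "indep_vars (\<lambda>_. count_space UNIV) X UNIV"
    and poisson: "\<And>i. distr M (count_space UNIV) (X i) = measure_pmf (poisson_pmf (\<alpha> * real b))"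
begin

definition lam :: real where "lam = \<alpha> * real b"

lemma lam_pos: "lam > 0" using b \<alpha> by (simp add: lam_def)

lemma X_measurable [measurable]: "X i \<in> measurable M (count_space UNIV)"
  using indep by (simp add: indep_vars_def)

lemma prob_X: "prob (X i -` {k} \<inter> space M) = pmf (poisson_pmf lam) k"
proof -
  have "prob (X i -` {k} \<inter> space M) = measure (distr M (count_space UNIV) (X i)) {k}"
    by (subst measure_distr) auto
  thus ?thesis by (simp add: poisson lam_def measure_pmf_single)
qed

lemma prob_X_eq:
  assumes J: "finite J" "inj_on pos J"
  shows "prob {\<omega> \<in> space M. \<forall>i\<in>J. X (pos i) \<omega> = g i} = (\<Prod>i\<in>J. pmf (poisson_pmf lam) (g i))"
proof (cases "J = {}")
  case True
  thus ?thesis by (simp add: prob_space)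
next
  case False
  define h where "h j = g (inv_into J pos j)" for j
  have h: "h (pos i) = g i" if "i \<in> J" for i using that J by (simp add: h_def)
  have "{\<omega> \<in> space M. \<forall>i\<in>J. X (pos i) \<omega> = g i} = (\<Inter>j\<in>pos ` J. X j -` {h j} \<inter> space M)"
    using False h by auto
  also have "prob \<dots> = (\<Prod>j\<in>pos ` J. prob (X j -` {h j} \<inter> space M))"
    using indep J False by (intro indep_varsD[where I = UNIV]) auto
  also have "\<dots> = (\<Prod>i\<in>J. pmf (poisson_pmf lam) (g i))"
    using J h by (simp add: prod.reindex prob_X)
  finally show ?thesis .
qed

lemma nn_integral_power_X:
  fixes z :: real
  assumes "z \<ge> 0"
  shows "(\<integral>\<^sup>+\<omega>. ennreal (z ^ X i \<omega>) \<partial>M) = ennreal (exp (lam * (z - 1)))"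
proof -
  have "(\<integral>\<^sup>+\<omega>. ennreal (z ^ X i \<omega>) \<partial>M) = (\<integral>\<^sup>+k. ennreal (z ^ k) \<partial>distr M (count_space UNIV) (X i))"
    by (subst nn_integral_distr) auto
  also have "\<dots> = (\<Sum>k. ennreal (pmf (poisson_pmf lam) k) * ennreal (z ^ k))"
    by (simp add: poisson lam_def nn_integral_measure_pmf nn_integral_count_space_nat)
  also have "\<dots> = (\<Sum>k. ennreal (lam ^ k / fact k * exp (- lam) * z ^ k))"
    by (intro arg_cong[of _ _ suminf] ext) (use lam_pos assms in \<open>simp add: ennreal_mult[symmetric]\<close>)
  also have "\<dots> = ennreal (exp (lam * (z - 1)))"
  proof (rule suminf_ennreal_eq)
    have "(\<lambda>k. exp (- lam) * ((lam * z) ^ k /\<^sub>R fact k)) sums (exp (- lam) * exp (lam * z))"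
      by (intro sums_mult exp_converges)
    also have "exp (- lam) * exp (lam * z) = exp (lam * (z - 1))"
      by (simp add: exp_add[symmetric] algebra_simps)
    also have "(\<lambda>k. exp (- lam) * ((lam * z) ^ k /\<^sub>R fact k)) = (\<lambda>k. lam ^ k / fact k * exp (- lam) * z ^ k)"
      by (auto simp: fun_eq_iff power_mult_distrib field_simps)
    finally show "(\<lambda>k. lam ^ k / fact k * exp (- lam) * z ^ k) sums exp (lam * (z - 1))" .
  qed (use lam_pos assms in auto)
  finally show ?thesis .
qed

lemma sum_X_measurable [measurable]: "(\<lambda>\<omega>. \<Sum>j\<in>J. X j \<omega>) \<in> measurable M (count_space UNIV)"
proof (induction J rule: infinite_finite_induct)
  case (insert j J)
  thus ?case by (simp add: measurable_apply2_count_space)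
qed auto

lemma chernoff_X:
  assumes J: "finite J"
  shows "prob {\<omega> \<in> space M. b * card J \<le> (\<Sum>j\<in>J. X j \<omega>)} \<le> rho \<alpha> ^ (b * card J)"
proof -
  define N where "N = b * card J"
  define z where "z = 1 / \<alpha>"
  have z: "z > 1" using \<alpha> by (simp add: z_def)
  let ?A = "{\<omega> \<in> space M. N \<le> (\<Sum>j\<in>J. X j \<omega>)}"
  have "emeasure M ?A = (\<integral>\<^sup>+\<omega>. indicator ?A \<omega> \<partial>M)" by simp
  also have "\<dots> \<le> (\<integral>\<^sup>+\<omega>. (\<Prod>j\<in>J. ennreal (z ^ X j \<omega>)) * ennreal (\<alpha> ^ N) \<partial>M)"
  proof (rule nn_integral_mono)
    fix \<omega> assume "\<omega> \<in> space M"
    have "indicator ?A \<omega> \<le> ennreal (z ^ (\<Sum>j\<in>J. X j \<omega>) * \<alpha> ^ N)"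
    proof (cases "\<omega> \<in> ?A")
      case True
      have "1 = z ^ N * \<alpha> ^ N" using \<alpha> by (simp add: z_def power_divide)
      also have "\<dots> \<le> z ^ (\<Sum>j\<in>J. X j \<omega>) * \<alpha> ^ N"
        using True z \<alpha> by (intro mult_right_mono power_increasing) auto
      finally show ?thesis using True by simp
    qed simp
    also have "\<dots> = (\<Prod>j\<in>J. ennreal (z ^ X j \<omega>)) * ennreal (\<alpha> ^ N)"
      using z \<alpha> by (simp add: power_sum ennreal_mult prod_ennreal prod_nonneg)
    finally show "indicator ?A \<omega> \<le> (\<Prod>j\<in>J. ennreal (z ^ X j \<omega>)) * ennreal (\<alpha> ^ N)" .
  qed
  also have "\<dots> = (\<integral>\<^sup>+\<omega>. (\<Prod>j\<in>J. ennreal (z ^ X j \<omega>)) \<partial>M) * ennreal (\<alpha> ^ N)"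
    by (rule nn_integral_multc) measurable
  also have "(\<integral>\<^sup>+\<omega>. (\<Prod>j\<in>J. ennreal (z ^ X j \<omega>)) \<partial>M) = (\<Prod>j\<in>J. \<integral>\<^sup>+\<omega>. ennreal (z ^ X j \<omega>) \<partial>M)"
  proof (rule indep_vars_nn_integral[OF J])
    have "indep_vars (\<lambda>_. count_space UNIV) X J" by (rule indep_vars_subset[OF indep]) auto
    thus "indep_vars (\<lambda>_. borel) (\<lambda>j \<omega>. ennreal (z ^ X j \<omega>)) J"
      by (rule indep_vars_compose2[where Y = "\<lambda>_ k. ennreal (z ^ k)"]) auto
  qed auto
  also have "\<dots> = ennreal (exp (lam * (z - 1)) ^ card J)"
    using z by (simp add: nn_integral_power_X ennreal_power)
  also have "exp (lam * (z - 1)) ^ card J = exp (1 - \<alpha>) ^ N"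
  proof -
    have "lam * (z - 1) = real b * (1 - \<alpha>)" using \<alpha> by (simp add: lam_def z_def field_simps)
    thus ?thesis by (simp add: N_def exp_of_nat_mult power_mult)
  qed
  also have "ennreal (exp (1 - \<alpha>) ^ N) * ennreal (\<alpha> ^ N) = ennreal (rho \<alpha> ^ N)"
    using \<alpha> by (simp add: rho_def power_mult_distrib ennreal_mult mult.commute)
  finally have "emeasure M ?A \<le> ennreal (rho \<alpha> ^ N)" .
  hence "prob ?A \<le> rho \<alpha> ^ N"
    using rho_bounds[OF \<alpha>] by (simp add: emeasure_eq_measure)
  thus ?thesis by (simp add: N_def)
qed

abbreviation x :: "'a \<Rightarrow> int \<Rightarrow> nat" where "x \<omega> \<equiv> (\<lambda>i. X i \<omega>)"

lemma back_sum_measurable [measurable]: "(\<lambda>\<omega>. back_sum (x \<omega>) i L) \<in> measurable M (count_space UNIV)"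
proof (induction L)
  case (Suc L)
  show ?case unfolding back_sum_Suc by (rule measurable_apply2_count_space[OF Suc.IH]) simp
qed simp

lemma inf_H_measurable [measurable]: "(\<lambda>\<omega>. inf_H b (x \<omega>) i) \<in> measurable M (count_space UNIV)"
  by (rule measurable_inf_H) simp

lemma inf_full_measurable [measurable]: "Measurable.pred M (\<lambda>\<omega>. inf_full b (x \<omega>) i)"
  unfolding inf_full_def by measurable

lemma inf_U_measurable [measurable]: "(\<lambda>\<omega>. inf_U b (x \<omega>)) \<in> measurable M (count_space UNIV)"
  by (rule measurable_inf_U) simp

lemma prob_back_sum: "prob {\<omega> \<in> space M. b * L \<le> back_sum (x \<omega>) i L} \<le> rho \<alpha> ^ (b * L)"
proof -
  have inj: "inj_on (\<lambda>k. i - int k) {..<L}" by (auto simp: inj_on_def)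
  have "back_sum (x \<omega>) i L = (\<Sum>j\<in>(\<lambda>k. i - int k) ` {..<L}. X j \<omega>)" for \<omega>
    by (simp add: back_sum_def sum.reindex[OF inj])
  moreover have "card ((\<lambda>k. i - int k) ` {..<L}) = L" using inj by (simp add: card_image)
  ultimately show ?thesis using chernoff_X[of "(\<lambda>k. i - int k) ` {..<L}"] by simp
qed

lemma rho_power_b_le: "rho \<alpha> ^ (b * (k + n)) \<le> rho \<alpha> ^ (b * k) * rho \<alpha> ^ n"
proof -
  have "rho \<alpha> ^ (b * n) \<le> rho \<alpha> ^ n"
    using rho_bounds[OF \<alpha>] b by (intro power_decreasing) auto
  thus ?thesis using rho_bounds[OF \<alpha>] by (simp add: distrib_left power_add mult_left_mono)
qed

text \<open>Chernoff's bound is summable in \<open>L\<close>, so Borel-Cantelli applies at each of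
  the countably many positions.\<close>

lemma AE_subcritical: "AE \<omega> in M. subcritical b (x \<omega>)"
  unfolding subcritical_def AE_all_countable
proof
  fix i
  let ?A = "\<lambda>L. {\<omega> \<in> space M. b * L \<le> back_sum (x \<omega>) i L}"
  have "AE \<omega> in M. eventually (\<lambda>L. \<omega> \<in> space M - ?A L) sequentially"
  proof (rule borel_cantelli_AE1)
    show "summable (\<lambda>L. prob (?A L))"
    proof (rule summable_comparison_test')
      show "summable (\<lambda>n. rho \<alpha> ^ n)" using rho_bounds[OF \<alpha>] by (intro summable_geometric) auto
      show "norm (prob (?A n)) \<le> rho \<alpha> ^ n" for n
        using prob_back_sum[of n i] rho_power_b_le[of 0 n] by simp
    qed
  qed (auto simp: emeasure_eq_measure)
  thus "AE \<omega> in M. eventually (\<lambda>L. back_sum (x \<omega>) i L < b * L) sequentially"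
    by (rule eventually_mono) (auto elim!: eventually_mono)
qed

lemma prob_inf_full_run:
  "prob {\<omega> \<in> space M. \<forall>i<k. inf_full b (x \<omega>) (e - int i)} \<le> rho \<alpha> ^ (b * k) / (1 - rho \<alpha>)"
proof -
  let ?A = "\<lambda>n. {\<omega> \<in> space M. b * (k + n) \<le> back_sum (x \<omega>) e (k + n)}"
  have le: "prob (?A n) \<le> rho \<alpha> ^ (b * k) * rho \<alpha> ^ n" for n
    using prob_back_sum[of "k + n" e] rho_power_b_le[of k n] by linarith
  have s: "summable (\<lambda>n. rho \<alpha> ^ (b * k) * rho \<alpha> ^ n)"
    using rho_bounds[OF \<alpha>] by (intro summable_mult summable_geometric) auto
  have sA: "summable (\<lambda>n. prob (?A n))"
    by (rule summable_comparison_test'[OF s]) (use le in simp)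
  have "prob {\<omega> \<in> space M. \<forall>i<k. inf_full b (x \<omega>) (e - int i)} \<le> prob (\<Union>n. ?A n)"
  proof (rule finite_measure_mono_AE)
    show "AE \<omega> in M. \<omega> \<in> {\<omega> \<in> space M. \<forall>i<k. inf_full b (x \<omega>) (e - int i)} \<longrightarrow> \<omega> \<in> (\<Union>n. ?A n)"
      using AE_subcritical
    proof eventually_elim
      case (elim \<omega>)
      show ?case
      proof
        assume \<omega>: "\<omega> \<in> {\<omega> \<in> space M. \<forall>i<k. inf_full b (x \<omega>) (e - int i)}"
        then obtain L where L: "L \<ge> k" "b * L \<le> back_sum (x \<omega>) e L"
          using inf_full_run[OF elim, of k e] by auto
        hence "\<omega> \<in> ?A (L - k)" using \<omega> by simp
        thus "\<omega> \<in> (\<Union>n. ?A n)" by blast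
      qed
    qed
  qed auto
  also have "\<dots> \<le> (\<Sum>n. prob (?A n))"
    by (rule finite_measure_subadditive_countably[OF _ sA]) auto
  also have "\<dots> \<le> (\<Sum>n. rho \<alpha> ^ (b * k) * rho \<alpha> ^ n)"
    by (rule suminf_le[OF le sA s])
  also have "\<dots> = rho \<alpha> ^ (b * k) / (1 - rho \<alpha>)"
    using rho_bounds[OF \<alpha>] by (subst suminf_mult) (auto simp: suminf_geometric intro!: summable_geometric)
  finally show ?thesis .
qed

lemma AE_ex_nonfull: "AE \<omega> in M. \<exists>k. \<not> inf_full b (x \<omega>) (int k)"
proof -
  let ?N = "{\<omega> \<in> space M. \<not> (\<exists>k. \<not> inf_full b (x \<omega>) (int k))}"
  have le: "prob ?N \<le> rho \<alpha> ^ (b * k) / (1 - rho \<alpha>)" for k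
  proof -
    have "prob ?N \<le> prob {\<omega> \<in> space M. \<forall>i<k. inf_full b (x \<omega>) ((int k - 1) - int i)}"
    proof (rule finite_measure_mono)
      show "?N \<subseteq> {\<omega> \<in> space M. \<forall>i<k. inf_full b (x \<omega>) ((int k - 1) - int i)}"
      proof safe
        fix \<omega> i assume \<omega>: "\<not> (\<exists>k. \<not> inf_full b (x \<omega>) (int k))" "i < k"
        have "int k - 1 - int i = int (k - 1 - i)" using \<omega>(2) by simp
        thus "inf_full b (x \<omega>) (int k - 1 - int i)" using \<omega>(1) by metis
      qed
    qed measurable
    also have "\<dots> \<le> rho \<alpha> ^ (b * k) / (1 - rho \<alpha>)" by (rule prob_inf_full_run)
    finally show ?thesis .
  qed
  have "prob ?N \<le> 0"
    by (rule LIMSEQ_le_const[OF rho_power_tendsto[OF \<alpha> b]]) (use le in auto)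
  hence "emeasure M ?N = 0" by (simp add: emeasure_eq_measure measure_le_0_iff)
  thus ?thesis by (subst AE_iff_measurable[of ?N]) auto
qed

lemma prob_inf_U_le: "prob {\<omega> \<in> space M. inf_U b (x \<omega>) = u} \<le> rho \<alpha> ^ (b * (u div b)) / (1 - rho \<alpha>)"
proof -
  let ?k = "u div b"
  have "prob {\<omega> \<in> space M. inf_U b (x \<omega>) = u} \<le>
    prob {\<omega> \<in> space M. \<forall>i<?k. inf_full b (x \<omega>) ((int ?k - 1) - int i)}"
  proof (rule finite_measure_mono_AE)
    show "AE \<omega> in M. \<omega> \<in> {\<omega> \<in> space M. inf_U b (x \<omega>) = u} \<longrightarrow>
      \<omega> \<in> {\<omega> \<in> space M. \<forall>i<?k. inf_full b (x \<omega>) ((int ?k - 1) - int i)}"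
      using AE_subcritical AE_ex_nonfull
    proof eventually_elim
      case (elim \<omega>)
      show ?case
      proof
        assume \<omega>: "\<omega> \<in> {\<omega> \<in> space M. inf_U b (x \<omega>) = u}"
        hence "ends_at b (overflow b (x \<omega>) (- 1)) (x \<omega> \<circ> int) 0 u"
          using inf_U_eq_iff[OF elim(1) b elim(2), of u 0] by (simp add: o_def)
        hence full: "inf_full b (x \<omega>) (int i)" if "i < ?k" for i
          using inf_H_lind[OF elim(1), of "-1" i] that
          by (simp add: ends_at_def inf_full_def o_def flip: of_nat_add)
        show "\<omega> \<in> {\<omega> \<in> space M. \<forall>i<?k. inf_full b (x \<omega>) ((int ?k - 1) - int i)}"
        proof (intro CollectI conjI allI impI)
          fix i assume "i < ?k"
          hence "int ?k - 1 - int i = int (?k - 1 - i)" "?k - 1 - i < ?k" by auto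
          thus "inf_full b (x \<omega>) (int ?k - 1 - int i)" using full by metis
        qed (use \<omega> in simp)
      qed
    qed
  qed measurable
  also have "\<dots> \<le> rho \<alpha> ^ (b * ?k) / (1 - rho \<alpha>)" by (rule prob_inf_full_run)
  finally show ?thesis .
qed

lemma prob_ends_at:
  shows "prob {\<omega> \<in> space M. ends_at b 0 (\<lambda>i. X (int i - int K) \<omega>) K u} = window_prob b lam K u"
    and "{\<omega> \<in> space M. ends_at b 0 (\<lambda>i. X (int i - int K) \<omega>) K u} \<in> sets M"
proof -
  let ?N = "Suc (K + u div b)"
  have S: "{\<omega> \<in> space M. \<forall>i<?N. X (int i - int K) \<omega> = g i} \<in> sets M" for g
    by measurable
  show "{\<omega> \<in> space M. ends_at b 0 (\<lambda>i. X (int i - int K) \<omega>) K u} \<in> sets M"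
    by (rule measure_ends_at(2)[OF b S])
  have "prob {\<omega> \<in> space M. \<forall>i<?N. X (int i - int K) \<omega> = g i} = (\<Prod>i<?N. pmf (poisson_pmf lam) (g i))" for g
    using prob_X_eq[of "{..<?N}" "\<lambda>i. int i - int K" g] by (simp add: inj_on_def Ball_def del: prod.lessThan_Suc)
  thus "prob {\<omega> \<in> space M. ends_at b 0 (\<lambda>i. X (int i - int K) \<omega>) K u} = window_prob b lam K u"
    unfolding window_prob_def by (subst measure_ends_at(1)[OF b S]) (simp only:)
qed

lemma prob_inf_U_approx:
  "\<bar>prob {\<omega> \<in> space M. inf_U b (x \<omega>) = u} - window_prob b lam K u\<bar> \<le> rho \<alpha> ^ (b * K) / (1 - rho \<alpha>)"
proof -
  define A where "A = {\<omega> \<in> space M. inf_U b (x \<omega>) = u}"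
  define B where "B = {\<omega> \<in> space M. ends_at b 0 (\<lambda>i. X (int i - int K) \<omega>) K u}"
  define C where "C = {\<omega> \<in> space M. \<forall>i<K. inf_full b (x \<omega>) (- 1 - int i)}"
  have "A \<in> sets M" "C \<in> sets M" unfolding A_def C_def by measurable
  moreover have "B \<in> sets M" unfolding B_def by (rule prob_ends_at(2))
  ultimately have sets: "A \<in> sets M" "B \<in> sets M" "C \<in> sets M" by auto
  have AE: "AE \<omega> in M. (\<omega> \<in> A) \<noteq> (\<omega> \<in> B) \<longrightarrow> \<omega> \<in> C"
    using AE_subcritical AE_ex_nonfull AE_space
  proof eventually_elim
    case (elim \<omega>)
    show ?case
    proof
      assume "(\<omega> \<in> A) \<noteq> (\<omega> \<in> B)"
      hence "ends_at b (overflow b (x \<omega>) (- int K - 1)) (\<lambda>i. X (int i - int K) \<omega>) K u \<noteq>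
          ends_at b 0 (\<lambda>i. X (int i - int K) \<omega>) K u"
        using inf_U_eq_iff[OF elim(1) b elim(2), of u K] elim(3) by (simp add: A_def B_def)
      from no_coupling_inf_full[OF elim(1) this] show "\<omega> \<in> C" using elim(3) by (auto simp: C_def)
    qed
  qed
  have "prob A \<le> prob (B \<union> C)"
    by (rule finite_measure_mono_AE, rule eventually_mono[OF AE]) (use sets in auto)
  moreover have "prob B \<le> prob (A \<union> C)"
    by (rule finite_measure_mono_AE, rule eventually_mono[OF AE]) (use sets in auto)
  moreover have "prob (B \<union> C) \<le> prob B + prob C" "prob (A \<union> C) \<le> prob A + prob C"
    using sets by (auto intro: measure_Un_le)
  moreover have "prob C \<le> rho \<alpha> ^ (b * K) / (1 - rho \<alpha>)"
    unfolding C_def by (rule prob_inf_full_run)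
  moreover have "prob B = window_prob b lam K u" unfolding B_def by (rule prob_ends_at)
  ultimately show ?thesis unfolding A_def[symmetric] by linarith
qed

end

section \<open>The recursion for the killed queue\<close>

lemma integrable_pmf_nat_iff:
  fixes f :: "nat \<Rightarrow> 'b :: {banach, second_countable_topology}"
  shows "integrable (measure_pmf p) f \<longleftrightarrow> summable (\<lambda>k. pmf p k * norm (f k))"
  by (simp add: measure_pmf_eq_density integrable_density integrable_count_space_nat_iff)

lemma integral_pmf_nat:
  fixes f :: "nat \<Rightarrow> 'b :: {banach, second_countable_topology}"
  assumes "summable (\<lambda>k. pmf p k * norm (f k))"
  shows "integral\<^sup>L (measure_pmf p) f = (\<Sum>k. pmf p k *\<^sub>R f k)"
  using assms
  by (simp add: measure_pmf_eq_density integral_density integral_count_space_nat integrable_count_space_nat_iff)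

text \<open>Subtracting the product cancels the leading terms and leaves degree below
  \<open>b\<close> with \<open>b\<close> distinct roots. Nothing is divided by \<open>c\<close>, so
  the lemma applies before the value of \<open>p_nonfull\<close> is known.\<close>

lemma poly_factor_distinct_roots:
  fixes c :: complex and a :: "nat \<Rightarrow> complex"
  assumes root: "\<And>l. l < b \<Longrightarrow> c * \<zeta> l ^ b + (\<Sum>s<b. a s * \<zeta> l ^ s) = 0"
    and inj: "inj_on \<zeta> {..<b}"
  shows "c * z ^ b + (\<Sum>s<b. a s * z ^ s) = c * (\<Prod>l<b. z - \<zeta> l)"
proof -
  define p where "p = monom c b + (\<Sum>s<b. monom (a s) s)"
  define r where "r n = (\<Prod>l<n. [:- \<zeta> l, 1:])" for n
  have r: "degree (r n) \<le> n \<and> coeff (r n) n = 1" for n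
  proof (induction n)
    case (Suc n)
    have e: "r (Suc n) = [:- \<zeta> n, 1:] * r n" by (simp add: r_def mult.commute)
    have "degree (r (Suc n)) \<le> degree [:- \<zeta> n, 1:] + degree (r n)"
      unfolding e by (rule degree_mult_le)
    moreover have "coeff (r n) (Suc n) = 0" using Suc by (intro coeff_eq_0) auto
    ultimately show ?case using Suc by (simp add: e)
  qed (simp add: r_def)
  define d where "d = p - smult c (r b)"
  have poly_p: "poly p z = c * z ^ b + (\<Sum>s<b. a s * z ^ s)" for z
    by (simp add: p_def poly_monom poly_sum)
  have poly_r: "poly (r b) z = (\<Prod>l<b. z - \<zeta> l)" for z
    by (simp add: r_def poly_prod)
  have cp: "coeff p n = (if n = b then c else if n < b then a n else 0)" for n
    by (auto simp: p_def coeff_sum)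
  have "d = 0"
  proof (rule ccontr)
    assume d: "d \<noteq> 0"
    have cd: "coeff d n = 0" if "n \<ge> b" for n
    proof (cases "n = b")
      case False
      hence "coeff (r b) n = 0" using that r[of b] by (intro coeff_eq_0) auto
      thus ?thesis using that False by (simp add: d_def cp)
    qed (use r[of b] in \<open>simp add: d_def cp\<close>)
    have deg: "degree d < b"
      using cd d by (metis leading_coeff_0_iff not_le)
    have "\<zeta> ` {..<b} \<subseteq> {x. poly d x = 0}"
      using root by (auto simp: d_def poly_p poly_r)
    hence "card (\<zeta> ` {..<b}) \<le> card {x. poly d x = 0}"
      by (intro card_mono poly_roots_finite d)
    also have "\<dots> \<le> degree d" by (rule card_poly_roots_bound[OF d])
    finally show False using deg inj by (simp add: card_image)
  qed
  hence "poly p z = poly (smult c (r b)) z" by (simp add: d_def)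
  thus ?thesis by (simp add: poly_p poly_r)
qed

lemma inf_U_eq_block_iff:
  assumes sub: "subcritical b x" and b: "b \<ge> 1" and ex: "\<exists>k. \<not> inf_full b x (int k)" and y: "y < b"
  shows "inf_U b x = b * j + y \<longleftrightarrow> (\<forall>i<j. inf_full b x (int i)) \<and> inf_H b x (int j) = int y"
proof -
  have H: "inf_H b x (int i) = int (lind b (overflow b x (- 1)) (\<lambda>i. x (int i)) i + x (int i))" for i
    using inf_H_lind[OF sub, of "-1" i] by simp
  show ?thesis
    using inf_U_eq_iff[OF sub b ex, of "b * j + y" 0] y b
    by (simp add: ends_at_def inf_full_def H del: of_nat_add)
qed

context poisson_model
begin

definition pU :: "nat \<Rightarrow> real" where
  "pU u = prob {\<omega> \<in> space M. inf_U b (x \<omega>) = u}"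

lemma pU_nonneg: "pU u \<ge> 0" by (simp add: pU_def)

lemma expectation_power_X:
  fixes z :: complex
  shows "integrable M (\<lambda>\<omega>. z ^ X i \<omega>)" "(LINT \<omega>|M. z ^ X i \<omega>) = exp (of_real lam * (z - 1))"
proof -
  let ?p = "poisson_pmf lam"
  have "(\<lambda>k. exp (- lam) * ((lam * norm z) ^ k /\<^sub>R fact k)) sums (exp (- lam) * exp (lam * norm z))"
    by (intro sums_mult exp_converges)
  also have "(\<lambda>k. exp (- lam) * ((lam * norm z) ^ k /\<^sub>R fact k)) = (\<lambda>k. pmf ?p k * norm (z ^ k))"
    using lam_pos by (auto simp: fun_eq_iff power_mult_distrib norm_power field_simps)
  finally have s: "summable (\<lambda>k. pmf ?p k * norm (z ^ k))" by (rule sums_summable)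
  have d: "distr M (count_space UNIV) (X i) = measure_pmf ?p" by (simp add: poisson lam_def)
  have "integrable (distr M (count_space UNIV) (X i)) (\<lambda>k. z ^ k)"
    unfolding d using s by (simp add: integrable_pmf_nat_iff)
  thus "integrable M (\<lambda>\<omega>. z ^ X i \<omega>)" by (subst (asm) integrable_distr_eq) auto
  have "(LINT \<omega>|M. z ^ X i \<omega>) = (LINT k|distr M (count_space UNIV) (X i). z ^ k)"
    by (subst integral_distr) auto
  also have "\<dots> = (\<Sum>k. pmf ?p k *\<^sub>R z ^ k)" unfolding d by (rule integral_pmf_nat[OF s])
  also have "\<dots> = exp (of_real lam * (z - 1))"
  proof (rule sums_unique[symmetric])
    have "(\<lambda>k. exp (- of_real lam) * ((of_real lam * z) ^ k /\<^sub>R fact k)) sums (exp (- of_real lam) * exp (of_real lam * z))"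
      by (intro sums_mult exp_converges)
    also have "exp (- of_real lam) * exp (of_real lam * z) = exp (of_real lam * (z - 1))"
      by (simp add: exp_add[symmetric] algebra_simps)
    also have "(\<lambda>k. exp (- of_real lam) * ((of_real lam * z) ^ k /\<^sub>R fact k)) = (\<lambda>k. pmf ?p k *\<^sub>R z ^ k)"
      using lam_pos
      by (auto simp: fun_eq_iff power_mult_distrib scaleR_conv_of_real exp_of_real[symmetric] field_simps)
    finally show "(\<lambda>k. pmf ?p k *\<^sub>R z ^ k) sums exp (of_real lam * (z - 1))" .
  qed
  finally show "(LINT \<omega>|M. z ^ X i \<omega>) = exp (of_real lam * (z - 1))" .
qed

text \<open>The overflow depends on infinitely many earlier buckets, so independence is used between
  the whole past and one bucket; \<open>\<phi>\<close> exhibits \<open>A\<close> as a measurable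
  function of the past.\<close>

lemma expectation_past_times_power_X:
  fixes z :: complex and \<phi> :: "(int \<Rightarrow> nat) \<Rightarrow> complex"
  assumes \<phi>: "\<phi> \<in> borel_measurable (PiM {..<j} (\<lambda>_. count_space UNIV))"
    and A: "\<And>\<omega>. A \<omega> = \<phi> (restrict (x \<omega>) {..<j})" and int: "integrable M A"
  shows "(LINT \<omega>|M. A \<omega> * z ^ X j \<omega>) = (LINT \<omega>|M. A \<omega>) * exp (of_real lam * (z - 1))"
proof -
  have "indep_var (PiM {..<j} (\<lambda>_. count_space UNIV)) (\<lambda>\<omega>. restrict (x \<omega>) {..<j})
    (PiM {j} (\<lambda>_. count_space UNIV)) (\<lambda>\<omega>. restrict (x \<omega>) {j})"
    by (rule indep_var_restrict[OF indep]) auto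
  hence "indep_var borel (\<phi> \<circ> (\<lambda>\<omega>. restrict (x \<omega>) {..<j})) borel ((\<lambda>y. z ^ y j) \<circ> (\<lambda>\<omega>. restrict (x \<omega>) {j}))"
  proof (rule indep_var_compose[OF _ \<phi>])
    have "(\<lambda>y. y j) \<in> measurable (PiM {j} (\<lambda>_. count_space UNIV :: nat measure)) (count_space UNIV)"
      by (rule measurable_component_singleton) simp
    thus "(\<lambda>y. z ^ y j) \<in> borel_measurable (PiM {j} (\<lambda>_. count_space UNIV))"
      by (rule measurable_compose) simp
  qed
  hence "indep_var borel A borel (\<lambda>\<omega>. z ^ X j \<omega>)"
    unfolding A[THEN ext[of A]] by (simp add: o_def)
  from indep_var_lebesgue_integral[OF this int expectation_power_X(1)] show ?thesis
    by (simp add: expectation_power_X(2))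
qed

lemma overflow_measurable [measurable]: "(\<lambda>\<omega>. overflow b (x \<omega>) i) \<in> measurable M (count_space UNIV)"
  unfolding overflow_def by measurable

text \<open>The overflow entering bucket \<open>j\<close>, marked by \<open>z\<close> and killed
  once a non-full bucket has been met. At \<open>j = 0\<close> no bucket has been tested, so this is
  the stationary overflow.\<close>

definition killed :: "complex \<Rightarrow> nat \<Rightarrow> 'a \<Rightarrow> complex" where
  "killed z j \<omega> = (if \<forall>i<j. inf_full b (x \<omega>) (int i) then z ^ overflow b (x \<omega>) (int j - 1) else 0)"

lemma killed_measurable [measurable]: "killed z j \<in> borel_measurable M"
proof -
  have "(\<lambda>\<omega>. z ^ overflow b (x \<omega>) (int j - 1)) \<in> borel_measurable M"
    by (rule measurable_compose[OF overflow_measurable]) simp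
  thus ?thesis unfolding killed_def[abs_def] by measurable
qed

lemma norm_killed_le: "norm z \<le> 1 \<Longrightarrow> norm (killed z j \<omega>) \<le> 1"
  by (simp add: killed_def norm_power power_le_one)

lemma killed_integrable: "norm z \<le> 1 \<Longrightarrow> integrable M (killed z j)"
  by (rule integrable_const_bound[where B = 1]) (auto simp: norm_killed_le)

lemma killed_past:
  obtains \<phi> where "\<phi> \<in> borel_measurable (PiM {..<int j} (\<lambda>_. count_space UNIV))"
    "\<And>\<omega>. killed z j \<omega> = \<phi> (restrict (x \<omega>) {..<int j})"
proof -
  define \<phi> where "\<phi> y = (if \<forall>i<j. inf_full b y (int i) then z ^ overflow b y (int j - 1) else 0)" for y
  let ?N = "PiM {..<int j} (\<lambda>_. count_space UNIV :: nat measure)"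
  have H: "(\<lambda>y. inf_H b y i) \<in> measurable ?N (count_space UNIV)" if "i < int j" for i
    by (rule measurable_inf_H) (use that in \<open>auto intro!: measurable_component_singleton\<close>)
  have 1: "(\<lambda>y. z ^ overflow b y (int j - 1)) \<in> borel_measurable ?N"
    unfolding overflow_def by (rule measurable_compose[OF H]) auto
  have 2: "Measurable.pred ?N (\<lambda>y. inf_full b y (int i))" if "i < j" for i
    unfolding inf_full_def by (rule measurable_compose[OF H]) (use that in auto)
  have 3: "Measurable.pred ?N (\<lambda>y. \<forall>i<j. inf_full b y (int i))"
  proof -
    have "Measurable.pred ?N (\<lambda>y. \<forall>i\<in>{..<j}. inf_full b y (int i))"
      by (rule pred_intros_finite) (use 2 in auto)
    thus ?thesis by (simp only: Ball_def lessThan_iff)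
  qed
  have "\<phi> \<in> borel_measurable ?N"
    unfolding \<phi>_def[abs_def] by (rule measurable_If[OF 1 measurable_const 3[unfolded pred_def]]) simp
  moreover have "killed z j \<omega> = \<phi> (restrict (x \<omega>) {..<int j})" for \<omega>
  proof -
    have "inf_H b (restrict (x \<omega>) {..<int j}) i = inf_H b (x \<omega>) i" if "i < int j" for i
      by (rule inf_H_cong) (use that in auto)
    thus ?thesis by (auto simp: killed_def \<phi>_def inf_full_def overflow_def)
  qed
  ultimately show ?thesis by (rule that)
qed

definition Gk :: "complex \<Rightarrow> nat \<Rightarrow> complex" where "Gk z j = (LINT \<omega>|M. killed z j \<omega>)"

lemma norm_Gk_le: 
  assumes "norm z \<le> 1"
  shows "norm (Gk z j) \<le> 1"
proof -
  have "norm (Gk z j) \<le> (LINT \<omega>|M. norm (killed z j \<omega>))"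
    unfolding Gk_def by (rule integral_norm_bound)
  also have "\<dots> \<le> (LINT \<omega>|M. 1)"
    by (intro integral_mono integrable_norm killed_integrable norm_killed_le assms) auto
  finally show ?thesis by (simp add: prob_space)
qed

lemma integral_indicator_pU:
  "integrable M (\<lambda>\<omega>. if inf_U b (x \<omega>) = u then c else 0 :: complex)"
  "(LINT \<omega>|M. (if inf_U b (x \<omega>) = u then c else 0 :: complex)) = of_real (pU u) * c"
proof -
  have [simp]: "{\<omega> \<in> space M. inf_U b (x \<omega>) = u} \<in> sets M" by measurable
  have "(\<lambda>\<omega>. if inf_U b (x \<omega>) = u then c else 0) \<in> borel_measurable M" by measurable
  thus int: "integrable M (\<lambda>\<omega>. if inf_U b (x \<omega>) = u then c else 0 :: complex)"
    by (intro integrable_const_bound[where B = "norm c"]) auto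
  have "(LINT \<omega>|M. (if inf_U b (x \<omega>) = u then c else 0 :: complex)) =
     (LINT \<omega>|M. indicator {\<omega> \<in> space M. inf_U b (x \<omega>) = u} \<omega> *\<^sub>R c)"
    by (intro Bochner_Integration.integral_cong) (auto simp: indicator_def)
  also have "\<dots> = pU u *\<^sub>R c"
    by (simp add: pU_def emeasure_eq_measure)
  finally show "(LINT \<omega>|M. (if inf_U b (x \<omega>) = u then c else 0 :: complex)) = of_real (pU u) * c"
    by (simp add: scaleR_conv_of_real)
qed

text \<open>Multiplying by \<open>z ^ X j\<close> marks the value of \<open>inf_H\<close> at bucket
  \<open>j\<close>. If the bucket is full, \<open>b\<close> keys stay and the rest is the next
  overflow, whence \<open>z ^ b\<close>; otherwise the search ends there with \<open>y < b\<close>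
  keys.\<close>

lemma Gk_step:
  assumes z: "norm z \<le> 1"
  shows "Gk z j * exp (of_real lam * (z - 1)) = z ^ b * Gk z (Suc j) + (\<Sum>y<b. of_real (pU (b * j + y)) * z ^ y)"
proof -
  obtain \<phi> where \<phi>: "\<phi> \<in> borel_measurable (PiM {..<int j} (\<lambda>_. count_space UNIV))"
    "\<And>\<omega>. killed z j \<omega> = \<phi> (restrict (x \<omega>) {..<int j})"
    using killed_past by blast
  have "Gk z j * exp (of_real lam * (z - 1)) = (LINT \<omega>|M. killed z j \<omega> * z ^ X (int j) \<omega>)"
    unfolding Gk_def by (rule expectation_past_times_power_X[OF \<phi> killed_integrable[OF z], symmetric])
  also have "\<dots> = (LINT \<omega>|M. z ^ b * killed z (Suc j) \<omega> + (\<Sum>y<b. if inf_U b (x \<omega>) = b * j + y then z ^ y else 0))"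
  proof (rule integral_cong_AE)
    have "(\<lambda>\<omega>. z ^ X (int j) \<omega>) \<in> borel_measurable M"
      by (rule measurable_compose[OF X_measurable]) simp
    thus "(\<lambda>\<omega>. killed z j \<omega> * z ^ X (int j) \<omega>) \<in> borel_measurable M" by measurable
    show "(\<lambda>\<omega>. z ^ b * killed z (Suc j) \<omega> + (\<Sum>y<b. if inf_U b (x \<omega>) = b * j + y then z ^ y else 0)) \<in> borel_measurable M"
      by measurable
    show "AE \<omega> in M. killed z j \<omega> * z ^ X (int j) \<omega> =
        z ^ b * killed z (Suc j) \<omega> + (\<Sum>y<b. if inf_U b (x \<omega>) = b * j + y then z ^ y else 0)"
      using AE_subcritical AE_ex_nonfull
    proof eventually_elim
      case (elim \<omega>)
      define F where "F \<longleftrightarrow> (\<forall>i<j. inf_full b (x \<omega>) (int i))"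
      define h where "h = overflow b (x \<omega>) (int j - 1) + X (int j) \<omega>"
      have H: "inf_H b (x \<omega>) (int j) = int h"
        using inf_H_step[OF elim(1), of "int j - 1"] by (simp add: h_def)
      have S: "(\<Sum>y<b. if inf_U b (x \<omega>) = b * j + y then z ^ y else 0) = (\<Sum>y<b. if y = h \<and> F then z ^ y else 0)"
        by (intro sum.cong refl if_cong)
          (use inf_U_eq_block_iff[OF elim(1) b elim(2), of _ j] in \<open>auto simp: F_def H\<close>)
      have F': "(\<forall>i<Suc j. inf_full b (x \<omega>) (int i)) \<longleftrightarrow> F \<and> b \<le> h"
        by (auto simp: F_def less_Suc_eq inf_full_def H)
      have o: "overflow b (x \<omega>) (int (Suc j) - 1) = h - b"
        by (simp add: overflow_def H)
      show ?case
      proof (cases F)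
        case True
        have L: "killed z j \<omega> * z ^ X (int j) \<omega> = z ^ h"
          using True by (simp add: killed_def F_def[symmetric] h_def power_add)
        show ?thesis
        proof (cases "b \<le> h")
          case True
          hence "z ^ b * killed z (Suc j) \<omega> = z ^ h"
            using \<open>F\<close> unfolding killed_def F' o by (simp flip: power_add)
          moreover have "(\<Sum>y<b. if y = h \<and> F then z ^ y else 0) = 0"
            using True by (intro sum.neutral) auto
          ultimately show ?thesis unfolding L S by simp
        next
          case False
          hence "killed z (Suc j) \<omega> = 0" unfolding killed_def F' by simp
          moreover have "(\<Sum>y<b. if y = h \<and> F then z ^ y else 0) = z ^ h"
            using False \<open>F\<close> by (simp add: sum.delta)
          ultimately show ?thesis unfolding L S by simp
        qed
      next
        case False
        hence "killed z (Suc j) \<omega> = 0" "killed z j \<omega> = 0"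
          unfolding killed_def F' F_def[symmetric] by simp_all
        thus ?thesis unfolding S using False by simp
      qed
    qed
  qed
  also have "\<dots> = z ^ b * Gk z (Suc j) + (\<Sum>y<b. of_real (pU (b * j + y)) * z ^ y)"
    using killed_integrable[OF z] integral_indicator_pU
    by (simp add: Bochner_Integration.integral_add Gk_def Bochner_Integration.integral_sum)
  finally show ?thesis .
qed

text \<open>The law of an independent, identically distributed family is a product measure with
  equal factors, which reindexing preserves.\<close>

lemma distr_shift:
  "distr M (PiM UNIV (\<lambda>_. count_space UNIV)) (\<lambda>\<omega> k. X (k + 1) \<omega>) =
   distr M (PiM UNIV (\<lambda>_. count_space UNIV)) (\<lambda>\<omega> k. X k \<omega>)"
proof -
  define P where "P = measure_pmf (poisson_pmf (\<alpha> * real b))"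
  let ?C = "\<lambda>_::int. count_space (UNIV :: nat set)"
  have X: "distr M (PiM UNIV ?C) (\<lambda>\<omega> k. X k \<omega>) = PiM UNIV (\<lambda>_. P)"
  proof -
    have "distr M (PiM UNIV ?C) (\<lambda>\<omega>. \<lambda>k\<in>UNIV. X k \<omega>) = PiM UNIV (\<lambda>i. distr M (?C i) (X i))"
      using indep by (subst indep_vars_iff_distr_eq_PiM[symmetric]) auto
    thus ?thesis by (simp add: poisson P_def restrict_def)
  qed
  have setsP: "sets (PiM UNIV ?C) = sets (PiM UNIV (\<lambda>_. P))"
    by (rule sets_PiM_cong) (auto simp: P_def)
  have m: "(\<lambda>y k. y (k + 1)) \<in> measurable (PiM UNIV ?C) (PiM UNIV ?C)"
    by (rule measurable_PiM_single') (auto intro!: measurable_component_singleton)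
  have mX: "(\<lambda>\<omega> k. X k \<omega>) \<in> measurable M (PiM UNIV ?C)"
    by (rule measurable_PiM_single') auto
  have "distr M (PiM UNIV ?C) (\<lambda>\<omega> k. X (k + 1) \<omega>) = distr (distr M (PiM UNIV ?C) (\<lambda>\<omega> k. X k \<omega>)) (PiM UNIV ?C) (\<lambda>y k. y (k + 1))"
    by (subst distr_distr[OF m mX]) (simp add: o_def)
  also have "\<dots> = distr (PiM UNIV (\<lambda>_. P)) (PiM UNIV (\<lambda>_. P)) (\<lambda>y. \<lambda>k\<in>UNIV. y (k + 1))"
    unfolding X by (rule distr_cong) (auto simp: setsP)
  also have "\<dots> = PiM UNIV (\<lambda>_. P)"
    by (rule distr_PiM_reindex) (auto simp: P_def measure_pmf.prob_space_axioms inj_on_def)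
  finally show ?thesis unfolding X .
qed

lemma overflow_stationary:
  fixes z :: complex
  shows "(LINT \<omega>|M. z ^ overflow b (x \<omega>) (i + 1)) = (LINT \<omega>|M. z ^ overflow b (x \<omega>) i)"
proof -
  let ?C = "PiM UNIV (\<lambda>_::int. count_space (UNIV :: nat set))"
  define f where "f y = z ^ overflow b y i" for y
  have f: "f \<in> borel_measurable ?C"
  proof -
    have "(\<lambda>y. inf_H b y i) \<in> measurable ?C (count_space UNIV)"
      by (rule measurable_inf_H) (auto intro!: measurable_component_singleton)
    thus ?thesis unfolding f_def[abs_def] overflow_def by (rule measurable_compose) simp
  qed
  have m: "(\<lambda>\<omega> k. X (k + c) \<omega>) \<in> measurable M ?C" for c
    by (rule measurable_PiM_single') auto
  have "(LINT \<omega>|M. z ^ overflow b (x \<omega>) (i + 1)) = (LINT \<omega>|M. f (\<lambda>k. X (k + 1) \<omega>))"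
    by (simp add: f_def overflow_def inf_H_shift[of b "x _"])
  also have "\<dots> = (LINT y|distr M ?C (\<lambda>\<omega> k. X (k + 1) \<omega>). f y)"
    by (rule integral_distr[OF m f, symmetric])
  also have "\<dots> = (LINT \<omega>|M. f (x \<omega>))"
    unfolding distr_shift using integral_distr[OF m[of 0] f] by simp
  finally show ?thesis by (simp add: f_def)
qed

text \<open>The overflow out of bucket 0 is the killed one if the bucket is full and 0, contributing
  1, if it is not. By stationarity it has the law of the inflow, and \<open>Gk_step\<close> at
  \<open>j = 0\<close> eliminates \<open>Gk z 1\<close>.\<close>

lemma Gk_0_equation:
  assumes z: "norm z \<le> 1"
  shows "Gk z 0 * (z ^ b - exp (of_real lam * (z - 1))) = (\<Sum>s<b. of_real (pU s) * (z ^ b - z ^ s))"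
proof -
  have m[measurable]: "(\<lambda>\<omega>. z ^ overflow b (x \<omega>) i) \<in> borel_measurable M" for i
    by (rule measurable_compose[OF overflow_measurable]) simp
  have int: "integrable M (\<lambda>\<omega>. z ^ overflow b (x \<omega>) i)" for i
    by (rule integrable_const_bound[where B = 1]) (use z in \<open>auto simp: norm_power power_le_one\<close>)
  have G0: "Gk z 0 = (LINT \<omega>|M. z ^ overflow b (x \<omega>) 0)"
    using overflow_stationary[of z "-1"] by (simp add: Gk_def killed_def)
  have "(LINT \<omega>|M. z ^ overflow b (x \<omega>) 0) = (LINT \<omega>|M. killed z (Suc 0) \<omega> + (\<Sum>s<b. if inf_U b (x \<omega>) = s then 1 else 0))"
  proof (rule integral_cong_AE)
    show "AE \<omega> in M. z ^ overflow b (x \<omega>) 0 = killed z (Suc 0) \<omega> + (\<Sum>s<b. if inf_U b (x \<omega>) = s then 1 else 0)"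
      using AE_subcritical AE_ex_nonfull
    proof eventually_elim
      case (elim \<omega>)
      define h where "h = X 0 \<omega> + overflow b (x \<omega>) (- 1)"
      have H: "inf_H b (x \<omega>) 0 = int h"
        using inf_H_step[OF elim(1), of "-1"] by (simp add: h_def)
      have o: "overflow b (x \<omega>) 0 = h - b" by (simp add: overflow_def H)
      have full: "inf_full b (x \<omega>) 0 \<longleftrightarrow> b \<le> h" by (simp add: inf_full_def H)
      have S: "(\<Sum>s<b. if inf_U b (x \<omega>) = s then 1 else 0) = (\<Sum>s<b. if s = h then 1 else 0 :: complex)"
        by (intro sum.cong refl if_cong)
          (use inf_U_eq_block_iff[OF elim(1) b elim(2), of _ 0] in \<open>auto simp: H\<close>)
      show ?case unfolding S by (simp add: killed_def full o sum.delta)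
    qed
    show "(\<lambda>\<omega>. z ^ overflow b (x \<omega>) 0) \<in> borel_measurable M" by (rule m)
    show "(\<lambda>\<omega>. killed z (Suc 0) \<omega> + (\<Sum>s<b. if inf_U b (x \<omega>) = s then 1 else 0)) \<in> borel_measurable M"
      by measurable
  qed
  also have "\<dots> = Gk z (Suc 0) + (\<Sum>s<b. of_real (pU s))"
    unfolding Bochner_Integration.integral_add[OF killed_integrable[OF z]
        Bochner_Integration.integrable_sum[OF integral_indicator_pU(1)]]
      Bochner_Integration.integral_sum[OF integral_indicator_pU(1)] integral_indicator_pU(2) Gk_def by simp
  finally have "z ^ b * Gk z 0 = z ^ b * Gk z (Suc 0) + (\<Sum>s<b. of_real (pU s) * z ^ b)"
    unfolding G0 by (simp add: distrib_left sum_distrib_left mult.commute)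
  moreover have "Gk z 0 * exp (of_real lam * (z - 1)) = z ^ b * Gk z (Suc 0) + (\<Sum>y<b. of_real (pU y) * z ^ y)"
    using Gk_step[OF z, of 0] by simp
  ultimately show ?thesis
    by (simp add: algebra_simps sum_subtractf)
qed

end

section \<open>Roots of the kernel\<close>

definition root_unity :: "nat \<Rightarrow> complex" where
  "root_unity b = exp (2 * of_real pi * \<i> / of_nat b)"

lemma root_unity_power: "root_unity b ^ l = exp (2 * of_real pi * \<i> * of_nat l / of_nat b)"
  unfolding root_unity_def by (simp add: exp_of_nat_mult[symmetric] mult_ac)

lemma root_unity_power_order: "b \<ge> 1 \<Longrightarrow> (root_unity b ^ l) ^ b = 1"
  unfolding root_unity_power by (rule complex_root_unity) auto

lemma norm_root_unity_power: "norm (root_unity b ^ l) = 1"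
  by (simp add: root_unity_def norm_power)

lemma bij_betw_root_unity:
  assumes "b \<ge> 1"
  shows "bij_betw (\<lambda>l. root_unity b ^ l) {..<b} {t. t ^ b = 1}"
proof -
  have "bij_betw (\<lambda>k. cis (2 * pi * real k / real b)) {..<b} {z. z ^ b = 1}"
    using assms by (intro Complex.bij_betw_roots_unity) auto
  moreover have "cis (2 * pi * real k / real b) = root_unity b ^ k" for k
    unfolding root_unity_power cis_conv_exp by (simp add: mult_ac)
  ultimately show ?thesis by simp
qed

locale tree_root =
  fixes b :: nat and \<alpha> :: real and rt :: "complex \<Rightarrow> complex"
  assumes b_pos: "b \<ge> 1" and alpha: "0 < \<alpha>" "\<alpha> < 1"
    and rt: "\<And>z. rt z ^ b = z" "rt 1 = 1"
begin

lemma zeta_altdef: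
  "zeta b \<alpha> rt l w = tree_fun (root_unity b ^ l * of_real (\<alpha> * exp (- \<alpha>)) * rt w) / of_real \<alpha>"
  by (simp add: zeta_def root_unity_def)

lemma norm_rt_le:
  assumes "norm w \<le> 1"
  shows "norm (rt w) \<le> 1"
proof (rule ccontr)
  assume "\<not> norm (rt w) \<le> 1"
  hence "1 < norm (rt w) ^ b" using b_pos by (intro one_less_power) auto
  thus False using assms rt(1)[of w] by (simp flip: norm_power)
qed

lemma norm_arg_le:
  assumes "norm w \<le> 1"
  shows "norm (root_unity b ^ l * of_real (\<alpha> * exp (- \<alpha>)) * rt w) \<le> \<alpha> * exp (- \<alpha>)"
  using norm_rt_le[OF assms] alpha
  by (simp add: norm_mult norm_root_unity_power mult_left_le)

lemma norm_zeta_le: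
  assumes "norm w \<le> 1"
  shows "norm (zeta b \<alpha> rt l w) \<le> 1"
  using norm_tree_fun_le[OF _ alpha(2) norm_arg_le[OF assms, of l]] alpha
  by (simp add: zeta_altdef norm_divide)

text \<open>The functional equation of the tree function says \<open>\<zeta> = root_unity b ^ l * rt
  w * exp (\<alpha> * (\<zeta> - 1))\<close>; taking the \<open>b\<close>-th power removes the
  choice of the root.\<close>

lemma zeta_root:
  assumes "norm w \<le> 1"
  shows "zeta b \<alpha> rt l w ^ b = w * exp (of_real (\<alpha> * real b) * (zeta b \<alpha> rt l w - 1))"
proof -
  define arg where "arg = root_unity b ^ l * of_real (\<alpha> * exp (- \<alpha>)) * rt w"
  define \<zeta> where "\<zeta> = zeta b \<alpha> rt l w"
  have T: "tree_fun arg = of_real \<alpha> * \<zeta>" using alpha by (simp add: \<zeta>_def zeta_altdef arg_def)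
  have "norm arg \<le> exp (-1)"
    using norm_arg_le[OF assms, of l] mul_exp_neg_le[of \<alpha>] alpha by (simp add: arg_def)
  from tree_fun_eq[OF this] have "of_real \<alpha> * \<zeta> * exp (- (of_real \<alpha> * \<zeta>)) = arg" by (simp add: T)
  hence "of_real \<alpha> * \<zeta> = arg * exp (of_real \<alpha> * \<zeta>)"
    by (metis exp_minus_inverse mult.assoc mult.right_neutral mult.commute)
  hence "of_real \<alpha> * \<zeta> = of_real \<alpha> * (root_unity b ^ l * rt w * (exp (- of_real \<alpha>) * exp (of_real \<alpha> * \<zeta>)))"
    by (simp add: arg_def exp_of_real[symmetric] mult_ac)
  hence "\<zeta> = root_unity b ^ l * rt w * exp (of_real \<alpha> * (\<zeta> - 1))"
    using alpha by (simp add: exp_add[symmetric] algebra_simps)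
  hence "\<zeta> ^ b = (root_unity b ^ l * rt w * exp (of_real \<alpha> * (\<zeta> - 1))) ^ b" by simp
  also have "\<dots> = w * exp (of_nat b * (of_real \<alpha> * (\<zeta> - 1)))"
    unfolding exp_of_nat_mult
    by (simp add: power_mult_distrib root_unity_power_order[OF b_pos] rt(1))
  finally show ?thesis by (simp add: \<zeta>_def mult_ac)
qed

text \<open>The tree function is injective because \<open>t * exp (- t)\<close> inverts it, so
  distinct roots of unity give distinct values; at \<open>w = 0\<close> they would all
  coincide.\<close>

lemma zeta_inj:
  assumes "norm w \<le> 1" "w \<noteq> 0"
  shows "inj_on (\<lambda>l. zeta b \<alpha> rt l w) {..<b}"
proof (rule inj_onI)
  fix i j assume ij: "i \<in> {..<b}" "j \<in> {..<b}" "zeta b \<alpha> rt i w = zeta b \<alpha> rt j w"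
  have le: "norm (root_unity b ^ l * of_real (\<alpha> * exp (- \<alpha>)) * rt w) \<le> exp (-1)" for l
    using norm_arg_le[OF assms(1), of l] mul_exp_neg_le[of \<alpha>] alpha by simp
  have "rt w \<noteq> 0" using rt(1)[of w] assms(2) b_pos by (auto simp: power_0_left)
  moreover have "root_unity b ^ i * of_real (\<alpha> * exp (- \<alpha>)) * rt w = root_unity b ^ j * of_real (\<alpha> * exp (- \<alpha>)) * rt w"
    by (rule tree_fun_inj[OF le le]) (use ij alpha in \<open>simp add: zeta_altdef\<close>)
  ultimately have "root_unity b ^ i = root_unity b ^ j" using alpha by simp
  thus "i = j" using bij_betw_root_unity[OF b_pos] ij by (auto simp: bij_betw_def inj_on_def)
qed

lemma zeta_0_1: "zeta b \<alpha> rt 0 1 = 1"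
  using tree_fun_mul_exp[of \<alpha>] alpha by (simp add: zeta_altdef rt(2))

end

context poisson_model
begin

lemma pU_le_1: "pU u \<le> 1" by (simp add: pU_def)

lemma summable_block:
  fixes w :: complex
  assumes "norm w < 1"
  shows "summable (\<lambda>j. w ^ j * of_real (pU (b * j + y)))"
proof (rule summable_comparison_test'[of "\<lambda>j. norm w ^ j"])
  show "summable (\<lambda>j. norm w ^ j)" using assms by (intro summable_geometric) auto
  show "norm (w ^ j * of_real (pU (b * j + y))) \<le> norm w ^ j" for j
    using pU_nonneg pU_le_1 by (simp add: norm_mult norm_power mult_left_le)
qed

text \<open>Here \<open>w\<close> marks the full buckets passed; keeping it apart from the variable
  \<open>z\<close> of the last bucket lets \<open>w\<close> be fixed while the polynomial in
  \<open>z\<close> is factored.\<close>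

definition block_gf :: "complex \<Rightarrow> nat \<Rightarrow> complex" where
  "block_gf w y = (\<Sum>j. w ^ j * of_real (pU (b * j + y)))"

lemma block_gf_sums:
  assumes "norm w < 1"
  shows "(\<lambda>j. w ^ j * (\<Sum>y<b. of_real (pU (b * j + y)) * z ^ y)) sums (\<Sum>y<b. block_gf w y * z ^ y)"
proof -
  have "(\<lambda>j. \<Sum>y<b. (w ^ j * of_real (pU (b * j + y))) * z ^ y) sums (\<Sum>y<b. block_gf w y * z ^ y)"
    unfolding block_gf_def by (intro sums_sum sums_mult2 summable_sums summable_block assms)
  thus ?thesis by (simp add: sum_distrib_left mult.assoc)
qed

text \<open>At a root of \<open>z ^ b = w * exp (lam * (z - 1))\<close> the recursion telescopes.\<close>
lemma block_gf_at_root: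
  assumes z: "norm z \<le> 1" and w: "norm w < 1" and root: "z ^ b = w * exp (of_real lam * (z - 1))"
  shows "(\<Sum>y<b. block_gf w y * z ^ y) = Gk z 0 * exp (of_real lam * (z - 1))"
proof -
  define e where "e = exp (of_real lam * (z - 1))"
  have step: "w ^ j * (\<Sum>y<b. of_real (pU (b * j + y)) * z ^ y) = e * (w ^ j * Gk z j) - e * (w ^ Suc j * Gk z (Suc j))" for j
  proof -
    define S where "S = (\<Sum>y<b. of_real (pU (b * j + y)) * z ^ y)"
    have "Gk z j * e = (w * e) * Gk z (Suc j) + S"
      using Gk_step[OF z, of j] unfolding e_def[symmetric] S_def[symmetric] root[folded e_def] .
    hence "S = Gk z j * e - (w * e) * Gk z (Suc j)" by simp
    hence "w ^ j * S = w ^ j * (Gk z j * e - (w * e) * Gk z (Suc j))" by (simp only:)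
    thus ?thesis unfolding S_def[symmetric] by (simp add: algebra_simps)
  qed
  have "(\<Sum>j<n. w ^ j * (\<Sum>y<b. of_real (pU (b * j + y)) * z ^ y)) = e * Gk z 0 - e * (w ^ n * Gk z n)" for n
    unfolding step by (subst sum_lessThan_telescope') simp
  moreover have "(\<lambda>n. e * Gk z 0 - e * (w ^ n * Gk z n)) \<longlonglongrightarrow> e * Gk z 0 - e * 0"
  proof (intro tendsto_intros)
    have "(\<lambda>n. norm w ^ n) \<longlonglongrightarrow> 0" using w by (intro LIMSEQ_power_zero) auto
    thus "(\<lambda>n. w ^ n * Gk z n) \<longlonglongrightarrow> 0"
      by (rule Lim_null_comparison[rotated])
        (use norm_Gk_le[OF z] in \<open>auto simp: norm_mult norm_power mult_left_le\<close>)
  qed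
  ultimately have "(\<lambda>j. w ^ j * (\<Sum>y<b. of_real (pU (b * j + y)) * z ^ y)) sums (e * Gk z 0)"
    by (simp add: sums_def)
  from sums_unique2[OF this block_gf_sums[OF w]] show ?thesis by (simp add: e_def mult.commute)
qed

definition p_nonfull :: complex where "p_nonfull = (\<Sum>s<b. of_real (pU s))"

lemma Gk_0_equation':
  assumes z: "norm z \<le> 1"
  shows "Gk z 0 * (z ^ b - exp (of_real lam * (z - 1))) = p_nonfull * z ^ b - (\<Sum>s<b. of_real (pU s) * z ^ s)"
  using Gk_0_equation[OF z] by (simp add: p_nonfull_def right_diff_distrib sum_subtractf sum_distrib_right)

end

section \<open>Factorisation at the kernel roots and the constant \<open>T0\<close>\<close>

locale poisson_tree = poisson_model M b \<alpha> X + tree_root b \<alpha> rt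
  for M :: "'a measure" and b \<alpha> X rt
begin

text \<open>The kernel equation with \<open>w = 1\<close>: at its roots the left-hand side of
  \<open>Gk_0_equation'\<close> vanishes.\<close>

lemma factor_1:
  "p_nonfull * z ^ b - (\<Sum>s<b. of_real (pU s) * z ^ s) = p_nonfull * (\<Prod>l<b. z - zeta b \<alpha> rt l 1)"
proof -
  have "p_nonfull * z ^ b + (\<Sum>s<b. (- of_real (pU s)) * z ^ s) = p_nonfull * (\<Prod>l<b. z - zeta b \<alpha> rt l 1)"
  proof (rule poly_factor_distinct_roots)
    fix l assume "l < b"
    let ?z = "zeta b \<alpha> rt l 1"
    have "?z ^ b = exp (of_real lam * (?z - 1))" using zeta_root[of 1 l] by (simp add: lam_def)
    thus "p_nonfull * ?z ^ b + (\<Sum>s<b. (- of_real (pU s)) * ?z ^ s) = 0"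
      using Gk_0_equation'[OF norm_zeta_le[of 1 l]] by (simp add: sum_negf)
  qed (rule zeta_inj, auto)
  thus ?thesis by (simp add: sum_negf)
qed

text \<open>With \<open>G = Gk z 0\<close> and \<open>e = exp (lam * (z - 1))\<close>, at a root the
  telescoped sum contributes \<open>(1 - w) * G * e\<close> and stationarity
  \<open>G * (z ^ b - e)\<close>; together this is \<open>G * (z ^ b - w * e) = 0\<close>. The added
  stationarity polynomial is subtracted again by \<open>factor_1\<close>.\<close>

lemma block_gf_formula:
  assumes w: "norm w < 1" "w \<noteq> 0"
  shows "(1 - w) * (\<Sum>y<b. block_gf w y * z ^ y) =
    p_nonfull * ((\<Prod>l<b. z - zeta b \<alpha> rt l w) - (\<Prod>l<b. z - zeta b \<alpha> rt l 1))"
proof -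
  have w1: "norm w \<le> 1" using w by simp
  have "p_nonfull * z ^ b + (\<Sum>s<b. ((1 - w) * block_gf w s - of_real (pU s)) * z ^ s) =
    p_nonfull * (\<Prod>l<b. z - zeta b \<alpha> rt l w)"
  proof (rule poly_factor_distinct_roots)
    fix l assume "l < b"
    let ?z = "zeta b \<alpha> rt l w"
    have root: "?z ^ b = w * exp (of_real lam * (?z - 1))" using zeta_root[OF w1, of l] by (simp add: lam_def)
    have "(\<Sum>s<b. ((1 - w) * block_gf w s - of_real (pU s)) * ?z ^ s) =
      (1 - w) * (\<Sum>s<b. block_gf w s * ?z ^ s) - (\<Sum>s<b. of_real (pU s) * ?z ^ s)"
      by (simp add: left_diff_distrib sum_subtractf sum_distrib_left mult.assoc)
    also have "\<dots> = (1 - w) * (Gk ?z 0 * exp (of_real lam * (?z - 1))) - (\<Sum>s<b. of_real (pU s) * ?z ^ s)"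
      by (simp only: block_gf_at_root[OF norm_zeta_le[OF w1] w(1) root])
    also have "(\<Sum>s<b. of_real (pU s) * ?z ^ s) = p_nonfull * ?z ^ b - Gk ?z 0 * (?z ^ b - exp (of_real lam * (?z - 1)))"
      using Gk_0_equation'[OF norm_zeta_le[OF w1, of l]] by (simp add: algebra_simps)
    finally show "p_nonfull * ?z ^ b + (\<Sum>s<b. ((1 - w) * block_gf w s - of_real (pU s)) * ?z ^ s) = 0"
      unfolding root by (simp add: algebra_simps)
  qed (rule zeta_inj[OF w1 w(2)])
  moreover have "(\<Sum>s<b. ((1 - w) * block_gf w s - of_real (pU s)) * z ^ s) =
      (1 - w) * (\<Sum>s<b. block_gf w s * z ^ s) - (\<Sum>s<b. of_real (pU s) * z ^ s)"
    by (simp add: left_diff_distrib sum_subtractf sum_distrib_left mult.assoc)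
  moreover have "S = A - B" if "p + D = A" "D = S - S'" "p - S' = B" for p D A S S' B :: complex
    using that by (auto simp: algebra_simps)
  ultimately show ?thesis unfolding right_diff_distrib using factor_1[of z] by blast
qed

text \<open>Both sides of the stationarity equation vanish at \<open>z = 1\<close>; after division
  by \<open>z - 1\<close> the left one tends to the derivative \<open>b - lam\<close> of the kernel,
  since \<open>Gk z 0\<close> tends to 1.\<close>

lemma p_nonfull_eq: "p_nonfull = T0 b \<alpha> rt"
proof -
  \<comment> \<open>Points inside the unit disc, because the equation is available only for
    \<open>norm z \<le> 1\<close>; they avoid 1 so that division is possible.\<close>
  define t where "t n = 1 - 1 / (real n + 2)" for n :: nat
  define z where "z n = complex_of_real (t n)" for n
  define P where "P z = (\<Prod>l\<in>{1..<b}. z - zeta b \<alpha> rt l 1)" for z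
  have t: "0 < t n" "t n < 1" for n by (auto simp: t_def field_simps)
  have z1: "norm (z n) \<le> 1" "z n \<noteq> 1" for n using t[of n] by (auto simp: z_def)
  have "t \<longlonglongrightarrow> 1" unfolding t_def by real_asymp
  hence zlim: "z \<longlonglongrightarrow> 1" unfolding z_def by (metis tendsto_of_real of_real_1)
  have split: "{..<b} = insert 0 {1..<b}" using b by auto
  have eq: "Gk (z n) 0 * ((z n ^ b - exp (of_real lam * (z n - 1))) / (z n - 1)) = p_nonfull * P (z n)" for n
  proof -
    have "Gk (z n) 0 * (z n ^ b - exp (of_real lam * (z n - 1))) = p_nonfull * ((z n - 1) * P (z n))"
    proof -
      have "(\<Prod>l<b. z n - zeta b \<alpha> rt l 1) = (z n - 1) * P (z n)"
        unfolding split by (simp add: P_def zeta_0_1)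
      thus ?thesis unfolding Gk_0_equation'[OF z1(1)] factor_1 by simp
    qed
    thus ?thesis using z1(2)[of n] by (simp add: field_simps)
  qed
  have "(\<lambda>n. Gk (z n) 0) \<longlonglongrightarrow> (LINT \<omega>|M. 1)"
    unfolding Gk_def
  proof (rule integral_dominated_convergence[where w = "\<lambda>_. 1"])
    show "AE \<omega> in M. (\<lambda>n. killed (z n) 0 \<omega>) \<longlonglongrightarrow> 1"
    proof (rule AE_I2)
      fix \<omega>
      have "(\<lambda>n. z n ^ overflow b (x \<omega>) (- 1)) \<longlonglongrightarrow> 1 ^ overflow b (x \<omega>) (- 1)"
        by (intro tendsto_power zlim)
      thus "(\<lambda>n. killed (z n) 0 \<omega>) \<longlonglongrightarrow> 1" by (simp add: killed_def)
    qed
  qed (auto simp: norm_killed_le z1)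
  hence G1: "(\<lambda>n. Gk (z n) 0) \<longlonglongrightarrow> 1" by (simp add: prob_space)
  have "((\<lambda>u. u ^ b - exp (of_real lam * (u - 1))) has_field_derivative (of_nat b - of_real lam)) (at (1::complex))"
    by (auto intro!: derivative_eq_intros)
  hence "((\<lambda>u. (u ^ b - exp (of_real lam * (u - 1)) - (1 ^ b - exp (of_real lam * (1 - 1)))) / (u - 1)) \<longlongrightarrow> of_nat b - of_real lam) (at (1::complex))"
    by (simp add: has_field_derivative_iff)
  hence "((\<lambda>u. (u ^ b - exp (of_real lam * (u - 1))) / (u - 1)) \<longlongrightarrow> of_nat b - of_real lam) (at (1::complex))"
    by simp
  moreover have "filterlim z (at 1) sequentially"
    unfolding filterlim_at using zlim z1 by auto
  ultimately have "(\<lambda>n. (z n ^ b - exp (of_real lam * (z n - 1))) / (z n - 1)) \<longlonglongrightarrow> of_nat b - of_real lam"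
    by (rule filterlim_compose)
  hence "(\<lambda>n. p_nonfull * P (z n)) \<longlonglongrightarrow> 1 * (of_nat b - of_real lam)"
    unfolding eq[symmetric] by (intro tendsto_mult G1)
  moreover have "(\<lambda>n. p_nonfull * P (z n)) \<longlonglongrightarrow> p_nonfull * P 1"
    unfolding P_def by (intro tendsto_intros zlim)
  ultimately have "p_nonfull * P 1 = of_nat b - of_real lam"
    using LIMSEQ_unique by fastforce
  also have "\<dots> = of_nat b * (1 - of_real \<alpha>)" by (simp add: lam_def algebra_simps)
  finally have *: "p_nonfull * P 1 = of_nat b * (1 - of_real \<alpha>)" .
  moreover have "of_nat b * (1 - of_real \<alpha>) \<noteq> (0::complex)"
  proof -
    have "complex_of_real (1 - \<alpha>) \<noteq> 0" unfolding of_real_eq_0_iff using \<alpha> by simp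
    thus ?thesis using b by simp
  qed
  \<comment> \<open>The equation just derived shows by itself that the denominator of
    \<open>T0\<close> is nonzero.\<close>
  ultimately have "P 1 \<noteq> 0" by auto
  thus ?thesis using * by (simp add: T0_def P_def field_simps)
qed

lemma pgf_small:
  assumes q: "norm q < 1" "q \<noteq> 0" and s: "summable (\<lambda>u. of_real (pU u) * q ^ u)"
  shows "(1 - q ^ b) * (\<Sum>u. of_real (pU u) * q ^ u) =
    T0 b \<alpha> rt * ((\<Prod>l<b. q - zeta b \<alpha> rt l (q ^ b)) - (\<Prod>l<b. q - zeta b \<alpha> rt l 1))"
proof -
  have w: "norm (q ^ b) < 1" "q ^ b \<noteq> 0"
    using q b by (auto simp: norm_power power_less_one_iff)
  have "(\<lambda>j. \<Sum>u\<in>{j * b..<j * b + b}. of_real (pU u) * q ^ u) sums (\<Sum>u. of_real (pU u) * q ^ u)"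
    by (rule sums_group[OF summable_sums[OF s]]) (use b in auto)
  moreover have "(\<Sum>u\<in>{j * b..<j * b + b}. of_real (pU u) * q ^ u) =
      (q ^ b) ^ j * (\<Sum>y<b. of_real (pU (b * j + y)) * q ^ y)" for j
  proof -
    have "(\<Sum>u\<in>{j * b..<j * b + b}. of_real (pU u) * q ^ u) = (\<Sum>y\<in>{0..<b}. of_real (pU (y + j * b)) * q ^ (y + j * b))"
      using sum.shift_bounds_nat_ivl[of "\<lambda>u. of_real (pU u) * q ^ u" 0 "j * b" b] by (simp add: add.commute)
    thus ?thesis
      by (simp add: sum_distrib_left power_add power_mult atLeast0LessThan mult_ac add.commute)
  qed
  ultimately have "(\<lambda>j. (q ^ b) ^ j * (\<Sum>y<b. of_real (pU (b * j + y)) * q ^ y)) sums (\<Sum>u. of_real (pU u) * q ^ u)"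
    by simp
  from sums_unique2[OF this block_gf_sums[OF w(1)]] show ?thesis
    using block_gf_formula[OF w, of q] by (simp add: p_nonfull_eq)
qed

end

section \<open>Analytic continuation\<close>

text \<open>Rounding \<open>u\<close> down to a multiple of \<open>b\<close> costs at most one
  block, hence the factor \<open>1 / r ^ b\<close>.\<close>

lemma power_mult_div_le:
  fixes r :: real
  assumes "0 < r" "r < 1" "b \<ge> 1"
  shows "r ^ (b * (u div b)) \<le> r ^ u / r ^ b"
proof -
  have "u \<le> b * (u div b) + b"
    using mult_div_mod_eq[of b u] mod_less_divisor[of b u] assms(3) by linarith
  hence "r ^ (b * (u div b) + b) \<le> r ^ u"
    using assms by (intro power_decreasing) auto
  thus ?thesis using assms by (simp add: power_add pos_le_divide_eq)
qed

context tree_root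
begin

definition radius :: real where "radius = exp (\<alpha> - 1) / \<alpha>"

lemma radius_eq: "radius = 1 / rho \<alpha>"
  by (simp add: radius_def rho_def exp_diff field_simps)

lemma radius_gt_1: "radius > 1"
  using rho_bounds[OF alpha] by (simp add: radius_eq)

lemma radius_arg: "\<alpha> * exp (- \<alpha>) * radius = exp (-1)"
  using alpha by (simp add: radius_def exp_diff exp_minus field_simps)

text \<open>Indexed by the roots of unity themselves and with \<open>q\<close> in place of
  \<open>rt (q ^ b)\<close>: the arbitrary, possibly discontinuous \<open>rt\<close> disappears and
  the product is visibly holomorphic.\<close>

definition zeta_prod :: "complex \<Rightarrow> complex" where
  "zeta_prod q = (\<Prod>t\<in>{t. t ^ b = 1}. q - tree_fun (t * of_real (\<alpha> * exp (- \<alpha>)) * q) / of_real \<alpha>)"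

text \<open>Since \<open>rt (q ^ b) / q\<close> is a root of unity, another choice of the root permutes the factors.\<close>
lemma prod_zeta: "(\<Prod>l<b. q - zeta b \<alpha> rt l (q ^ b)) = zeta_prod q"
proof -
  let ?F = "\<lambda>t. q - tree_fun (t * of_real (\<alpha> * exp (- \<alpha>)) * rt (q ^ b)) / of_real \<alpha>"
  have "(\<Prod>l<b. q - zeta b \<alpha> rt l (q ^ b)) = (\<Prod>l<b. ?F (root_unity b ^ l))"
    by (simp add: zeta_altdef)
  also have "\<dots> = (\<Prod>t\<in>{t. t ^ b = 1}. ?F t)"
    by (rule prod.reindex_bij_betw[OF bij_betw_root_unity[OF b_pos]])
  also have "\<dots> = zeta_prod q"
  proof (cases "q = 0")
    case True
    have "rt (0 ^ b) = 0" using rt(1)[of 0] b_pos by (simp add: power_0_left)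
    thus ?thesis using True by (simp add: zeta_prod_def)
  next
    case False
    define s where "s = rt (q ^ b) / q"
    have s: "s ^ b = 1" using rt(1)[of "q ^ b"] False by (simp add: s_def power_divide)
    hence s0: "s \<noteq> 0" using b_pos by (auto simp: power_0_left)
    have "rt (q ^ b) = s * q" using False by (simp add: s_def)
    thus ?thesis unfolding zeta_prod_def
      by (intro prod.reindex_bij_witness[of _ "\<lambda>t. t / s" "\<lambda>t. t * s"])
        (use s s0 in \<open>auto simp: power_mult_distrib power_divide mult_ac\<close>)
  qed
  finally show ?thesis .
qed

lemma zeta_prod_arg:
  fixes t q :: complex
  assumes "t ^ b = 1"
  shows "norm (t * of_real (\<alpha> * exp (- \<alpha>)) * q) = \<alpha> * exp (- \<alpha>) * norm q"
proof -
  have "norm t ^ b = 1" using assms norm_power[of t b] by simp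
  hence "norm t = 1" using b_pos power_eq_imp_eq_base[of "norm t" b 1] by simp
  thus ?thesis using alpha by (simp add: norm_mult)
qed

lemma zeta_prod_continuous: "continuous_on (cball 0 radius) zeta_prod"
  unfolding zeta_prod_def
proof (intro continuous_intros continuous_on_compose2[OF tree_fun_continuous])
  fix t assume "t \<in> {t::complex. t ^ b = 1}"
  hence t: "t ^ b = 1" by simp
  show "(\<lambda>q. t * of_real (\<alpha> * exp (- \<alpha>)) * q) ` cball 0 radius \<subseteq> cball 0 (exp (-1))"
  proof safe
    fix q :: complex assume "q \<in> cball 0 radius"
    hence "\<alpha> * exp (- \<alpha>) * norm q \<le> \<alpha> * exp (- \<alpha>) * radius"
      using alpha by (intro mult_left_mono) auto
    thus "t * of_real (\<alpha> * exp (- \<alpha>)) * q \<in> cball 0 (exp (-1))"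
      using zeta_prod_arg[OF t, of q] radius_arg by simp
  qed
qed (use alpha in auto)

lemma zeta_prod_holomorphic: "zeta_prod holomorphic_on ball 0 radius"
  unfolding zeta_prod_def
proof (intro holomorphic_intros)
  fix t assume "t \<in> {t::complex. t ^ b = 1}"
  hence t: "t ^ b = 1" by simp
  have "(tree_fun \<circ> (\<lambda>q. t * of_real (\<alpha> * exp (- \<alpha>)) * q)) holomorphic_on ball 0 radius"
  proof (rule holomorphic_on_compose_gen[OF _ tree_fun_holomorphic])
    show "(\<lambda>q. t * of_real (\<alpha> * exp (- \<alpha>)) * q) ` ball 0 radius \<subseteq> ball 0 (exp (-1))"
    proof safe
      fix q :: complex assume "q \<in> ball 0 radius"
      hence "\<alpha> * exp (- \<alpha>) * norm q < \<alpha> * exp (- \<alpha>) * radius"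
        using alpha by (intro mult_strict_left_mono) auto
      thus "t * of_real (\<alpha> * exp (- \<alpha>)) * q \<in> ball 0 (exp (-1))"
        using zeta_prod_arg[OF t, of q] radius_arg by simp
    qed
  qed (intro holomorphic_intros)
  thus "(\<lambda>q. tree_fun (t * of_real (\<alpha> * exp (- \<alpha>)) * q)) holomorphic_on ball 0 radius"
    by (simp add: o_def)
qed (use alpha in auto)

end

lemma norm_power_neq_1: "norm (q::complex) > 1 \<Longrightarrow> b \<ge> 1 \<Longrightarrow> q ^ b \<noteq> 1"
  by (metis less_le_trans less_numeral_extra(1) linorder_not_less norm_one norm_power one_less_power order_refl)

context poisson_tree
begin

definition psi :: "complex \<Rightarrow> complex" where "psi q = (\<Sum>u. of_real (pU u) * q ^ u)"

lemma pU_le: "pU u \<le> rho \<alpha> ^ u / (rho \<alpha> ^ b * (1 - rho \<alpha>))"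
proof -
  have "pU u \<le> rho \<alpha> ^ (b * (u div b)) / (1 - rho \<alpha>)"
    unfolding pU_def by (rule prob_inf_U_le)
  also have "\<dots> \<le> (rho \<alpha> ^ u / rho \<alpha> ^ b) / (1 - rho \<alpha>)"
    using rho_bounds[OF \<alpha>] b by (intro divide_right_mono power_mult_div_le) auto
  finally show ?thesis by simp
qed

lemma summable_pU:
  assumes "0 \<le> y" "y < radius"
  shows "summable (\<lambda>u. pU u * y ^ u)"
proof (rule summable_comparison_test')
  have r: "0 < rho \<alpha>" "rho \<alpha> < 1" using rho_bounds[OF \<alpha>] by auto
  have "rho \<alpha> * y < 1" using assms r by (simp add: radius_eq field_simps)
  thus "summable (\<lambda>u. (rho \<alpha> * y) ^ u * (1 / (rho \<alpha> ^ b * (1 - rho \<alpha>))))"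
    using r assms by (intro summable_mult2 summable_geometric) auto
  show "norm (pU u * y ^ u) \<le> (rho \<alpha> * y) ^ u * (1 / (rho \<alpha> ^ b * (1 - rho \<alpha>)))" for u
    using mult_right_mono[OF pU_le[of u], of "y ^ u"] assms pU_nonneg[of u]
    by (simp add: power_mult_distrib)
qed

lemma summable_norm_pU:
  assumes "summable (\<lambda>u. pU u * norm q ^ u)"
  shows "summable (\<lambda>u. norm (of_real (pU u) * q ^ u :: complex))"
  using assms pU_nonneg by (simp add: norm_mult norm_power)

lemma psi_holomorphic: "psi holomorphic_on ball 0 radius"
proof (rule power_series_holomorphic)
  fix q :: complex assume "q \<in> ball 0 radius"
  hence "summable (\<lambda>u. norm (of_real (pU u) * q ^ u))"
    by (intro summable_norm_pU summable_pU) auto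
  thus "(\<lambda>u. of_real (pU u) * (q - 0) ^ u) sums psi q"
    unfolding psi_def by (simp add: summable_norm_cancel summable_sums)
qed

definition rhs :: "complex \<Rightarrow> complex" where
  "rhs q = T0 b \<alpha> rt * (zeta_prod q - (\<Prod>l<b. q - zeta b \<alpha> rt l 1))"

lemma rhs_continuous: "continuous_on (cball 0 radius) rhs"
  unfolding rhs_def by (intro continuous_intros zeta_prod_continuous)

text \<open>The formula is known on the unit disc without the origin, where the roots coincide; both
  sides are holomorphic up to \<open>radius\<close>.\<close>

lemma psi_eq_inside:
  assumes "norm q < radius"
  shows "(1 - q ^ b) * psi q = rhs q"
proof (rule analytic_continuation_open[of "ball 0 1 - {0}" "ball 0 radius" "\<lambda>q. (1 - q ^ b) * psi q" rhs])
  show "ball 0 1 - {0::complex} \<noteq> {}"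
  proof -
    have "1 / 2 \<in> ball 0 1 - {0::complex}" by simp
    thus ?thesis by blast
  qed
  show "(\<lambda>q. (1 - q ^ b) * psi q) holomorphic_on ball 0 radius"
    by (intro holomorphic_intros psi_holomorphic)
  show "rhs holomorphic_on ball 0 radius"
    unfolding rhs_def[abs_def] by (intro holomorphic_intros zeta_prod_holomorphic)
  fix z :: complex assume z: "z \<in> ball 0 1 - {0}"
  hence "summable (\<lambda>u. of_real (pU u) * z ^ u)"
    using radius_gt_1 by (intro summable_norm_cancel[OF summable_norm_pU] summable_pU) auto
  thus "(1 - z ^ b) * psi z = rhs z"
    using pgf_small[of z] z by (simp add: psi_def rhs_def prod_zeta)
qed (use radius_gt_1 assms in auto)

lemma summable_radius: "summable (\<lambda>u. pU u * radius ^ u)"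
proof (rule bounded_imp_summable)
  define f where "f r = Re (rhs (of_real r) / (1 - of_real r ^ b))" for r :: real
  have R0: "radius > 0" using radius_gt_1 by simp
  \<comment> \<open>Staying above 1 keeps \<open>1 - r ^ b\<close> nonzero.\<close>
  have ev: "eventually (\<lambda>r. r \<in> {1<..<radius}) (at_left radius)"
    using radius_gt_1 by (intro eventually_at_left_real) auto
  have lim: "(f \<longlongrightarrow> f radius) (at_left radius)"
  proof -
    have "(rhs \<longlongrightarrow> rhs (of_real radius)) (at (of_real radius) within cball 0 radius)"
      using rhs_continuous R0 by (auto simp: continuous_on_def)
    moreover have "filterlim complex_of_real (at (of_real radius) within cball 0 radius) (at_left radius)"
      unfolding filterlim_at
    proof
      show "eventually (\<lambda>r. complex_of_real r \<in> cball 0 radius \<and> complex_of_real r \<noteq> of_real radius) (at_left radius)"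
        using ev by eventually_elim auto
      show "(complex_of_real \<longlongrightarrow> of_real radius) (at_left radius)"
        by (intro tendsto_intros)
    qed
    ultimately have "((\<lambda>r. rhs (of_real r)) \<longlongrightarrow> rhs (of_real radius)) (at_left radius)"
      by (rule filterlim_compose)
    thus ?thesis unfolding f_def
      using norm_power_neq_1[of "of_real radius" b] radius_gt_1 b
      by (intro tendsto_intros) auto
  qed
  show "pU u * radius ^ u \<ge> 0" for u using pU_nonneg R0 by simp
  fix N
  show "(\<Sum>u\<le>N. pU u * radius ^ u) \<le> f radius"
  proof (rule tendsto_le[OF _ lim])
    show "((\<lambda>r. \<Sum>u\<le>N. pU u * r ^ u) \<longlongrightarrow> (\<Sum>u\<le>N. pU u * radius ^ u)) (at_left radius)"
      by (intro tendsto_intros)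
    show "eventually (\<lambda>r. (\<Sum>u\<le>N. pU u * r ^ u) \<le> f r) (at_left radius)"
      using ev
    proof eventually_elim
      case (elim r)
      have s: "summable (\<lambda>u. pU u * r ^ u)" by (rule summable_pU) (use elim in auto)
      have "psi (of_real r) = of_real (\<Sum>u. pU u * r ^ u)"
        unfolding psi_def using suminf_of_real[OF s, where 'a = complex] by simp
      moreover have "psi (of_real r) = rhs (of_real r) / (1 - of_real r ^ b)"
        using psi_eq_inside[of "of_real r"] norm_power_neq_1[of "of_real r" b] elim b
        by (simp add: field_simps)
      ultimately have "f r = (\<Sum>u. pU u * r ^ u)" by (simp add: f_def)
      moreover have "(\<Sum>u\<le>N. pU u * r ^ u) \<le> (\<Sum>u. pU u * r ^ u)"
        by (rule sum_le_suminf[OF s]) (use elim pU_nonneg in auto)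
      ultimately show ?case by simp
    qed
  qed simp
qed

lemma summable_pU_closed:
  assumes "0 \<le> y" "y \<le> radius"
  shows "summable (\<lambda>u. pU u * y ^ u)"
  by (rule summable_comparison_test'[OF summable_radius])
    (use assms pU_nonneg in \<open>auto intro!: mult_left_mono power_mono\<close>)

lemma psi_continuous: "continuous_on (cball 0 radius) psi"
proof -
  have "uniform_limit (cball 0 radius)
      (\<lambda>n q. \<Sum>u<n. of_real (pU u) * q ^ u) psi sequentially"
    unfolding psi_def[abs_def]
    by (rule Weierstrass_m_test[OF _ summable_radius])
      (auto simp: norm_mult norm_power pU_nonneg intro!: mult_left_mono power_mono)
  thus ?thesis
    by (rule uniform_limit_theorem[rotated]) (auto intro!: always_eventually continuous_intros)
qed

lemma psi_eq:
  assumes "norm q \<le> radius"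
  shows "(1 - q ^ b) * psi q = rhs q"
proof -
  have cl: "closure (ball (0::complex) radius) = cball 0 radius" using radius_gt_1 by (intro closure_ball) auto
  have "(1 - q ^ b) * psi q - rhs q = 0"
  proof (rule continuous_constant_on_closure[of "ball 0 radius" "\<lambda>q. (1 - q ^ b) * psi q - rhs q"])
    show "continuous_on (closure (ball 0 radius)) (\<lambda>q. (1 - q ^ b) * psi q - rhs q)"
      unfolding cl by (intro continuous_intros psi_continuous rhs_continuous)
  qed (use assms in \<open>auto simp: cl psi_eq_inside\<close>)
  thus ?thesis by simp
qed

lemma psi_formula:
  assumes "norm q \<le> radius" "q ^ b \<noteq> 1"
  shows "psi q = T0 b \<alpha> rt * ((\<Prod>l<b. q - zeta b \<alpha> rt l (q ^ b)) - (\<Prod>l<b. q - zeta b \<alpha> rt l 1)) / (1 - q ^ b)"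
  using psi_eq[OF assms(1)] assms(2) by (simp add: rhs_def prod_zeta field_simps)

end

section \<open>Convergence\<close>

text \<open>On a countable space a probability measure is carried by its atoms, which is the
  condition for being a \<open>pmf\<close>.\<close>

lemma (in prob_space) law_pmf_exists:
  assumes U: "U \<in> measurable M (count_space (UNIV :: nat set))"
  shows "\<exists>p. measure_pmf p = distr M (count_space UNIV) U"
proof -
  define D where "D = distr M (count_space UNIV) U"
  interpret D: prob_space D unfolding D_def by (rule prob_space_distr[OF U])
  have sets: "sets D = UNIV" by (simp add: D_def)
  have "AE y in D. \<forall>u. y = u \<longrightarrow> measure D {u} \<noteq> 0"
    unfolding AE_all_countable
  proof
    fix u
    show "AE y in D. y = u \<longrightarrow> measure D {u} \<noteq> 0"
    proof (cases "measure D {u} = 0")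
      case True
      hence "AE y in D. y \<notin> {u}"
        by (intro AE_not_in) (simp add: null_sets_def sets D.emeasure_eq_measure)
      thus ?thesis by eventually_elim auto
    qed simp
  qed
  hence "AE y in D. measure D {y} \<noteq> 0" by eventually_elim auto
  hence "measure_pmf (Abs_pmf D) = D"
    using D.prob_space_axioms sets by (intro Abs_pmf_inverse) auto
  thus ?thesis by (auto simp: D_def)
qed

text \<open>One term of the exponential series of \<open>real u * ln y\<close>; it lets moments be
  dominated by a geometric weight.\<close>

lemma power_le_fact_mult_power:
  fixes y :: real
  assumes "y > 1"
  shows "real u ^ j \<le> (fact j / ln y ^ j) * y ^ u"
proof -
  define z where "z = real u * ln y"
  have ly: "ln y > 0" using assms by simp
  have z: "z \<ge> 0" using ly by (simp add: z_def)
  have "z ^ j / fact j \<le> (\<Sum>k. z ^ k / fact k)"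
    using sum_le_suminf[of "\<lambda>k. z ^ k / fact k" "{j}"] summable_exp_generic[of z] z
    by (simp add: divide_inverse mult.commute)
  also have "\<dots> = exp z" by (simp add: exp_def divide_inverse mult.commute)
  also have "\<dots> = y ^ u" using assms by (simp add: z_def exp_of_nat_mult)
  finally have "z ^ j \<le> fact j * y ^ u" by (simp add: field_simps)
  thus ?thesis using ly by (simp add: z_def power_mult_distrib field_simps)
qed

lemma summable_geometric_times_power:
  fixes r :: real
  assumes "0 < r" "r < 1"
  shows "summable (\<lambda>u. r ^ u * real u ^ j)"
proof -
  define y where "y = (1 + 1 / r) / 2"
  have y: "y > 1" "r * y < 1" using assms by (auto simp: y_def field_simps)
  show ?thesis
  proof (rule summable_comparison_test')
    show "summable (\<lambda>u. (r * y) ^ u * (fact j / ln y ^ j))"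
      using y assms by (intro summable_mult2 summable_geometric) auto
    show "norm (r ^ u * real u ^ j) \<le> (r * y) ^ u * (fact j / ln y ^ j)" for u
      using mult_left_mono[OF power_le_fact_mult_power[OF y(1), of u j], of "r ^ u"] assms
      by (simp add: power_mult_distrib mult_ac)
  qed
qed

lemma summable_pmf_weight:
  fixes f :: "nat \<Rightarrow> 'b :: {banach, second_countable_topology}"
  assumes "\<And>u. pmf p u \<le> C * r ^ u" "summable (\<lambda>u. r ^ u * w u)" "\<And>u. norm (f u) \<le> w u"
  shows "summable (\<lambda>u. pmf p u * norm (f u))"
proof (rule summable_comparison_test'[OF summable_mult[OF assms(2), of C]])
  fix u
  have "pmf p u * norm (f u) \<le> (C * r ^ u) * w u"
  proof (rule mult_mono[OF assms(1,3)])
    show "0 \<le> C * r ^ u" using pmf_nonneg assms(1) by (rule order_trans)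
  qed simp
  thus "norm (pmf p u * norm (f u)) \<le> C * (r ^ u * w u)" by (simp add: mult.assoc)
qed

text \<open>The bound involves \<open>f\<close> only through its majorant \<open>w\<close>, so one
  estimate serves all \<open>q\<close> in a disc and yields uniform convergence.\<close>

lemma norm_expectation_diff_le:
  fixes f :: "nat \<Rightarrow> 'b :: {banach, second_countable_topology}"
  assumes P: "\<And>u. pmf P u \<le> C * r ^ u" and p: "\<And>u. pmf p u \<le> C * r ^ u"
    and w: "summable (\<lambda>u. r ^ u * w u)" and f: "\<And>u. norm (f u) \<le> w u"
  shows "norm (measure_pmf.expectation P f - measure_pmf.expectation p f)
    \<le> (\<Sum>u. \<bar>pmf P u - pmf p u\<bar> * w u)"
proof -
  have sP: "summable (\<lambda>u. pmf P u * norm (f u))" by (rule summable_pmf_weight[OF P w f])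
  have sp: "summable (\<lambda>u. pmf p u * norm (f u))" by (rule summable_pmf_weight[OF p w f])
  have w0: "w u \<ge> 0" for u using f[of u] norm_ge_zero order_trans by blast
  have wP: "summable (\<lambda>u. pmf P u * norm (w u))" by (rule summable_pmf_weight[OF P w]) (use w0 in auto)
  have wp: "summable (\<lambda>u. pmf p u * norm (w u))" by (rule summable_pmf_weight[OF p w]) (use w0 in auto)
  have ws: "summable (\<lambda>u. \<bar>pmf P u - pmf p u\<bar> * w u)"
  proof (rule summable_comparison_test'[OF summable_add[OF wP wp]])
    fix u
    have "\<bar>pmf P u - pmf p u\<bar> \<le> pmf P u + pmf p u"
      using pmf_nonneg[of P u] pmf_nonneg[of p u] by linarith
    from mult_right_mono[OF this w0[of u]]
    show "norm (\<bar>pmf P u - pmf p u\<bar> * w u) \<le> pmf P u * norm (w u) + pmf p u * norm (w u)"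
      using w0[of u] by (simp add: distrib_right)
  qed
  have s1: "summable (\<lambda>u. pmf P u *\<^sub>R f u)" by (rule summable_norm_cancel) (use sP in simp)
  have s2: "summable (\<lambda>u. pmf p u *\<^sub>R f u)" by (rule summable_norm_cancel) (use sp in simp)
  have "measure_pmf.expectation P f - measure_pmf.expectation p f = (\<Sum>u. pmf P u *\<^sub>R f u - pmf p u *\<^sub>R f u)"
    by (simp add: integral_pmf_nat[OF sP] integral_pmf_nat[OF sp] suminf_diff[OF s1 s2])
  also have "\<dots> = (\<Sum>u. (pmf P u - pmf p u) *\<^sub>R f u)" by (simp add: scaleR_left_diff_distrib)
  also have "norm \<dots> \<le> (\<Sum>u. \<bar>pmf P u - pmf p u\<bar> * w u)"
    by (rule norm_suminf_le[OF _ ws]) (auto intro: mult_left_mono f)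
  finally show ?thesis .
qed

text \<open>Tannery's theorem: the geometric tails, valid for all large \<open>k\<close> at once,
  allow the limit to be taken term by term.\<close>

lemma pmf_weighted_distance_tendsto:
  fixes P :: "nat \<Rightarrow> nat pmf"
  assumes conv: "\<And>u. (\<lambda>k. pmf (P k) u) \<longlonglongrightarrow> pmf p u"
    and P: "eventually (\<lambda>k. \<forall>u. pmf (P k) u \<le> C * r ^ u) sequentially"
    and p: "\<And>u. pmf p u \<le> C * r ^ u"
    and w: "summable (\<lambda>u. r ^ u * w u)" "\<And>u. w u \<ge> 0"
  shows "(\<lambda>k. \<Sum>u. \<bar>pmf (P k) u - pmf p u\<bar> * w u) \<longlonglongrightarrow> 0"
proof -
  have "(\<lambda>k. \<Sum>u. \<bar>pmf (P k) u - pmf p u\<bar> * w u) \<longlonglongrightarrow> (\<Sum>u::nat. 0)"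
  proof (rule conjunct2[OF conjunct2[OF tannerys_theorem[where M = "\<lambda>u. C * (r ^ u * w u)"]]])
    show "(\<lambda>k. \<bar>pmf (P k) u - pmf p u\<bar> * w u) \<longlonglongrightarrow> 0" for u
    proof -
      have "(\<lambda>k. \<bar>pmf (P k) u - pmf p u\<bar> * w u) \<longlonglongrightarrow> \<bar>pmf p u - pmf p u\<bar> * w u"
        by (intro tendsto_intros conv)
      thus ?thesis by simp
    qed
    show "summable (\<lambda>u. C * (r ^ u * w u))" by (intro summable_mult w)
    have "eventually (\<lambda>(u::nat, k). \<forall>u. pmf (P k) u \<le> C * r ^ u) (sequentially \<times>\<^sub>F sequentially)"
      by (subst eventually_prod2) (use P in auto)
    thus "eventually (\<lambda>(u, k). norm (\<bar>pmf (P k) u - pmf p u\<bar> * w u) \<le> C * (r ^ u * w u)) (sequentially \<times>\<^sub>F sequentially)"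
    proof eventually_elim
      case (elim uk)
      obtain u k where uk: "uk = (u, k)" by (cases uk)
      have "\<bar>pmf (P k) u - pmf p u\<bar> \<le> C * r ^ u"
      proof -
        have "pmf (P k) u \<le> C * r ^ u" using elim by (simp add: uk)
        thus ?thesis
          using p[of u] pmf_nonneg[of "P k" u] pmf_nonneg[of p u] unfolding abs_le_iff by linarith
      qed
      from mult_right_mono[OF this w(2)[of u]] show ?case
        using w(2)[of u] by (simp add: uk abs_mult mult.assoc)
    qed
  qed simp
  thus ?thesis by simp
qed

text \<open>The distribution function at any \<open>t\<close> is a finite sum of point masses, so it
  converges at jumps as well.\<close>

lemma weak_conv_m_pmf_nat:
  fixes P :: "nat \<Rightarrow> nat pmf"
  assumes conv: "\<And>u. (\<lambda>k. pmf (P k) u) \<longlonglongrightarrow> pmf p u"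
  shows "weak_conv_m (\<lambda>k. distr (measure_pmf (P k)) borel real) (distr (measure_pmf p) borel real)"
proof -
  have cdf: "cdf (distr (measure_pmf q) borel real) t = (\<Sum>u\<in>{u. real u \<le> t}. pmf q u)" for q :: "nat pmf" and t
  proof -
    have fin: "finite {u. real u \<le> t}"
      by (rule finite_subset[of _ "{..nat \<lfloor>t\<rfloor>}"]) (auto simp: le_nat_floor)
    have "cdf (distr (measure_pmf q) borel real) t = measure_pmf.prob q {u. real u \<le> t}"
      unfolding cdf_def2 by (subst measure_distr) (auto simp: vimage_def)
    thus ?thesis using fin by (simp add: measure_measure_pmf_finite)
  qed
  show ?thesis unfolding weak_conv_m_def weak_conv_def cdf
    by (auto intro!: tendsto_sum conv)
qed

context poisson_tree
begin

lemma pmf_law: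
  assumes "measure_pmf p = distr M (count_space UNIV) (\<lambda>\<omega>. inf_U b (x \<omega>))"
  shows "pmf p u = pU u"
proof -
  have "pmf p u = measure (distr M (count_space UNIV) (\<lambda>\<omega>. inf_U b (x \<omega>))) {u}"
    by (simp add: measure_pmf_single flip: assms)
  also have "\<dots> = pU u"
    unfolding pU_def by (subst measure_distr) (auto intro!: arg_cong[of _ _ prob])
  finally show ?thesis .
qed

text \<open>The depth \<open>K\<close> is fixed first, by the two coupling errors, whose bounds do
  not depend on \<open>k\<close>; only then does \<open>k\<close> grow, so that the probability of
  the truncated event converges.\<close>

lemma prob_exact_U_tendsto:
  fixes m n s :: "nat \<Rightarrow> nat" and a :: real
  assumes less: "\<And>k. n k < b * m k" "\<And>k. s k < m k"
    and m: "filterlim m at_top sequentially" and n: "filterlim n at_top sequentially"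
    and mn: "(\<lambda>k. n k / m k) \<longlonglongrightarrow> lam"
    and a: "0 < a" "a < 1" "eventually (\<lambda>k. n k \<le> a * b * m k) sequentially"
  shows "(\<lambda>k. measure_pmf.prob (hash_addresses (m k) (n k)) {hs. exact_U b (m k) (s k) hs = u}) \<longlonglongrightarrow> pU u"
proof (rule LIMSEQ_I)
  fix e :: real assume e: "e > 0"
  have e3: "0 < e / 3" using e by simp
  note order_tendstoD(2)[OF rho_power_tendsto[OF a(1,2) b] e3] order_tendstoD(2)[OF rho_power_tendsto[OF \<alpha> b] e3]
  hence "eventually (\<lambda>K. rho a ^ (b * K) / (1 - rho a) < e / 3 \<and> rho \<alpha> ^ (b * K) / (1 - rho \<alpha>) < e / 3) sequentially"
    by eventually_elim auto
  then obtain K where K: "rho a ^ (b * K) / (1 - rho a) < e / 3" "rho \<alpha> ^ (b * K) / (1 - rho \<alpha>) < e / 3"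
    by (auto simp: eventually_sequentially)
  let ?W = "\<lambda>k. measure_pmf.prob (hash_addresses (m k) (n k))
       {hs. ends_at b 0 (\<lambda>i. count_list hs ((s k + m k - K + i) mod m k)) K u}"
  have "?W \<longlonglongrightarrow> window_prob b lam K u"
    by (rule prob_window_tendsto[OF m n mn lam_pos b])
  hence "eventually (\<lambda>k. \<bar>?W k - window_prob b lam K u\<bar> < e / 3) sequentially"
    using e unfolding tendsto_iff dist_real_def by (meson divide_pos_pos zero_less_numeral)
  moreover have "eventually (\<lambda>k. K \<le> m k) sequentially"
    using m by (simp add: filterlim_at_top)
  ultimately have "eventually (\<lambda>k. norm (measure_pmf.prob (hash_addresses (m k) (n k)) {hs. exact_U b (m k) (s k) hs = u} - pU u) < e) sequentially"
    using a(3)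
  proof eventually_elim
    case (elim k)
    have "\<bar>measure_pmf.prob (hash_addresses (m k) (n k)) {hs. exact_U b (m k) (s k) hs = u} - ?W k\<bar> < e / 3"
      using prob_exact_U_approx[OF less(1) b less(2) elim(2) a(1,2) elim(3), of u] K(1) by linarith
    moreover have "\<bar>pU u - window_prob b lam K u\<bar> < e / 3"
      using prob_inf_U_approx[of u K] K(2) unfolding pU_def by linarith
    ultimately show ?case using elim(1) unfolding real_norm_def by linarith
  qed
  thus "\<exists>no. \<forall>k\<ge>no. norm (measure_pmf.prob (hash_addresses (m k) (n k)) {hs. exact_U b (m k) (s k) hs = u} - pU u) < e"
    by (simp add: eventually_sequentially)
qed

end

theorem theorem11p6:
  fixes b :: nat and \<alpha> :: real
    and M :: "'a measure" and X :: "int \<Rightarrow> 'a \<Rightarrow> nat"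
    and rt :: "complex \<Rightarrow> complex"
    and U :: "'a \<Rightarrow> nat"
  assumes b: "b \<ge> 1" and \<alpha>: "0 < \<alpha>" "\<alpha> < 1"
    and rt: "\<And>z. rt z ^ b = z" "rt 1 = 1"
    and M: "prob_space M"
    and indep: "prob_space.indep_vars M (\<lambda>_. count_space UNIV) X UNIV"
    and poisson: "\<And>i. distr M (count_space UNIV) (X i) = measure_pmf (poisson_pmf (\<alpha> * real b))"
  defines "U \<equiv> \<lambda>\<omega>. inf_U b (\<lambda>i. X i \<omega>)"
  shows
    "U \<in> measurable M (count_space UNIV)
     \<and> (\<forall>q::complex. norm q \<le> exp (\<alpha> - 1) / \<alpha> \<longrightarrow> integrable M (\<lambda>\<omega>. q ^ U \<omega>))
     \<and> (\<forall>q::complex. norm q \<le> exp (\<alpha> - 1) / \<alpha> \<and> q ^ b \<noteq> 1 \<longrightarrow>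
          pgf M U q =
            T0 b \<alpha> rt
            * ((\<Prod>l<b. q - zeta b \<alpha> rt l (q ^ b)) - (\<Prod>l<b. q - zeta b \<alpha> rt l 1))
            / (1 - q ^ b))
     \<and> (\<forall>r::nat. integrable M (\<lambda>\<omega>. real (U \<omega>) ^ r))
     \<and> (\<exists>\<delta>>0. 1 + \<delta> \<le> exp (\<alpha> - 1) / \<alpha> \<and>
          (\<forall>m n s :: nat \<Rightarrow> nat.
             (\<forall>k. n k < b * m k) \<and> (\<forall>k. s k < m k)
             \<and> filterlim m at_top sequentially \<and> filterlim n at_top sequentially
             \<and> (\<lambda>k. real (n k) / (real b * real (m k))) \<longlonglongrightarrow> \<alpha>
             \<longrightarrow>
             weak_conv_m
               (\<lambda>k. distr (measure_pmf (hash_addresses (m k) (n k))) borel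
                       (\<lambda>hs. real (exact_U b (m k) (s k) hs)))
               (distr M borel (\<lambda>\<omega>. real (U \<omega>)))
             \<and> (\<forall>r::nat.
                  (\<lambda>k. measure_pmf.expectation (hash_addresses (m k) (n k))
                         (\<lambda>hs. real (exact_U b (m k) (s k) hs) ^ r))
                  \<longlonglongrightarrow> (LINT \<omega>|M. real (U \<omega>) ^ r))
             \<and> uniform_limit (cball 0 (1 + \<delta>))
                 (\<lambda>k. pgf (measure_pmf (hash_addresses (m k) (n k))) (exact_U b (m k) (s k)))
                 (pgf M U) sequentially))"
proof -
  interpret prob_space M by (rule M)
  interpret poisson_tree M b \<alpha> X rt
    by unfold_locales (use b \<alpha> rt indep poisson in auto)
  have U: "U \<in> measurable M (count_space UNIV)"
    unfolding U_def by (rule inf_U_measurable)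
  obtain p where p: "measure_pmf p = distr M (count_space UNIV) U"
    using law_pmf_exists[OF U] by auto
  have pmf_p: "pmf p u = pU u" for u
    by (rule pmf_law) (use p in \<open>simp add: U_def\<close>)
  have int_iff: "integrable M (\<lambda>\<omega>. f (U \<omega>)) \<longleftrightarrow> summable (\<lambda>u. pU u * norm (f u))"
    for f :: "nat \<Rightarrow> 'c :: {banach, second_countable_topology}"
  proof -
    have "integrable M (\<lambda>\<omega>. f (U \<omega>)) \<longleftrightarrow> integrable (measure_pmf p) f"
      unfolding p by (subst integrable_distr_eq[OF U]) auto
    thus ?thesis by (simp add: integrable_pmf_nat_iff pmf_p)
  qed
  have int_eq: "(LINT \<omega>|M. f (U \<omega>)) = measure_pmf.expectation p f"
    for f :: "nat \<Rightarrow> 'c :: {banach, second_countable_topology}"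
    unfolding p by (subst integral_distr[OF U]) auto
  have R: "exp (\<alpha> - 1) / \<alpha> = radius" by (simp add: radius_def)

  \<comment> \<open>Any number strictly between \<open>\<alpha>\<close> and 1 would do: the loads,
    which tend to \<open>\<alpha>\<close>, are eventually below it.\<close>
  define a where "a = (1 + \<alpha>) / 2"
  have a: "0 < a" "a < 1" "\<alpha> < a" using \<alpha> by (auto simp: a_def)
  \<comment> \<open>A decay rate common to both models.\<close>
  define r where "r = max (rho \<alpha>) (rho a)"
  have r: "0 < r" "r < 1" "rho \<alpha> \<le> r" "rho a \<le> r"
    using rho_bounds[OF \<alpha>] rho_bounds[OF a(1,2)] by (auto simp: r_def)
  \<comment> \<open>Halfway between 1 and \<open>1 / r\<close>, so that \<open>r * y < 1\<close>;
    the witness for \<open>\<delta>\<close> is \<open>y - 1\<close>.\<close>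
  define y where "y = (1 + 1 / r) / 2"
  have y: "y > 1" "r * y < 1" "y \<le> 1 / r" using r by (auto simp: y_def field_simps)
  have yR: "y \<le> radius"
  proof -
    have "1 / r \<le> 1 / rho \<alpha>" using r rho_bounds[OF \<alpha>] by (intro divide_left_mono) auto
    thus ?thesis using y by (simp add: radius_eq)
  qed
  define C where "C = 1 / (r ^ b * (1 - r))"
  have bound: "t \<le> C * r ^ u" if "t \<le> rho c ^ (b * (u div b)) / (1 - rho c)" "rho c \<le> r" "0 < rho c" for t c u
  proof -
    have "t \<le> rho c ^ (b * (u div b)) / (1 - rho c)" by fact
    also have "\<dots> \<le> r ^ (b * (u div b)) / (1 - r)"
      using r that by (intro frac_le power_mono) auto
    also have "\<dots> \<le> (r ^ u / r ^ b) / (1 - r)"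
      using r b by (intro divide_right_mono power_mult_div_le) auto
    finally show ?thesis by (simp add: C_def)
  qed
  have p_le: "pmf p u \<le> C * r ^ u" for u
    unfolding pmf_p pU_def by (rule bound[OF prob_inf_U_le]) (use r rho_bounds[OF \<alpha>] in auto)
  have w_pow: "summable (\<lambda>u. r ^ u * y ^ u)"
    using r y by (simp add: power_mult_distrib[symmetric])
  have w_mom: "summable (\<lambda>u. r ^ u * real u ^ j)" for j
    using r by (intro summable_geometric_times_power)

  have 1: "integrable M (\<lambda>\<omega>. q ^ U \<omega>)" if "norm q \<le> radius" for q :: complex
    unfolding int_iff using summable_pU_closed[of "norm q"] that by (simp add: norm_power)
  have 2: "pgf M U q = psi q" if "norm q \<le> radius" for q
  proof -
    have "summable (\<lambda>u. pmf p u * norm (q ^ u))"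
      using summable_pU_closed[of "norm q"] that by (simp add: norm_power pmf_p)
    from integral_pmf_nat[OF this] show ?thesis
      by (simp add: pgf_def int_eq psi_def pmf_p scaleR_conv_of_real)
  qed
  have 3: "integrable M (\<lambda>\<omega>. real (U \<omega>) ^ j)" for j
    unfolding int_iff[of "\<lambda>u. real u ^ j"] pmf_p[symmetric]
    by (rule summable_pmf_weight[OF p_le w_mom]) auto

  have conv: "weak_conv_m (\<lambda>k. distr (measure_pmf (hash_addresses (m k) (n k))) borel
                       (\<lambda>hs. real (exact_U b (m k) (s k) hs))) (distr M borel (\<lambda>\<omega>. real (U \<omega>)))
       \<and> (\<forall>j. (\<lambda>k. measure_pmf.expectation (hash_addresses (m k) (n k))
                         (\<lambda>hs. real (exact_U b (m k) (s k) hs) ^ j)) \<longlonglongrightarrow> (LINT \<omega>|M. real (U \<omega>) ^ j))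
       \<and> uniform_limit (cball 0 (1 + (y - 1)))
                 (\<lambda>k. pgf (measure_pmf (hash_addresses (m k) (n k))) (exact_U b (m k) (s k)))
                 (pgf M U) sequentially"
    if less: "\<And>k. n k < b * m k" "\<And>k. s k < m k"
      and m: "filterlim m at_top sequentially" and n: "filterlim n at_top sequentially"
      and load: "(\<lambda>k. real (n k) / (real b * real (m k))) \<longlonglongrightarrow> \<alpha>"
    for m n s :: "nat \<Rightarrow> nat"
  proof -
    define P where "P k = map_pmf (exact_U b (m k) (s k)) (hash_addresses (m k) (n k))" for k
    have m0: "m k > 0" for k using less(2)[of k] by simp
    have mn: "(\<lambda>k. n k / m k) \<longlonglongrightarrow> lam"
    proof -
      have "(\<lambda>k. b * (real (n k) / (real b * real (m k)))) \<longlonglongrightarrow> b * \<alpha>"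
        by (intro tendsto_intros load)
      thus ?thesis using b by (simp add: lam_def mult.commute)
    qed
    have ev: "eventually (\<lambda>k. n k \<le> a * b * m k) sequentially"
      using order_tendstoD(2)[OF load a(3)]
    proof eventually_elim
      case (elim k)
      thus ?case using m0[of k] b by (simp add: field_simps)
    qed
    have pmf_P: "pmf (P k) u = measure_pmf.prob (hash_addresses (m k) (n k)) {hs. exact_U b (m k) (s k) hs = u}" for k u
      by (simp add: P_def pmf_map vimage_def)
    have Pconv: "(\<lambda>k. pmf (P k) u) \<longlonglongrightarrow> pmf p u" for u
      unfolding pmf_P pmf_p by (rule prob_exact_U_tendsto[OF less m n mn a(1,2) ev])
    have P_le: "eventually (\<lambda>k. \<forall>u. pmf (P k) u \<le> C * r ^ u) sequentially"
      using ev
    proof eventually_elim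
      case (elim k)
      show ?case unfolding pmf_P
        by (intro allI bound[OF prob_exact_U_le[OF less(1) b less(2) a(1,2) elim]])
          (use r rho_bounds[OF a(1,2)] in auto)
    qed
    have lim: "(\<lambda>k. measure_pmf.expectation (P k) f) \<longlonglongrightarrow> measure_pmf.expectation p f"
      if w: "summable (\<lambda>u. r ^ u * w u)" "\<And>u. norm (f u) \<le> w u" for f :: "nat \<Rightarrow> real" and w
    proof -
      have w0: "w u \<ge> 0" for u using w(2)[of u] norm_ge_zero order_trans by blast
      have "(\<lambda>k. measure_pmf.expectation (P k) f - measure_pmf.expectation p f) \<longlonglongrightarrow> 0"
      proof (rule Lim_null_comparison[OF _ pmf_weighted_distance_tendsto[OF Pconv P_le p_le w(1) w0]])
        show "eventually (\<lambda>k. norm (measure_pmf.expectation (P k) f - measure_pmf.expectation p f) \<le>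
            (\<Sum>u. \<bar>pmf (P k) u - pmf p u\<bar> * w u)) sequentially"
          using P_le by eventually_elim (rule norm_expectation_diff_le[OF _ p_le w], auto)
      qed
      thus ?thesis by (simp add: LIM_zero_iff)
    qed
    have "weak_conv_m (\<lambda>k. distr (measure_pmf (P k)) borel real) (distr (measure_pmf p) borel real)"
      by (rule weak_conv_m_pmf_nat[OF Pconv])
    moreover have "distr (measure_pmf (P k)) borel real =
       distr (measure_pmf (hash_addresses (m k) (n k))) borel (\<lambda>hs. real (exact_U b (m k) (s k) hs))" for k
      unfolding P_def map_pmf_rep_eq by (subst distr_distr) (auto simp: o_def)
    moreover have "distr (measure_pmf p) borel real = distr M borel (\<lambda>\<omega>. real (U \<omega>))"
      unfolding p by (subst distr_distr[OF _ U]) (auto simp: o_def)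
    ultimately have W: "weak_conv_m (\<lambda>k. distr (measure_pmf (hash_addresses (m k) (n k))) borel
         (\<lambda>hs. real (exact_U b (m k) (s k) hs))) (distr M borel (\<lambda>\<omega>. real (U \<omega>)))"
      by simp
    have mom: "(\<lambda>k. measure_pmf.expectation (hash_addresses (m k) (n k))
         (\<lambda>hs. real (exact_U b (m k) (s k) hs) ^ j)) \<longlonglongrightarrow> (LINT \<omega>|M. real (U \<omega>) ^ j)" for j
      using lim[OF w_mom[of j], of "\<lambda>u. real u ^ j"] by (simp add: P_def int_eq[of "\<lambda>u. real u ^ j"])
    have "uniform_limit (cball 0 (1 + (y - 1)))
       (\<lambda>k. pgf (measure_pmf (hash_addresses (m k) (n k))) (exact_U b (m k) (s k))) (pgf M U) sequentially"
      unfolding uniform_limit_iff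
    proof (intro allI impI)
      fix e :: real assume e: "e > 0"
      have "(\<lambda>k. \<Sum>u. \<bar>pmf (P k) u - pmf p u\<bar> * y ^ u) \<longlonglongrightarrow> 0"
        by (rule pmf_weighted_distance_tendsto[OF Pconv P_le p_le w_pow]) (use y in auto)
      hence "eventually (\<lambda>k. (\<Sum>u. \<bar>pmf (P k) u - pmf p u\<bar> * y ^ u) < e) sequentially"
        using e by (rule order_tendstoD(2))
      thus "eventually (\<lambda>k. \<forall>q\<in>cball 0 (1 + (y - 1)).
          dist (pgf (measure_pmf (hash_addresses (m k) (n k))) (exact_U b (m k) (s k)) q) (pgf M U q) < e) sequentially"
        using P_le
      proof eventually_elim
        case (elim k)
        show ?case
        proof
          fix q :: complex assume q: "q \<in> cball 0 (1 + (y - 1))"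
          have "norm (measure_pmf.expectation (P k) (\<lambda>u. q ^ u) - measure_pmf.expectation p (\<lambda>u. q ^ u))
              \<le> (\<Sum>u. \<bar>pmf (P k) u - pmf p u\<bar> * y ^ u)"
            by (rule norm_expectation_diff_le[OF _ p_le w_pow])
              (use elim q in \<open>auto simp: norm_power intro!: power_mono\<close>)
          thus "dist (pgf (measure_pmf (hash_addresses (m k) (n k))) (exact_U b (m k) (s k)) q) (pgf M U q) < e"
            using elim(1) by (simp add: pgf_def int_eq P_def dist_norm)
        qed
      qed
    qed
    with W mom show ?thesis by blast
  qed
  have "\<exists>\<delta>>0. 1 + \<delta> \<le> radius \<and>
          (\<forall>m n s :: nat \<Rightarrow> nat.
             (\<forall>k. n k < b * m k) \<and> (\<forall>k. s k < m k)
             \<and> filterlim m at_top sequentially \<and> filterlim n at_top sequentially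
             \<and> (\<lambda>k. real (n k) / (real b * real (m k))) \<longlonglongrightarrow> \<alpha>
             \<longrightarrow>
             weak_conv_m
               (\<lambda>k. distr (measure_pmf (hash_addresses (m k) (n k))) borel
                       (\<lambda>hs. real (exact_U b (m k) (s k) hs)))
               (distr M borel (\<lambda>\<omega>. real (U \<omega>)))
             \<and> (\<forall>r::nat.
                  (\<lambda>k. measure_pmf.expectation (hash_addresses (m k) (n k))
                         (\<lambda>hs. real (exact_U b (m k) (s k) hs) ^ r))
                  \<longlonglongrightarrow> (LINT \<omega>|M. real (U \<omega>) ^ r))
             \<and> uniform_limit (cball 0 (1 + \<delta>))
                 (\<lambda>k. pgf (measure_pmf (hash_addresses (m k) (n k))) (exact_U b (m k) (s k)))
                 (pgf M U) sequentially)"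
    using y yR by (intro exI[of _ "y - 1"], intro conjI, simp, simp) (intro allI impI, elim conjE, rule conv, blast+)
  thus ?thesis
    unfolding R using U 1 2 3 psi_formula by auto
qed

end
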